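(* Let $\chi$ be a primitive Dirichlet character modulo $q>1$. For $n\in\mathbb N_0$ let $a_n(\chi)$ be defined by $\xi\left(\tfrac12+is,\chi\right)=\sum_{n=0}^\infty i^na_n(\chi)s^n$, let $\mu\in\mathbb N_0$ be the least nonnegative integer with $a_\mu(\chi)\ne0$, and let $$f(s,\chi)=s^{-2\mu}\,\xi\left(\tfrac12+is,\chi\right)\xi\left(\tfrac12+is,\overline\chi\right)=\sum_{n=0}^\infty(-1)^nb_n(\chi)s^{2n},$$ which is an even entire function with $b_0(\chi)\neq0$. For $k\in\mathbb N_0$ let $$m_k(\chi)=-\frac1{2\,(2k+3)!}\left(\frac{f'(s,\chi)}{f(s,\chi)}\right)^{(2k+3)}\bigg|_{s=0},$$ where $'$ and the higher derivatives are with respect to $s$. Then: (i) For every $n\in\mathbb N_0$, $m_n(\chi)$ is $(-1)^n$ times the determinant of the $(n+1)\times(n+1)$ matrix obtained from the lower triangular Toeplitz matrix $\left(b_{i-j}(\chi)/b_0(\chi)\right)_{0\le i,j\le n}$ (with $b_r(\chi)=0$ for $r<0$) by replacing its last column by the column with entries $\frac{b_1(\chi)b_{i+1}(\chi)}{b_0^2(\chi)}-\frac{(i+2)b_{i+2}(\chi)}{b_0(\chi)}$, $0\le i\le n$. (ii) For every $n\in\mathbb N_0$, $$(-1)^nm_n(\chi)=\frac{b_1(\chi)b_{n+1}(\chi)}{b_0^2(\chi)}-\frac{(n+2)b_{n+2}(\chi)}{b_0(\chi)}-\sum_{k=0}^{n-1}\frac{(-1)^km_k(\chi)b_{n-k}(\chi)}{b_0(\chi)}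 .$$ (iii) If $$\frac{b_n(\chi)}{b_0(\chi)}=\sum_{j=0}^{2n}(-1)^j\frac{a_{j+\mu}(\chi)}{a_\mu(\chi)}\frac{a_{2n-j+\mu}(\chi)}{a_\mu(\chi)}>0\qquad\forall n\in\mathbb N,$$ then the generalized Riemann hypothesis for $L(s,\chi)$ holds if and only if there exists a positive number $L>s_1^{-2}(\chi)$ such that $$\sum_{j=0}^k(-1)^j\binom kj\frac{m_{n+j}(\chi)}{L^{n+j}}\ge0\qquad\forall n,k\in\mathbb N_0,$$ where $s_1(\chi)>0$ is the zero of $f(s,\chi)$ with the smallest positive real part.
   Context: $\mathbb N=\{1,2,\dots\}$ and $\mathbb N_0=\{0,1,2,\dots\}$. For a primitive Dirichlet character $\chi$ modulo $q>1$ with parity $\kappa\in\{0,1\}$ (that is, $\chi(-1)=(-1)^\kappa$), $$\xi(s,\chi)=\left(\frac q\pi\right)^{(s+\kappa)/2}\Gamma\left(\frac{s+\kappa}2\right)L(s,\chi),$$ where $L(s,\chi)$ is the analytic continuation of $\sum_{n\ge1}\chi(n)n^{-s}$; $\xi(s,\chi)$ is an entire function of order $1$, and $\xi(\frac12+is,\chi)$ has all its zeros in $|\Im s|<\frac12$. Explicitly, $$a_n(\chi)=\frac1{n!}\int_{-\infty}^\infty y^n\varphi(y,\chi)\,dy,\qquad \varphi(y,\chi)=2\sum_{n=1}^\infty n^\kappa\chi(n)\exp\left(-\frac{n^2\pi}{q}e^{2y}+\left(\kappa+\tfrac12\right)y\right).$$ The generalized Riemann hypothesis for $L(s,\chi)$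 is the assertion that all zeros of $\xi(\frac12+is,\chi)$ are real, equivalently that all zeros of $f(s,\chi)$ are real. In part (iii) it is understood that the zero $s_1(\chi)$ of $f(s,\chi)$ of smallest positive real part is a positive real number. *)

theory Defs
  imports
    "HOL-Complex_Analysis.Complex_Analysis"
    "HOL-Library.Complex_Order"
    "Jordan_Normal_Form.Determinant"
begin

(* Inequalities between complex numbers are those of HOL-Library.Complex_Order:
   0 \<le> z means that z is real and nonnegative, 0 < z that z is real and positive. *)

definition dirichlet_character :: "nat \<Rightarrow> (int \<Rightarrow> complex) \<Rightarrow> bool" where
  "dirichlet_character q chi \<longleftrightarrow>
     q > 0 \<and>
     (\<forall>m n. chi (m * n) = chi m * chi n) \<and>
     (\<forall>n. chi (n + int q) = chi n) \<and>
     (\<forall>n. chi n \<noteq> 0 \<longleftrightarrow> coprime n (int q))"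

definition induced_from :: "nat \<Rightarrow> (int \<Rightarrow> complex) \<Rightarrow> nat \<Rightarrow> bool" where
  "induced_from q chi d \<longleftrightarrow>
     (\<exists>\<psi>. dirichlet_character d \<psi> \<and> (\<forall>n. coprime n (int q) \<longrightarrow> chi n = \<psi> n))"

definition primitive_character :: "nat \<Rightarrow> (int \<Rightarrow> complex) \<Rightarrow> bool" where
  "primitive_character q chi \<longleftrightarrow>
     dirichlet_character q chi \<and> (\<forall>d. d dvd q \<and> d < q \<longrightarrow> \<not> induced_from q chi d)"

definition conj_character :: "(int \<Rightarrow> complex) \<Rightarrow> int \<Rightarrow> complex" where
  "conj_character chi n = cnj (chi n)"

(* The exponent \<kappa> in {0, 1} with chi(-1) = (-1)^\<kappa>; a Dirichlet character has chi(-1) = 1 or -1. *)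
definition char_parity :: "(int \<Rightarrow> complex) \<Rightarrow> nat" where
  "char_parity chi = (if chi (-1) = 1 then 0 else 1)"

(* The entire continuation of the Dirichlet series, unique by the identity theorem.
   It exists for the primitive characters of modulus q > 1, since these are nonprincipal. *)
definition dirichlet_L :: "(int \<Rightarrow> complex) \<Rightarrow> complex \<Rightarrow> complex" where
  "dirichlet_L chi =
     (THE F. F holomorphic_on UNIV \<and>
        (\<forall>s. Re s > 1 \<longrightarrow>
           (\<lambda>n. chi (int (Suc n)) * of_nat (Suc n) powr (- s)) sums F s))"

(* The singularities at the poles of the Gamma factor are removable (they cancel against
   zeros of L), but in HOL the product takes the value 0 there because Gamma does. *)
definition xi :: "nat \<Rightarrow> (int \<Rightarrow> complex) \<Rightarrow> complex \<Rightarrow> complex" where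
  "xi q chi =
     remove_sings (\<lambda>s. of_real (real q / pi) powr ((s + of_nat (char_parity chi)) / 2)
                       * Gamma ((s + of_nat (char_parity chi)) / 2) * dirichlet_L chi s)"

definition xi_line :: "nat \<Rightarrow> (int \<Rightarrow> complex) \<Rightarrow> complex \<Rightarrow> complex" where
  "xi_line q chi s = xi q chi (1 / 2 + \<i> * s)"

(* Taylor coefficients normalised by xi_line q chi s = (\<Sum>n. \<i>^n * a_n * s^n). *)
definition xi_coeff :: "nat \<Rightarrow> (int \<Rightarrow> complex) \<Rightarrow> nat \<Rightarrow> complex" where
  "xi_coeff q chi n = (deriv ^^ n) (xi_line q chi) 0 / (fact n * \<i> ^ n)"

definition xi_order :: "nat \<Rightarrow> (int \<Rightarrow> complex) \<Rightarrow> nat" where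
  "xi_order q chi = (LEAST n. xi_coeff q chi n \<noteq> 0)"

(* remove_sings supplies the value at s = 0, where the quotient has a removable singularity. *)
definition xi_prod :: "nat \<Rightarrow> (int \<Rightarrow> complex) \<Rightarrow> complex \<Rightarrow> complex" where
  "xi_prod q chi =
     remove_sings (\<lambda>s. xi_line q chi s * xi_line q (conj_character chi) s
                       / s ^ (2 * xi_order q chi))"

(* Taylor coefficients normalised by xi_prod q chi s = (\<Sum>n. (-1)^n * b_n * s^(2*n)). *)
definition xi_prod_coeff :: "nat \<Rightarrow> (int \<Rightarrow> complex) \<Rightarrow> nat \<Rightarrow> complex" where
  "xi_prod_coeff q chi n = (-1) ^ n * (deriv ^^ (2 * n)) (xi_prod q chi) 0 / fact (2 * n)"

definition logderiv_moment :: "nat \<Rightarrow> (int \<Rightarrow> complex) \<Rightarrow> nat \<Rightarrow> complex" where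
  "logderiv_moment q chi k =
     - (1 / (2 * fact (2 * k + 3))) *
       (deriv ^^ (2 * k + 3)) (\<lambda>s. deriv (xi_prod q chi) s / xi_prod q chi s) 0"

definition GRH :: "nat \<Rightarrow> (int \<Rightarrow> complex) \<Rightarrow> bool" where
  "GRH q chi \<longleftrightarrow> (\<forall>s. xi_line q chi s = 0 \<longrightarrow> s \<in> \<real>)"

(* The zero of smallest positive real part, in the case that it is a positive real number. *)
definition is_first_zero :: "(complex \<Rightarrow> complex) \<Rightarrow> real \<Rightarrow> bool" where
  "is_first_zero f s1 \<longleftrightarrow>
     s1 > 0 \<and> f (of_real s1) = 0 \<and> (\<forall>z. f z = 0 \<and> Re z > 0 \<longrightarrow> s1 \<le> Re z)"

end

(* The completed L-function on the critical line is the Fourier-Laplace transform of a theta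
   kernel.  Poisson summation and the evaluation of Gauss sums show that the kernel decays like
   exp(-y^2), which yields that the transform is entire with growth exp(O(|s|^2)), together with
   the functional equation.

   If all zeros of f are real, divide f by the product of 1 - z/r over the zeros r with |r| <= R:
   Borel-Caratheodory, applied to the logarithm of the quotient on |z| < 2R, shows that the Taylor
   coefficients of f'/f of index N >= 2 are limits of -sum r^(-N-1) as R grows.  The moments are
   thus sums of powers of the numbers r^(-2) in (0, L], whose scaled differences are nonnegative.

   Conversely, nonnegativity of all differences bounds the Euler transforms of the moment
   sequence, and these continue its generating function to discs that touch 1 and fill the
   complement of [1, oo).  There f' = f h with h holomorphic, so f has no zero off the real
   axis. *)

theory Submission
  imports Defs "HOL-Probability.Probability" "HOL-Number_Theory.Residues"
begin

unbundle no vec_syntax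
no_notation Matrix.vec_index (infixl "$" 100)

section \<open>Analytic core of the moment criterion\<close>

text \<open>The bound exp(-y^2) is far weaker than the true decay of the kernel, and the growth it
  yields is weaker than order 1. It still suffices: the error in the coefficient of index N of f'/f
  is O(R^2) / R^(N+1), which vanishes for N >= 2, and the moments use only N = 2k + 3. So neither a
  Hadamard product nor a summability statement about the zeros enters. The converse likewise builds
  no measure as the Hausdorff moment theorem would: it suffices that the functional x^n -> c n is
  nonnegative on the polynomials x^n (1 - x)^k, which bounds it on powers of linear polynomials with
  complex coefficients. Much of the length has another cause: \<open>dirichlet_L\<close> is a
  definite description, about which nothing is known until an entire function with the right
  Dirichlet series is exhibited. The transform of the theta kernel, multiplied by the entire
  reciprocal Gamma function, is that witness. The functional equation then expresses the conjugate
  factor of f through X(-z), where X is \<open>xi_line q chi\<close>. This makes f even, and every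
  zero of f is a zero of X or the negative of one.\<close>

lemma Borel_Caratheodory_coeff:
  fixes H :: "complex \<Rightarrow> complex"
  assumes hol: "H holomorphic_on ball 0 R" and R: "R > 0" and n: "n > 0"
    and B: "\<And>z. z \<in> ball 0 R \<Longrightarrow> Re (H z) - Re (H 0) < B"
  shows "norm ((deriv ^^ n) H 0) \<le> fact n * (2 * B) / (R / 2) ^ n"
proof -
  have B0: "B > 0" using B[of 0] R by simp
  define w where "w = (\<lambda>z. H (of_real R * z) - H 0)"
  \<comment> \<open>The Moebius map w / (2B - w) sends the half plane Re w < B into the unit disc
    and fixes 0, because 0 and 2B are mirror images in the line Re w = B. This makes the Schwarz
    lemma applicable.\<close>
  define K where "K = (\<lambda>z. w z / (2 * of_real B - w z))"
  have mem: "of_real R * z \<in> ball 0 R" if "norm z < 1" for z :: complex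
    using that R by (simp add: norm_mult)
  have Re_w: "Re (w z) < B" if "norm z < 1" for z
    using B[OF mem[OF that]] by (simp add: w_def)
  have den: "2 * of_real B - w z \<noteq> 0" if "norm z < 1" for z
  proof
    assume "2 * of_real B - w z = 0"
    then have "Re (2 * of_real B - w z) = 0" by simp
    with Re_w[OF that] B0 show False by simp
  qed
  have lt: "norm (w z) < norm (2 * of_real B - w z)" if "norm z < 1" for z
  proof -
    have "(norm (2 * of_real B - w z))\<^sup>2 - (norm (w z))\<^sup>2 = 4 * B * (B - Re (w z))"
      unfolding cmod_power2 by (simp add: power2_eq_square algebra_simps)
    also have "\<dots> > 0" using Re_w[OF that] B0 by simp
    finally have "(norm (w z))\<^sup>2 < (norm (2 * of_real B - w z))\<^sup>2" by simp
    then show ?thesis by (rule power2_less_imp_less) simp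
  qed
  have holw: "w holomorphic_on ball 0 1"
  proof -
    have "(H \<circ> (\<lambda>z. of_real R * z)) holomorphic_on ball 0 1"
      by (rule holomorphic_on_compose_gen[OF _ hol]) (use mem in \<open>auto intro!: holomorphic_intros\<close>)
    then show ?thesis unfolding w_def comp_def by (intro holomorphic_intros)
  qed
  have holK: "K holomorphic_on ball 0 1"
    unfolding K_def by (intro holomorphic_intros holw) (use den in auto)
  have K0: "K 0 = 0" by (simp add: K_def w_def)
  have K1: "norm (K z) < 1" if "norm z < 1" for z
    using lt[OF that] den[OF that] by (simp add: K_def norm_divide divide_simps)
  have Kle: "norm (K z) \<le> norm z" if "norm z < 1" for z
    using Schwarz_Lemma(1)[OF holK K0 K1 that] by simp
  \<comment> \<open>On |z| = 1/2 the Schwarz lemma gives |w| <= (1/2) (2B + |w|), and solving for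
    |w| yields 2B. This bound feeds Cauchy's inequality on the circle of radius R/2.\<close>
  have wle: "norm (w z) \<le> 2 * B" if "norm z = 1/2" for z
  proof -
    have z: "norm z < 1" using that by simp
    have "norm (w z) = norm (K z) * norm (2 * of_real B - w z)"
      using den[OF z] by (simp add: K_def norm_divide)
    also have "\<dots> \<le> (1/2) * (2 * B + norm (w z))"
    proof (rule mult_mono)
      show "norm (K z) \<le> 1/2" using Kle[OF z] that by simp
      have "norm (2 * of_real B - w z) \<le> norm (2 * of_real B :: complex) + norm (w z)"
        by (rule norm_triangle_ineq4)
      then show "norm (2 * of_real B - w z) \<le> 2 * B + norm (w z)"
        using B0 by (simp add: norm_mult)
    qed auto
    finally show ?thesis by simp
  qed
  have sub: "cball 0 (R/2) \<subseteq> ball (0::complex) R" using R by auto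
  have holD: "(\<lambda>z. H z - H 0) holomorphic_on ball 0 R"
    by (intro holomorphic_intros hol)
  have bd: "norm ((deriv ^^ n) (\<lambda>z. H z - H 0) 0) \<le> fact n * (2 * B) / (R / 2) ^ n"
  proof (rule Cauchy_inequality)
    show "(\<lambda>z. H z - H 0) holomorphic_on ball 0 (R/2)"
      using holD by (rule holomorphic_on_subset) (use R in auto)
    show "continuous_on (cball 0 (R/2)) (\<lambda>z. H z - H 0)"
      using holomorphic_on_imp_continuous_on[OF holD] sub by (rule continuous_on_subset)
    show "norm (H z - H 0) \<le> 2 * B" if "norm (0 - z) = R/2" for z
    proof -
      have "norm (w (z / of_real R)) \<le> 2 * B"
        by (rule wle) (use that R in \<open>simp add: norm_divide\<close>)
      then show ?thesis using R by (simp add: w_def)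
    qed
  qed (use R in auto)
  have "(deriv ^^ n) (\<lambda>z. H z - H 0) 0 = (deriv ^^ n) H 0 - (deriv ^^ n) (\<lambda>z. H 0) 0"
    by (rule higher_deriv_diff[of _ "ball 0 R"]) (use hol R in auto)
  also have "(deriv ^^ n) (\<lambda>z. H 0) 0 = 0" using n by (simp add: higher_deriv_const)
  finally show ?thesis using bd by simp
qed

section \<open>Logarithmic derivatives, formal and analytic, and removal of zeros\<close>

definition fps_logderiv :: "'a::field fps \<Rightarrow> 'a fps" where
  "fps_logderiv F = fps_deriv F / F"

lemma fps_logderiv_mult:
  fixes F G :: "'a::field fps"
  assumes "F $ 0 \<noteq> 0" "G $ 0 \<noteq> 0"
  shows "fps_logderiv (F * G) = fps_logderiv F + fps_logderiv G"
proof -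
  have nz: "F \<noteq> 0" "G \<noteq> 0" using assms by auto
  have u: "is_unit F" "is_unit G" "is_unit (F * G)" using assms by (auto simp: fps_is_unit_iff)
  have FG: "fps_logderiv (F * G) * (F * G) = fps_deriv (F * G)"
    unfolding fps_logderiv_def by (rule dvd_div_mult_self) (use u in auto)
  have F: "fps_logderiv F * F = fps_deriv F" and G: "fps_logderiv G * G = fps_deriv G"
    unfolding fps_logderiv_def by (rule dvd_div_mult_self; use u in auto)+
  have "fps_logderiv (F * G) * (F * G) = F * fps_deriv G + fps_deriv F * G"
    unfolding FG by simp
  also have "\<dots> = (fps_logderiv F + fps_logderiv G) * (F * G)"
    unfolding F[symmetric] G[symmetric] by (simp only: ring_distribs ac_simps)
  finally show ?thesis using nz by (simp only: mult_cancel_right no_zero_divisors) simp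
qed

lemma fps_logderiv_power:
  fixes F :: "'a::field fps"
  assumes "F $ 0 \<noteq> 0"
  shows "fps_logderiv (F ^ n) = of_nat n * fps_logderiv F"
proof (induction n)
  case 0
  then show ?case by (simp add: fps_logderiv_def)
next
  case (Suc n)
  have "F ^ n $ 0 \<noteq> 0" using assms by (simp add: fps_power_zeroth)
  then show ?case using Suc assms by (simp add: fps_logderiv_mult algebra_simps)
qed

text \<open>With c = 1/r this is the contribution of a zero r to the Taylor coefficients of f'/f;
  these are the power sums that the moments are compared with.\<close>

lemma fps_logderiv_linear_nth:
  fixes c :: "'a::field"
  shows "fps_logderiv (1 - fps_const c * fps_X) $ n = - (c ^ Suc n)"
proof -
  have "fps_deriv (1 - fps_const c * fps_X) = - fps_const c"
    by simp
  moreover have "inverse (1 - fps_const c * fps_X) = Abs_fps (\<lambda>n. c ^ n)"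
  proof (rule fps_inverse_unique)
    show "(1 - fps_const c * fps_X) * Abs_fps (\<lambda>n. c ^ n) = 1"
    proof (rule fps_ext)
      fix k show "((1 - fps_const c * fps_X) * Abs_fps (\<lambda>n. c ^ n)) $ k = (1 :: 'a fps) $ k"
        by (cases k) (simp_all add: ring_distribs mult.assoc)
    qed
  qed
  ultimately have "fps_logderiv (1 - fps_const c * fps_X) = - fps_const c * Abs_fps (\<lambda>n. c ^ n)"
    unfolding fps_logderiv_def by (subst fps_divide_unit) auto
  then show ?thesis by simp
qed

lemma has_fps_expansion_logderiv:
  fixes f :: "complex \<Rightarrow> complex"
  assumes "f has_fps_expansion F" "F $ 0 \<noteq> 0"
  shows "(\<lambda>z. deriv f z / f z) has_fps_expansion fps_logderiv F"
  unfolding fps_logderiv_def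
  by (rule has_fps_expansion_divide'[OF has_fps_expansion_deriv]) (use assms in auto)

text \<open>Normalising the factor as 1 - z/r instead of z - r makes it 1 at the origin, so removing
  zeros does not change the value at 0 and the formal factor has constant term 1.\<close>

lemma entire_factor_zero:
  fixes k :: "complex \<Rightarrow> complex"
  assumes hol: "k holomorphic_on UNIV" and k0: "k 0 \<noteq> 0" and kr: "k r = 0"
  obtains n g where "g holomorphic_on UNIV" "g r \<noteq> 0" "\<And>z. k z = (1 - z / r) ^ n * g z"
proof -
  have r: "r \<noteq> 0" using k0 kr by auto
  obtain e where e: "e > 0" "zor_poly k r holomorphic_on cball r e"
    and kz: "\<And>w. w \<in> cball r e \<Longrightarrow> k w = zor_poly k r w * (w - r) ^ nat (zorder k r) \<and> zor_poly k r w \<noteq> 0"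
    using zorder_exist_zero[OF hol open_UNIV connected_UNIV, of r] k0 by blast
  define n where "n = nat (zorder k r)"
  define P where "P = (\<lambda>z. zor_poly k r z * (-r) ^ n)"
  \<comment> \<open>Off r the quotient is a plain division; at r the value is supplied by the local
    factor \<open>zor_poly\<close>, rescaled by (-r)^n because (z - r)^n = (-r)^n (1 - z/r)^n. Both
    descriptions agree near r.\<close>
  define g where "g = (\<lambda>z. if z = r then P z else k z / (1 - z / r) ^ n)"
  have eq: "g z = P z" if "z \<in> ball r e" for z
  proof (cases "z = r")
    case False
    have "z - r = (-r) * (1 - z / r)" using r by (simp add: field_simps)
    then have *: "(z - r) ^ n = (-r) ^ n * (1 - z / r) ^ n" by (metis power_mult_distrib)
    have "1 - z / r \<noteq> 0" using False r by auto
    then show ?thesis using False kz[of z] that * by (simp add: g_def P_def n_def)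
  qed (simp add: g_def)
  have "g holomorphic_on ball r e \<union> (UNIV - {r})"
  proof (rule holomorphic_on_Un)
    have "P holomorphic_on ball r e"
      unfolding P_def by (intro holomorphic_intros holomorphic_on_subset[OF e(2)]) auto
    then show "g holomorphic_on ball r e"
      by (rule holomorphic_transform) (simp add: eq)
    have "(\<lambda>z. k z / (1 - z / r) ^ n) holomorphic_on UNIV - {r}"
      by (intro holomorphic_intros holomorphic_on_subset[OF hol]) (use r in auto)
    then show "g holomorphic_on UNIV - {r}"
      by (rule holomorphic_transform) (simp add: g_def)
  qed auto
  moreover have "ball r e \<union> (UNIV - {r}) = UNIV" using e by auto
  ultimately have holg: "g holomorphic_on UNIV" by simp
  have gr: "g r \<noteq> 0" using kz[of r] e r by (simp add: g_def P_def)
  have "k z = (1 - z / r) ^ n * g z" for z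
  proof (cases "z = r")
    case True
    have "n > 0" 
      using kz[of r] e kr by (cases "n = 0") (auto simp: n_def)
    then show ?thesis using True kr r by simp
  next
    case False
    then have "1 - z / r \<noteq> 0" using r by auto
    then show ?thesis using False by (simp add: g_def)
  qed
  with holg gr show ?thesis using that by blast
qed

text \<open>The condition g r \<noteq> 0 on all of A forces the exponents to be the multiplicities
  and, when A consists of all zeros in a disc, leaves a cofactor without zeros there.\<close>

lemma entire_factor_zeros:
  fixes f :: "complex \<Rightarrow> complex"
  assumes "finite A" and hol: "f holomorphic_on UNIV" and f0: "f 0 \<noteq> 0" and A: "\<And>r. r \<in> A \<Longrightarrow> f r = 0"
  shows "\<exists>n g. g holomorphic_on UNIV \<and> (\<forall>z. f z = (\<Prod>r\<in>A. (1 - z / r) ^ n r) * g z) \<and>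
            (\<forall>r\<in>A. g r \<noteq> 0)"
  using assms(1) A
proof (induction A)
  case empty
  then show ?case using hol by auto
next
  case (insert a A)
  then obtain n g where IH: "g holomorphic_on UNIV" "\<And>z. f z = (\<Prod>r\<in>A. (1 - z / r) ^ n r) * g z"
     "\<And>r. r \<in> A \<Longrightarrow> g r \<noteq> 0" using insert.IH[OF insert.prems] by blast
  have nz: "r \<noteq> 0" if "r \<in> insert a A" for r using insert.prems[OF that] f0 by auto
  \<comment> \<open>The factors already removed vanish only at points of A, so the new zero a is a
    zero of the cofactor.\<close>
  have "(\<Prod>r\<in>A. (1 - a / r) ^ n r) \<noteq> 0"
    using insert.hyps nz by (auto simp: prod_zero_iff)
  then have ga: "g a = 0" using IH(2)[of a] insert.prems[of a] by auto
  have g0: "g 0 \<noteq> 0" using IH(2)[of 0] f0 by auto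
  obtain m h where h: "h holomorphic_on UNIV" "h a \<noteq> 0" "\<And>z. g z = (1 - z / a) ^ m * h z"
    using entire_factor_zero[OF IH(1) g0 ga] by metis
  have "(\<Prod>r\<in>insert a A. (1 - z / r) ^ (n(a := m)) r) = (1 - z / a) ^ m * (\<Prod>r\<in>A. (1 - z / r) ^ n r)" for z
    using insert.hyps by (simp add: prod.insert) (intro disjI2 prod.cong, auto)
  then have "f z = (\<Prod>r\<in>insert a A. (1 - z / r) ^ (n(a := m)) r) * h z" for z
    using IH(2)[of z] h(3)[of z] by simp
  moreover have "\<forall>r\<in>insert a A. h r \<noteq> 0" using h IH(3) by (metis insertE mult_zero_right)
  ultimately show ?case using h(1) by blast
qed

lemma fps_logderiv_prod:
  fixes F :: "'b \<Rightarrow> 'a::field fps"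
  assumes "finite A" "\<And>i. i \<in> A \<Longrightarrow> F i $ 0 \<noteq> 0"
  shows "fps_logderiv (\<Prod>i\<in>A. F i) = (\<Sum>i\<in>A. fps_logderiv (F i))"
  using assms
proof (induction A)
  case (insert a A)
  have "(\<Prod>i\<in>A. F i) $ 0 = (\<Prod>i\<in>A. F i $ 0)"
    using insert.hyps(1) by (induction A) auto
  then have "(\<Prod>i\<in>A. F i) $ 0 \<noteq> 0" using insert by simp
  then show ?case using insert by (simp add: fps_logderiv_mult)
qed (simp add: fps_logderiv_def)

text \<open>The zeros removed lie in |z| <= R, while f is bounded on |z| = 2R: there every factor 1
  - z/r has modulus at least 1, so the cofactor g inherits the bound M, and the maximum principle
  carries it inside. The logarithm of g lives on |z| < R, where g has no zeros, and its coefficients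
  are estimated at radius R/2. The index \<open>Suc N\<close> appears because the coefficient N of
  g'/g is N + 1 times the coefficient N + 1 of log g.\<close>

lemma logderiv_coeff_approx:
  fixes f :: "complex \<Rightarrow> complex"
  assumes hol: "f holomorphic_on UNIV" and f0: "f 0 \<noteq> 0"
    and F: "f has_fps_expansion F" and R: "R > 0"
    and M: "\<And>z. norm z = 2 * R \<Longrightarrow> norm (f z) \<le> M"
  obtains A n where "finite A" "\<And>r. r \<in> A \<Longrightarrow> f r = 0"
    "\<And>N. norm (fps_logderiv F $ N + (\<Sum>r\<in>A. of_nat (n r) * (1 / r) ^ Suc N))
             \<le> real (Suc N) * (2 * (ln M - ln (norm (f 0)) + 1)) / (R / 2) ^ Suc N"
proof -
  define A where "A = {z \<in> cball 0 R. f z = 0}"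
  have finA: "finite A"
  proof (cases "f constant_on UNIV")
    case True
    then have "A = {}" using f0 unfolding A_def constant_on_def by auto
    then show ?thesis by simp
  next
    case False
    then show ?thesis unfolding A_def
      by (intro holomorphic_compact_finite_zeros[OF hol]) auto
  qed
  obtain n g where g: "g holomorphic_on UNIV" "\<And>z. f z = (\<Prod>r\<in>A. (1 - z / r) ^ n r) * g z"
     "\<And>r. r \<in> A \<Longrightarrow> g r \<noteq> 0"
    using entire_factor_zeros[OF finA hol f0] unfolding A_def by blast
  have g_nz: "g z \<noteq> 0" if "z \<in> cball 0 R" for z
    using g(2)[of z] g(3)[of z] that unfolding A_def by auto
  have g0: "g 0 = f 0" using g(2)[of 0] by simp
  have bdg: "norm (g z) \<le> M" if "z \<in> cball 0 (2 * R)" for z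
  proof (rule maximum_modulus_frontier[of g "cball 0 (2 * R)"])
    fix z :: complex assume "z \<in> frontier (cball 0 (2 * R))"
    then have z: "norm z = 2 * R" using R by (simp add: frontier_cball)
    have ge: "norm (1 - z / r) \<ge> 1" if "r \<in> A" for r
    proof -
      have r: "r \<noteq> 0" "norm r \<le> R" using that f0 unfolding A_def by auto
      have "norm (z / r) \<ge> 2" using r z by (simp add: norm_divide field_simps)
      moreover have "norm (z / r) \<le> norm (1 - z / r) + 1"
        using norm_triangle_sub[of "z / r" 1] by (simp add: norm_minus_commute)
      ultimately show ?thesis by linarith
    qed
    have "1 \<le> (\<Prod>r\<in>A. norm (1 - z / r) ^ n r)"
      by (intro prod_ge_1 one_le_power ge)
    then have "1 \<le> norm (\<Prod>r\<in>A. (1 - z / r) ^ n r)"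
      by (simp add: prod_norm[symmetric] norm_power)
    then have "1 * norm (g z) \<le> norm (\<Prod>r\<in>A. (1 - z / r) ^ n r) * norm (g z)"
      by (intro mult_right_mono) auto
    also have "\<dots> = norm (f z)" using g(2)[of z] by (simp add: norm_mult)
    finally show "norm (g z) \<le> M" using M[OF z] by simp
  qed (use that R in \<open>auto intro!: holomorphic_on_imp_continuous_on holomorphic_on_subset[OF g(1)]\<close>)
  have "g holomorphic_on ball 0 R" by (rule holomorphic_on_subset[OF g(1)]) simp
  then obtain H where H: "H holomorphic_on ball 0 R" "\<And>z. z \<in> ball 0 R \<Longrightarrow> g z = exp (H z)"
    by (rule contractible_imp_holomorphic_log[OF _ convex_imp_contractible[OF convex_ball]])
       (use g_nz in auto)
  define B where "B = ln M - ln (norm (f 0)) + 1"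
  have ReH: "Re (H z) - Re (H 0) < B" if z: "z \<in> ball 0 R" for z
  proof -
    have eq: "Re (H w) = ln (norm (g w))" if "w \<in> ball 0 R" for w
      using H(2)[OF that] by simp
    have "norm (g z) > 0" using g_nz[of z] z by auto
    moreover have "norm (g z) \<le> M" using bdg[of z] z R by auto
    ultimately have "ln (norm (g z)) \<le> ln M" by (subst ln_le_cancel_iff) linarith+
    then show ?thesis using eq[OF z] eq[of 0] R g0 by (simp add: B_def)
  qed
  define G where "G = fps_expansion g 0"
  have G: "g has_fps_expansion G"
    unfolding G_def by (rule has_fps_expansion_fps_expansion[OF open_UNIV _ g(1)]) simp
  have G0: "G $ 0 \<noteq> 0" using g0 f0 by (simp add: G_def fps_expansion_def)
  have FG: "F = (\<Prod>r\<in>A. (1 - fps_const (1 / r) * fps_X) ^ n r) * G"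
  proof -
    have "(\<lambda>z. (\<Prod>r\<in>A. (1 - (1 / r) * z) ^ n r) * g z) has_fps_expansion
         (\<Prod>r\<in>A. (1 - fps_const (1 / r) * fps_X) ^ n r) * G"
      by (intro fps_expansion_intros G)
    also have "(\<lambda>z. (\<Prod>r\<in>A. (1 - (1 / r) * z) ^ n r) * g z) = f"
      using g(2) by (auto simp: fun_eq_iff)
    finally show ?thesis using F fps_expansion_unique_complex by blast
  qed
  have "fps_logderiv F = (\<Sum>r\<in>A. of_nat (n r) * fps_logderiv (1 - fps_const (1 / r) * fps_X)) + fps_logderiv G"
  proof -
    have 1: "((1 - fps_const (1 / r) * fps_X) ^ n r) $ 0 = 1" for r :: complex
      by (simp add: fps_power_zeroth)
    have "(\<Prod>r\<in>A. (1 - fps_const (1 / r) * fps_X) ^ n r) $ 0 = 1"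
      using finA by (induction A) (auto simp: 1)
    then show ?thesis unfolding FG
      by (subst fps_logderiv_mult) (use G0 1 finA in \<open>auto simp: fps_logderiv_prod fps_logderiv_power\<close>)
  qed
  then have lgd: "fps_logderiv F $ N = - (\<Sum>r\<in>A. of_nat (n r) * (1 / r) ^ Suc N) + fps_logderiv G $ N" for N
    by (simp add: fps_sum_nth fps_mult_of_nat_nth fps_logderiv_linear_nth sum_negf del: power_Suc)
  have bd: "norm (fps_logderiv G $ N) \<le> real (Suc N) * (2 * B) / (R / 2) ^ Suc N" for N
  proof -
    have "fps_logderiv G $ N = (deriv ^^ N) (\<lambda>z. deriv g z / g z) 0 / fact N"
      by (rule fps_nth_fps_expansion[OF has_fps_expansion_logderiv[OF G G0]])
    also have "(deriv ^^ N) (\<lambda>z. deriv g z / g z) 0 = (deriv ^^ N) (deriv H) 0"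
    proof (rule higher_deriv_cong_ev)
      have "eventually (\<lambda>z::complex. z \<in> ball 0 R) (nhds 0)"
        using R by (intro eventually_nhds_in_open) auto
      then show "eventually (\<lambda>z. deriv g z / g z = deriv H z) (nhds 0)"
      proof eventually_elim
        case (elim z)
        have dH: "(H has_field_derivative deriv H z) (at z)"
          using H(1) elim by (simp add: holomorphic_derivI)
        have "((\<lambda>z. exp (H z)) has_field_derivative exp (H z) * deriv H z) (at z)"
          by (rule DERIV_chain2[OF DERIV_exp dH])
        then have "(g has_field_derivative exp (H z) * deriv H z) (at z)"
          by (rule has_field_derivative_transform_within_open[of _ _ _ "ball 0 R"])
             (use elim H(2) in auto)
        then have "deriv g z = exp (H z) * deriv H z" by (rule DERIV_imp_deriv)
        then show ?case using H(2)[OF elim] by simp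
      qed
    qed simp
    also have "(deriv ^^ N) (deriv H) 0 = (deriv ^^ Suc N) H 0"
      by (simp only: funpow_Suc_right o_apply)
    finally have "norm (fps_logderiv G $ N) = norm ((deriv ^^ Suc N) H 0) / fact N"
      by (simp add: norm_divide del: funpow.simps)
    also have "\<dots> \<le> (fact (Suc N) * (2 * B) / (R / 2) ^ Suc N) / fact N"
      by (intro divide_right_mono Borel_Caratheodory_coeff[OF H(1) R _ ReH]) auto
    also have "\<dots> = real (Suc N) * (2 * B) / (R / 2) ^ Suc N"
      by (simp add: field_simps del: power_Suc of_nat_Suc)
    finally show ?thesis .
  qed
  show thesis
  proof (rule that[OF finA])
    show "f r = 0" if "r \<in> A" for r using that by (simp add: A_def)
    show "norm (fps_logderiv F $ N + (\<Sum>r\<in>A. of_nat (n r) * (1 / r) ^ Suc N))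
             \<le> real (Suc N) * (2 * (ln M - ln (norm (f 0)) + 1)) / (R / 2) ^ Suc N" for N
      using bd[of N] by (simp add: lgd B_def)
  qed
qed

text \<open>Take R = k + 1. The logarithm of the bound for |f| on |z| = 2R is O(R^2), so the error
  bound for the coefficient of index N is O(R^(1 - N)), which tends to 0 from N = 2 on.\<close>

lemma logderiv_coeff_limit:
  fixes f :: "complex \<Rightarrow> complex"
  assumes hol: "f holomorphic_on UNIV" and f0: "f 0 \<noteq> 0"
    and F: "f has_fps_expansion F"
    and C: "C > 0" and growth: "\<And>z. norm z \<ge> 1 \<Longrightarrow> norm (f z) \<le> C * exp (K * norm z ^ 2)"
  obtains A n where "\<And>k::nat. finite (A k)" "\<And>k r. r \<in> A k \<Longrightarrow> f r = 0"
    "\<And>N. N \<ge> 2 \<Longrightarrow> (\<lambda>k. - (\<Sum>r\<in>A k. of_nat (n k r) * (1 / r) ^ Suc N)) \<longlonglongrightarrow> fps_logderiv F $ N"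
proof -
  define E where "E = (\<lambda>k N. real (Suc N) * (2 * (ln (C * exp (K * (2 * real (Suc k)) ^ 2)) - ln (norm (f 0)) + 1)) / (real (Suc k) / 2) ^ Suc N)"
  have "\<exists>A n. finite A \<and> (\<forall>r\<in>A. f r = 0) \<and>
     (\<forall>N. norm (fps_logderiv F $ N + (\<Sum>r\<in>A. of_nat (n r) * (1 / r) ^ Suc N)) \<le> E k N)" for k :: nat
  proof -
    have *: "norm (f z) \<le> C * exp (K * (2 * real (Suc k)) ^ 2)" if "norm z = 2 * real (Suc k)" for z
      using growth[of z] by (simp only: that) simp
    show ?thesis unfolding E_def
      by (rule logderiv_coeff_approx[OF hol f0 F _ *, where R = "real (Suc k)"]) (auto simp del: power_Suc of_nat_Suc)
  qed
  then obtain A n where A: "\<And>k. finite (A k)" "\<And>k r. r \<in> A k \<Longrightarrow> f r = 0"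
     "\<And>k N. norm (fps_logderiv F $ N + (\<Sum>r\<in>A k. of_nat (n k r) * (1 / r) ^ Suc N)) \<le> E k N"
    by metis
  have "(\<lambda>k. - (\<Sum>r\<in>A k. of_nat (n k r) * (1 / r) ^ Suc N)) \<longlonglongrightarrow> fps_logderiv F $ N" if N: "N \<ge> 2" for N
  proof -
    have "(\<lambda>k. E k N) \<longlonglongrightarrow> 0"
    proof (rule Lim_null_comparison)
      \<comment> \<open>For x = k + 1 >= 1 the numerator d + 4 K x^2 is at most (|d| + 4 |K|) x^2 in
        modulus, where 4 comes from the radius 2R; the power of 2 comes from R/2 in the
        denominator.\<close>
      define c where "c = real (Suc N) * 2 * (\<bar>ln C - ln (norm (f 0)) + 1\<bar> + 4 * \<bar>K\<bar>) * 2 ^ Suc N"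
      show "eventually (\<lambda>k. norm (E k N) \<le> c * inverse (real (Suc k))) sequentially"
      proof (intro always_eventually allI)
        fix k
        define x where "x = real (Suc k)"
        have x: "x \<ge> 1" by (simp add: x_def)
        define d where "d = ln C - ln (norm (f 0)) + 1"
        have E: "E k N = real (Suc N) * 2 * (d + 4 * K * x ^ 2) * 2 ^ Suc N / x ^ Suc N"
          using C by (simp add: E_def x_def[symmetric] ln_mult d_def power_divide power_mult_distrib del: power_Suc of_nat_Suc)
        have "\<bar>d + 4 * K * x ^ 2\<bar> \<le> \<bar>d\<bar> + 4 * \<bar>K\<bar> * x ^ 2"
          by (rule order_trans[OF abs_triangle_ineq]) (simp add: abs_mult)
        also have "\<dots> \<le> \<bar>d\<bar> * x ^ 2 + 4 * \<bar>K\<bar> * x ^ 2"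
          using x by (simp add: mult_le_cancel_left1 one_le_power)
        finally have le: "\<bar>d + 4 * K * x ^ 2\<bar> \<le> (\<bar>d\<bar> + 4 * \<bar>K\<bar>) * x ^ 2" by (simp add: algebra_simps)
        define e where "e = real (Suc N) * 2 * 2 ^ Suc N / x ^ Suc N"
        have e: "e \<ge> 0" using x by (simp add: e_def del: of_nat_Suc power_Suc)
        have "E k N = e * (d + 4 * K * x ^ 2)"
          unfolding E e_def by (simp only: times_divide_eq_left times_divide_eq_right mult_ac)
        then have 1: "norm (E k N) = e * \<bar>d + 4 * K * x ^ 2\<bar>"
          using e by (simp only: real_norm_def abs_mult abs_of_nonneg)
        have 2: "\<dots> \<le> e * ((\<bar>d\<bar> + 4 * \<bar>K\<bar>) * x ^ 2)"
          by (rule mult_left_mono[OF le e])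
        have 3: "e * ((\<bar>d\<bar> + 4 * \<bar>K\<bar>) * x ^ 2) = c * (x ^ 2 / x ^ Suc N)"
        proof -
          have "(a * 2 * b / X) * (D * y) = a * 2 * D * b * (y / X)" for a b X D y :: real
            by simp
          then show ?thesis unfolding c_def d_def e_def .
        qed
        have "x ^ 2 / x ^ Suc N \<le> inverse x"
        proof -
          have "x ^ 3 \<le> x ^ Suc N" using x N by (intro power_increasing) auto
          then have "x ^ 2 * x \<le> x ^ Suc N" by (simp add: power2_eq_square power3_eq_cube)
          moreover have "x ^ Suc N > 0" using x by simp
          ultimately show ?thesis using x by (simp add: divide_simps del: power_Suc)
        qed
        moreover have "c \<ge> 0" unfolding c_def by (intro mult_nonneg_nonneg add_nonneg_nonneg) auto
        ultimately have "c * (x ^ 2 / x ^ Suc N) \<le> c * inverse x" by (rule mult_left_mono)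
        then show "norm (E k N) \<le> c * inverse (real (Suc k))"
          using 1 2 unfolding 3 x_def[symmetric] by linarith
      qed
      show "(\<lambda>k. c * inverse (real (Suc k))) \<longlonglongrightarrow> 0"
        using tendsto_mult_left[OF LIMSEQ_inverse_real_of_nat, of c] by simp
    qed
    then have "(\<lambda>k. fps_logderiv F $ N - (- (\<Sum>r\<in>A k. of_nat (n k r) * (1 / r) ^ Suc N))) \<longlonglongrightarrow> 0"
      by (rule Lim_null_comparison[rotated]) (use A(3)[of N] in auto)
    from tendsto_diff[OF tendsto_const this, of "fps_logderiv F $ N"] show ?thesis by simp
  qed
  with A(1,2) that show thesis by blast
qed

text \<open>With t = 1 / (L r^2) the sum over j collapses by the binomial theorem to t^n (1 - t)^k
  for each zero r, and the hypothesis on the zeros says 0 < t <= 1. The remaining weight is r^(-4)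
  times half the exponent of the zero. Only finite sums over zeros and a limit of nonnegative
  numbers occur.\<close>

lemma real_zeros_imp_moment_differences_nonneg:
  fixes f :: "complex \<Rightarrow> complex"
  assumes hol: "f holomorphic_on UNIV" and f0: "f 0 \<noteq> 0"
    and F: "f has_fps_expansion F"
    and C: "C > 0" and growth: "\<And>z. norm z \<ge> 1 \<Longrightarrow> norm (f z) \<le> C * exp (K * norm z ^ 2)"
    and zeros: "\<And>z. f z = 0 \<Longrightarrow> \<exists>x::real. z = of_real x \<and> x\<^sup>2 * L \<ge> 1" and L: "L > 0"
    and m: "\<And>k. m k = - (fps_logderiv F $ (2 * k + 3)) / 2"
  shows "(\<Sum>j\<le>k. (-1) ^ j * of_nat (k choose j) * (m (n + j) / of_real (L ^ (n + j)))) \<ge> 0"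
proof -
  obtain A p where A: "\<And>k::nat. finite (A k)" "\<And>k r. r \<in> A k \<Longrightarrow> f r = 0"
    and lim: "\<And>N. N \<ge> 2 \<Longrightarrow> (\<lambda>k. - (\<Sum>r\<in>A k. of_nat (p k r) * (1 / r) ^ Suc N)) \<longlonglongrightarrow> fps_logderiv F $ N"
    using logderiv_coeff_limit[OF hol f0 F C growth] by blast
  define M where "M = (\<lambda>l k. (\<Sum>r\<in>A l. of_nat (p l r) * (1 / r) ^ (2 * k + 4)) / 2)"
  have limM: "(\<lambda>l. M l k) \<longlonglongrightarrow> m k" for k
  proof -
    have "(\<lambda>l. (- (- (\<Sum>r\<in>A l. of_nat (p l r) * (1 / r) ^ Suc (2 * k + 3)))) / 2) \<longlonglongrightarrow> (- (fps_logderiv F $ (2 * k + 3))) / 2"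
      by (intro tendsto_intros lim) auto
    moreover have "Suc (2 * k + 3) = 2 * k + 4" by simp
    ultimately show ?thesis by (simp only: M_def m minus_minus)
  qed
  define S where "S = (\<lambda>M. (\<Sum>j\<le>k. (-1) ^ j * of_nat (k choose j) * (M (n + j) / of_real (L ^ (n + j)))) :: complex)"
  have limS: "(\<lambda>l. S (M l)) \<longlonglongrightarrow> S m"
    unfolding S_def using L by (intro tendsto_intros limM) auto
  have "S (M l) \<ge> 0" for l
  proof -
    have "S (M l) = (\<Sum>r\<in>A l. of_nat (p l r) / 2 * (1 / r) ^ 4 * ((1 / r) ^ 2 / of_real L) ^ n * (1 - (1 / r) ^ 2 / of_real L) ^ k)"
    proof -
      have "S (M l) = (\<Sum>j\<le>k. \<Sum>r\<in>A l. of_nat (p l r) / 2 * (1 / r) ^ 4 * ((1 / r) ^ 2 / of_real L) ^ n * (of_nat (k choose j) * (- ((1 / r) ^ 2 / of_real L)) ^ j * 1 ^ (k - j)))"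
        unfolding S_def M_def sum_divide_distrib sum_distrib_left
      proof (intro sum.cong refl)
        fix j and r :: complex
        have 1: "(1 / r) ^ (2 * (n + j) + 4) = (1 / r) ^ 4 * ((1 / r) ^ 2) ^ n * ((1 / r) ^ 2) ^ j"
          unfolding power_add distrib_left power_mult by (simp only: mult_ac)
        have 2: "(- ((1 / r) ^ 2 / of_real L)) ^ j = (-1) ^ j * ((1 / r) ^ 2 / of_real L) ^ j"
          using power_mult_distrib[of "-1" "(1 / r) ^ 2 / of_real L" j] by simp
        show "(-1) ^ j * of_nat (k choose j) * (of_nat (p l r) * (1 / r) ^ (2 * (n + j) + 4) / 2 / of_real (L ^ (n + j))) =
          of_nat (p l r) / 2 * (1 / r) ^ 4 * ((1 / r) ^ 2 / of_real L) ^ n * (of_nat (k choose j) * (- ((1 / r) ^ 2 / of_real L)) ^ j * 1 ^ (k - j))"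
          unfolding 1 2
          unfolding power_divide[of "(1 / r) ^ 2"] power_add of_real_mult of_real_power power_one mult_1_right
          by (simp only: times_divide_eq_left times_divide_eq_right divide_divide_eq_left mult_ac)
      qed
      also have "\<dots> = (\<Sum>r\<in>A l. of_nat (p l r) / 2 * (1 / r) ^ 4 * ((1 / r) ^ 2 / of_real L) ^ n * (\<Sum>j\<le>k. of_nat (k choose j) * (- ((1 / r) ^ 2 / of_real L)) ^ j * 1 ^ (k - j)))"
        by (subst sum.swap) (simp only: sum_distrib_left)
      finally show ?thesis unfolding binomial_ring[symmetric] by simp
    qed
    also have "\<dots> \<ge> 0"
    proof (rule sum_nonneg)
      fix r assume "r \<in> A l"
      then obtain x where x: "r = of_real x" "x\<^sup>2 * L \<ge> 1" using zeros A(2) by metis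
      have x0: "x \<noteq> 0" using x by auto
      have "of_nat (p l r) / 2 * (1 / r) ^ 4 * ((1 / r) ^ 2 / of_real L) ^ n * (1 - (1 / r) ^ 2 / of_real L) ^ k
         = of_real (real (p l r) / 2 * (1 / x) ^ 4 * ((1 / x) ^ 2 / L) ^ n * (1 - (1 / x) ^ 2 / L) ^ k)"
        unfolding x by simp
      moreover have "real (p l r) / 2 * (1 / x) ^ 4 * ((1 / x) ^ 2 / L) ^ n * (1 - (1 / x) ^ 2 / L) ^ k \<ge> 0"
      proof -
        have "(1 / x) ^ 2 / L \<le> 1" using x L x0 by (simp add: field_simps)
        moreover have "(1 / x) ^ 4 \<ge> 0" by (simp add: zero_le_even_power)
        ultimately show ?thesis using L
          by (intro mult_nonneg_nonneg zero_le_power[of "_ / L"] zero_le_power[of "1 - _"]) auto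
      qed
      ultimately show "of_nat (p l r) / 2 * (1 / r) ^ 4 * ((1 / r) ^ 2 / of_real L) ^ n * (1 - (1 / r) ^ 2 / of_real L) ^ k \<ge> 0"
        by (simp only: less_eq_complex_def complex_of_real_def complex.sel zero_complex.sel simp_thms)
    qed
    finally show ?thesis .
  qed
  \<comment> \<open>\<open>0 \<le>\<close> on complex numbers contains a statement about the
    imaginary part, so the limit is taken for real and imaginary parts separately.\<close>
  then have nn: "Re (S (M l)) \<ge> 0" "Im (S (M l)) = 0" for l by (auto simp: less_eq_complex_def)
  have "Re (S m) \<ge> 0"
    by (rule LIMSEQ_le_const[OF tendsto_Re[OF limS]]) (use nn in auto)
  moreover have "Im (S m) = 0"
    using tendsto_Im[OF limS] by (simp add: nn LIMSEQ_const_iff)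
  ultimately show ?thesis unfolding S_def by (simp add: less_eq_complex_def)
qed

section \<open>Moment functionals, Bernstein polynomials and the Euler transform\<close>

definition poly_moment :: "(nat \<Rightarrow> 'a::comm_ring_1) \<Rightarrow> 'a poly \<Rightarrow> 'a" where
  "poly_moment c p = (\<Sum>i\<le>degree p. Polynomial.coeff p i * c i)"

lemma poly_moment_altdef: "degree p \<le> d \<Longrightarrow> poly_moment c p = (\<Sum>i\<le>d. Polynomial.coeff p i * c i)"
  unfolding poly_moment_def by (rule sum.mono_neutral_left) (auto simp: coeff_eq_0)

lemma poly_moment_add: "poly_moment c (p + q) = poly_moment c p + poly_moment c q"
proof -
  define d where "d = max (degree p) (degree q)"
  have "degree (p + q) \<le> d" "degree p \<le> d" "degree q \<le> d"
    by (auto simp: d_def degree_add_le_max)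
  then show ?thesis by (simp add: poly_moment_altdef sum.distrib algebra_simps)
qed

lemma poly_moment_smult: "poly_moment c (Polynomial.smult a p) = a * poly_moment c p"
proof -
  have "degree (Polynomial.smult a p) \<le> degree p" by (rule degree_smult_le)
  then show ?thesis unfolding poly_moment_def[of c p]
    by (simp add: poly_moment_altdef sum_distrib_left mult.assoc)
qed

lemma poly_moment_0: "poly_moment c 0 = 0"
  by (simp add: poly_moment_def)

lemma poly_moment_sum: "poly_moment c (\<Sum>i\<in>A. p i) = (\<Sum>i\<in>A. poly_moment c (p i))"
  by (induction A rule: infinite_finite_induct) (simp_all add: poly_moment_0 poly_moment_add)

lemma poly_moment_monom: "poly_moment c (Polynomial.monom a n) = a * c n"
proof -
  have "poly_moment c (Polynomial.monom a n) = (\<Sum>i\<le>n. Polynomial.coeff (Polynomial.monom a n) i * c i)"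
    by (rule poly_moment_altdef) (rule degree_monom_le)
  also have "\<dots> = (\<Sum>i\<in>{n}. Polynomial.coeff (Polynomial.monom a n) i * c i)"
    by (rule sum.mono_neutral_right) auto
  finally show ?thesis by simp
qed

definition moment_difference :: "(nat \<Rightarrow> complex) \<Rightarrow> nat \<Rightarrow> nat \<Rightarrow> complex" where
  "moment_difference c n k = (\<Sum>j\<le>k. (-1) ^ j * of_nat (k choose j) * c (n + j))"

lemma linear_poly_power: "[:0, a:] ^ n = Polynomial.monom (a ^ n) n" for a :: "'a::comm_ring_1"
  by (metis monom_0 monom_Suc monom_power mult_1 One_nat_def)

text \<open>\<open>poly_moment c\<close> is what integration against a measure with moments c would
  be. The iterated differences are its values on x^n (1 - x)^k, so nonnegative differences mean
  positivity on Bernstein polynomials, as in the Hausdorff moment problem on [0, 1].\<close>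

lemma poly_moment_bernstein:
  "poly_moment c ([:0, 1:] ^ n * [:1, -1:] ^ k) = moment_difference c n k"
proof -
  have "[:1, -1:] = [:0, -1:] + (1 :: complex poly)" by (simp add: one_pCons)
  then have "[:1, -1 :: complex:] ^ k = (\<Sum>j\<le>k. of_nat (k choose j) * [:0, -1:] ^ j)"
    using binomial_ring[of "[:0, -1 :: complex:]" 1 k] by simp
  then have "[:0, 1:] ^ n * [:1, -1 :: complex:] ^ k = (\<Sum>j\<le>k. [:0, 1:] ^ n * (of_nat (k choose j) * [:0, -1:] ^ j))"
    by (simp only: sum_distrib_left)
  also have "\<dots> = (\<Sum>j\<le>k. Polynomial.monom ((-1) ^ j * of_nat (k choose j)) (n + j))"
    by (intro sum.cong refl)
       (simp add: linear_poly_power of_nat_poly smult_monom mult_monom mult_ac)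
  finally show ?thesis by (simp add: poly_moment_sum poly_moment_monom moment_difference_def)
qed

text \<open>The polynomial is \<alpha> + (\<beta> - \<alpha>) x = \<alpha> (1 - x) + \<beta> x. The
  first expansion, in powers of x, serves to identify Taylor coefficients; the second, in Bernstein
  polynomials, serves for estimates.\<close>

lemma poly_moment_linear_power:
  fixes \<alpha> \<beta> :: complex
  shows "poly_moment c ([:\<alpha>, \<beta> - \<alpha>:] ^ j) = (\<Sum>n\<le>j. of_nat (j choose n) * \<alpha> ^ (j - n) * (\<beta> - \<alpha>) ^ n * c n)"
    and "poly_moment c ([:\<alpha>, \<beta> - \<alpha>:] ^ j) = (\<Sum>i\<le>j. of_nat (j choose i) * \<alpha> ^ (j - i) * \<beta> ^ i * moment_difference c i (j - i))"
proof -
  have 1: "[:\<alpha>, \<beta> - \<alpha>:] = [:0, \<beta> - \<alpha>:] + [:\<alpha>:]" by simp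
  have "[:\<alpha>, \<beta> - \<alpha>:] ^ j = (\<Sum>n\<le>j. Polynomial.monom (of_nat (j choose n) * \<alpha> ^ (j - n) * (\<beta> - \<alpha>) ^ n) n)"
    unfolding 1 binomial_ring
  proof (intro sum.cong refl)
    fix n
    show "of_nat (j choose n) * [:0, \<beta> - \<alpha>:] ^ n * [:\<alpha>:] ^ (j - n) =
          Polynomial.monom (of_nat (j choose n) * \<alpha> ^ (j - n) * (\<beta> - \<alpha>) ^ n) n"
      by (simp add: linear_poly_power of_nat_poly smult_monom mult_ac poly_const_pow)
  qed
  then show "poly_moment c ([:\<alpha>, \<beta> - \<alpha>:] ^ j) = (\<Sum>n\<le>j. of_nat (j choose n) * \<alpha> ^ (j - n) * (\<beta> - \<alpha>) ^ n * c n)"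
    by (simp add: poly_moment_sum poly_moment_monom)
  have 2: "[:\<alpha>, \<beta> - \<alpha>:] = Polynomial.smult \<beta> [:0, 1:] + Polynomial.smult \<alpha> [:1, -1:]" by simp
  have "[:\<alpha>, \<beta> - \<alpha>:] ^ j = (\<Sum>i\<le>j. Polynomial.smult (of_nat (j choose i) * \<alpha> ^ (j - i) * \<beta> ^ i) ([:0, 1:] ^ i * [:1, -1:] ^ (j - i)))"
    unfolding 2 binomial_ring smult_power
    by (intro sum.cong refl) (simp add: of_nat_poly mult_ac smult_power del: smult_pCons)
  then show "poly_moment c ([:\<alpha>, \<beta> - \<alpha>:] ^ j) = (\<Sum>i\<le>j. of_nat (j choose i) * \<alpha> ^ (j - i) * \<beta> ^ i * moment_difference c i (j - i))"
    by (simp add: poly_moment_sum poly_moment_smult poly_moment_bernstein)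
qed

text \<open>On [0, 1] the linear polynomial runs from \<alpha> to \<beta>, hence has modulus at most
  r, and a positive functional has norm c 0. In the Bernstein expansion the differences act as
  weights of total mass c 0.\<close>

lemma poly_moment_linear_power_bound:
  fixes \<alpha> \<beta> :: complex
  assumes pos: "\<And>n k. moment_difference c n k \<ge> 0"
    and r: "norm \<alpha> \<le> r" "norm \<beta> \<le> r"
  shows "norm (poly_moment c ([:\<alpha>, \<beta> - \<alpha>:] ^ j)) \<le> r ^ j * norm (c 0)"
proof -
  have r0: "r \<ge> 0" using r(1) norm_ge_zero order_trans by blast
  have D: "moment_difference c n k = of_real (norm (moment_difference c n k))" for n k
    using pos[of n k] by (simp add: less_eq_complex_def complex_eq_iff cmod_eq_Re)
  \<comment> \<open>The choice \<alpha> = \<beta> = 1 turns the polynomial into 1 and shows that the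
    weights add up to c 0.\<close>
  have one: "(\<Sum>i\<le>j. of_nat (j choose i) * moment_difference c i (j - i)) = c 0"
    using poly_moment_linear_power[of c 1 1 j] by (simp add: poly_moment_def power_0_left flip: one_pCons)
  have "(\<Sum>i\<le>j. real (j choose i) * norm (moment_difference c i (j - i))) = norm (c 0)"
  proof -
    define t where "t = (\<Sum>i\<le>j. real (j choose i) * norm (moment_difference c i (j - i)))"
    have "complex_of_real t = (\<Sum>i\<le>j. of_nat (j choose i) * complex_of_real (norm (moment_difference c i (j - i))))"
      unfolding t_def by simp
    also have "\<dots> = c 0" unfolding D[symmetric] by (rule one)
    finally have "norm (c 0) = \<bar>t\<bar>" using norm_of_real[of t, where 'a = complex] by simp
    moreover have "t \<ge> 0" unfolding t_def by (intro sum_nonneg) auto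
    ultimately show ?thesis unfolding t_def by simp
  qed
  moreover have "norm (poly_moment c ([:\<alpha>, \<beta> - \<alpha>:] ^ j)) \<le> (\<Sum>i\<le>j. r ^ j * (real (j choose i) * norm (moment_difference c i (j - i))))"
    unfolding poly_moment_linear_power(2)
  proof (rule order_trans[OF norm_sum], rule sum_mono)
    fix i assume "i \<in> {..j}"
    then have "r ^ j = r ^ (j - i) * r ^ i" by (simp flip: power_add)
    moreover have "norm \<alpha> ^ (j - i) * norm \<beta> ^ i \<le> r ^ (j - i) * r ^ i"
      using r r0 by (intro mult_mono power_mono) auto
    ultimately have "norm \<alpha> ^ (j - i) * norm \<beta> ^ i \<le> r ^ j" by simp
    then have "norm \<alpha> ^ (j - i) * norm \<beta> ^ i * (real (j choose i) * norm (moment_difference c i (j - i)))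
        \<le> r ^ j * (real (j choose i) * norm (moment_difference c i (j - i)))"
      by (rule mult_right_mono) simp
    then show "norm (of_nat (j choose i) * \<alpha> ^ (j - i) * \<beta> ^ i * moment_difference c i (j - i))
         \<le> r ^ j * (real (j choose i) * norm (moment_difference c i (j - i)))"
      by (simp add: norm_mult norm_power mult_ac)
  qed
  ultimately show ?thesis by (simp add: sum_distrib_left[symmetric])
qed

text \<open>The binomial series with exponent -(n + 1), whose signs (-1)^d cancel against those of
  the argument -\<alpha>.\<close>

lemma negative_binomial_sums:
  fixes \<alpha> :: complex
  assumes "norm \<alpha> < 1"
  shows "(\<lambda>d. of_nat ((n + d) choose n) * \<alpha> ^ d) sums (1 / (1 - \<alpha>) ^ Suc n)"
proof -
  have nz: "1 - \<alpha> \<noteq> 0" using assms by auto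
  have "(\<lambda>d. ((- of_nat (Suc n)) gchoose d) * (- \<alpha>) ^ d) sums (1 + (- \<alpha>)) powr (- of_nat (Suc n))"
    by (rule gen_binomial_complex) (use assms in simp)
  moreover have "((- of_nat (Suc n)) gchoose d) * (- \<alpha>) ^ d = of_nat ((n + d) choose n) * \<alpha> ^ d" for d
  proof -
    have "((- of_nat (Suc n) :: complex) gchoose d) = (-1) ^ d * ((of_nat (Suc n) + of_nat d - 1) gchoose d)"
      by (rule gbinomial_minus)
    also have "(of_nat (Suc n) + of_nat d - 1 :: complex) = of_nat (n + d)" by simp
    also have "(of_nat (n + d) gchoose d :: complex) = of_nat ((n + d) choose d)"
      by (rule binomial_gbinomial[symmetric])
    also have "(n + d) choose d = (n + d) choose n"
      using binomial_symmetric[of d "n + d"] by simp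
    finally have "((- of_nat (Suc n) :: complex) gchoose d) = (-1) ^ d * of_nat ((n + d) choose n)" .
    moreover have "(- \<alpha>) ^ d = (-1) ^ d * \<alpha> ^ d" using power_mult_distrib[of "-1" \<alpha> d] by simp
    ultimately show ?thesis by (simp add: mult_ac flip: power_mult_distrib)
  qed
  moreover have "(1 + (- \<alpha>)) powr (- of_nat (Suc n)) = 1 / (1 - \<alpha>) ^ Suc n"
    using nz by (simp only: powr_minus powr_nat) (simp add: inverse_eq_divide)
  ultimately show ?thesis by simp
qed

text \<open>If c n were the integral of x^n, the generating function would be the integral of 1 / (1
  - z x), and this is the geometric series of w (1 - w + w z x)^j over j. Its terms are controlled
  by the bases at x = 0 and x = 1, which are 1 - w and 1 - w + w z. The domain is the disc of radius
  1/|w| around 1 - 1/w, which contains 0 and has 1 on its boundary.\<close>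

lemma euler_transform_holomorphic:
  fixes c :: "nat \<Rightarrow> complex" and w :: complex
  assumes pos: "\<And>n k. moment_difference c n k \<ge> 0" and w: "norm (1 - w) < 1"
  obtains G where "G holomorphic_on {z. norm (1 - w + w * z) < 1}"
    "G has_fps_expansion Abs_fps c"
proof -
  define D where "D = {z. norm (1 - w + w * z) < 1}"
  define P where "P = (\<lambda>j z. w * (\<Sum>n\<le>j. of_nat (j choose n) * (1 - w) ^ (j - n) * (w * z) ^ n * c n))"
  define G where "G = (\<lambda>z. \<Sum>j. P j z)"
  have w0: "w \<noteq> 0" using w by auto
  have openD: "open D" unfolding D_def by (intro open_Collect_less continuous_intros)
  have D0: "0 \<in> D" using w by (simp add: D_def)
  have bound: "norm (P j z) \<le> norm w * (r ^ j * norm (c 0))"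
    if "norm (1 - w) \<le> r" "norm (1 - w + w * z) \<le> r" for j z r
  proof -
    have "P j z = w * poly_moment c ([:1 - w, (1 - w + w * z) - (1 - w):] ^ j)"
      unfolding P_def poly_moment_linear_power(1) by simp
    then show ?thesis
      using poly_moment_linear_power_bound[OF pos that, of j]
      by (simp add: norm_mult mult_left_mono)
  qed
  have ulim: "\<exists>d. 0 < d \<and> cball x d \<subseteq> D \<and> uniform_limit (cball x d) (\<lambda>J z. \<Sum>j<J. P j z) G sequentially"
    if x: "x \<in> D" for x
  proof -
    \<comment> \<open>The radius d is half of the distance to the boundary, so |1 - w + w z| stays
      below a fixed r < 1 on the whole ball and the Weierstrass test applies.\<close>
    define d where "d = (1 - norm (1 - w + w * x)) / (2 * norm w)"
    define r where "r = max (norm (1 - w)) ((1 + norm (1 - w + w * x)) / 2)"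
    have d: "d > 0" using x w0 by (simp add: d_def D_def)
    have r: "r < 1" using x w by (simp add: r_def D_def)
    have r0: "r \<ge> 0" by (simp add: r_def le_max_iff_disj)
    have le: "norm (1 - w + w * z) \<le> (1 + norm (1 - w + w * x)) / 2" if "z \<in> cball x d" for z
    proof -
      have "1 - w + w * z = (1 - w + w * x) + w * (z - x)" by (simp add: algebra_simps)
      then have "norm (1 - w + w * z) \<le> norm (1 - w + w * x) + norm w * norm (z - x)"
        by (metis norm_triangle_ineq norm_mult)
      also have "norm w * norm (z - x) \<le> norm w * d"
        using that by (intro mult_left_mono) (auto simp: dist_norm norm_minus_commute)
      also have "norm w * d = (1 - norm (1 - w + w * x)) / 2" using w0 by (simp add: d_def)
      finally show ?thesis by (simp add: field_simps)
    qed
    have "cball x d \<subseteq> D"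
    proof
      fix z assume "z \<in> cball x d"
      from le[OF this] x show "z \<in> D" by (simp add: D_def)
    qed
    moreover have "uniform_limit (cball x d) (\<lambda>J z. \<Sum>j<J. P j z) G sequentially"
      unfolding G_def
    proof (rule Weierstrass_m_test)
      show "norm (P j z) \<le> norm w * (r ^ j * norm (c 0))" if "z \<in> cball x d" for j z
        using le[OF that] by (intro bound) (auto simp: r_def le_max_iff_disj)
      show "summable (\<lambda>j. norm w * (r ^ j * norm (c 0)))"
        using r r0 by (intro summable_mult summable_mult2 summable_geometric) auto
    qed
    ultimately show ?thesis using d by blast
  qed
  have holP: "(\<lambda>z. \<Sum>j<J. P j z) holomorphic_on A" for J A
    unfolding P_def by (intro holomorphic_intros)
  have holG: "G holomorphic_on D"
    by (rule holomorphic_uniform_sequence[OF openD holP ulim])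
  have coeff: "(deriv ^^ m) G 0 / fact m = c m" for m
  proof -
    obtain d where d: "d > 0" "cball 0 d \<subseteq> D" "uniform_limit (cball 0 d) (\<lambda>J z. \<Sum>j<J. P j z) G sequentially"
      using ulim[OF D0] by blast
    have "(\<lambda>J. (deriv ^^ m) (\<lambda>z. \<Sum>j<J. P j z) 0) \<longlonglongrightarrow> (deriv ^^ m) G 0"
    proof (rule higher_deriv_complex_uniform_limit)
      show "uniform_limit (ball 0 d) (\<lambda>J z. \<Sum>j<J. P j z) G sequentially"
        using d(3) by (rule uniform_limit_on_subset) auto
    qed (use d holP in auto)
    then have lim1: "(\<lambda>J. (deriv ^^ m) (\<lambda>z. \<Sum>j<J. P j z) 0 / fact m) \<longlonglongrightarrow> (deriv ^^ m) G 0 / fact m"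
      by (intro tendsto_intros) auto
    have nth: "(deriv ^^ m) (\<lambda>z. \<Sum>j<J. P j z) 0 / fact m
       = (\<Sum>j<J. w * (of_nat (j choose m) * (1 - w) ^ (j - m) * w ^ m * c m))" for J
    proof -
      have "(\<lambda>z. \<Sum>j<J. w * (\<Sum>n\<le>j. (of_nat (j choose n) * (1 - w) ^ (j - n) * w ^ n * c n) * z ^ n))
        has_fps_expansion (\<Sum>j<J. fps_const w * (\<Sum>n\<le>j. fps_const (of_nat (j choose n) * (1 - w) ^ (j - n) * w ^ n * c n) * fps_X ^ n))"
        by (intro fps_expansion_intros)
      also have "(\<lambda>z. \<Sum>j<J. w * (\<Sum>n\<le>j. (of_nat (j choose n) * (1 - w) ^ (j - n) * w ^ n * c n) * z ^ n)) = (\<lambda>z. \<Sum>j<J. P j z)"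
        unfolding P_def by (simp add: power_mult_distrib mult_ac)
      finally have "(deriv ^^ m) (\<lambda>z. \<Sum>j<J. P j z) 0 / fact m =
          (\<Sum>j<J. fps_const w * (\<Sum>n\<le>j. fps_const (of_nat (j choose n) * (1 - w) ^ (j - n) * w ^ n * c n) * fps_X ^ n)) $ m"
        by (rule fps_nth_fps_expansion[symmetric])
      also have "\<dots> = (\<Sum>j<J. w * (of_nat (j choose m) * (1 - w) ^ (j - m) * w ^ m * c m))"
        unfolding fps_sum_nth
      proof (intro sum.cong refl)
        fix j
        have "(\<Sum>n\<le>j. (fps_const (of_nat (j choose n) * (1 - w) ^ (j - n) * w ^ n * c n) * fps_X ^ n) $ m)
            = (\<Sum>n\<le>j. if n = m then of_nat (j choose n) * (1 - w) ^ (j - n) * w ^ n * c n else 0)"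
          by (intro sum.cong refl) (simp add: fps_X_power_iff)
        also have "\<dots> = of_nat (j choose m) * (1 - w) ^ (j - m) * w ^ m * c m"
          by (simp add: binomial_eq_0)
        finally show "(fps_const w * (\<Sum>n\<le>j. fps_const (of_nat (j choose n) * (1 - w) ^ (j - n) * w ^ n * c n) * fps_X ^ n)) $ m
             = w * (of_nat (j choose m) * (1 - w) ^ (j - m) * w ^ m * c m)"
          by (simp add: fps_sum_nth)
      qed
      finally show ?thesis .
    qed
    \<comment> \<open>The coefficient of z^m in the limit is c m times w^(m+1) / (1 - (1 - w))^(m+1)
      = 1; the terms with j < m vanish with the binomial coefficient.\<close>
    have "(\<lambda>j. w * (of_nat (j choose m) * (1 - w) ^ (j - m) * w ^ m * c m)) sums c m"
    proof -
      have "(\<lambda>j. w ^ Suc m * c m * (of_nat ((m + j) choose m) * (1 - w) ^ j)) sums (w ^ Suc m * c m * (1 / (1 - (1 - w)) ^ Suc m))"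
        by (intro sums_mult negative_binomial_sums w)
      then have "(\<lambda>j. w * (of_nat ((j + m) choose m) * (1 - w) ^ ((j + m) - m) * w ^ m * c m)) sums c m"
        using w0 by (simp add: mult_ac add.commute)
      then show ?thesis
        by (subst (asm) sums_iff_shift) (simp add: binomial_eq_0)
    qed
    then have lim2: "(\<lambda>J. (deriv ^^ m) (\<lambda>z. \<Sum>j<J. P j z) 0 / fact m) \<longlonglongrightarrow> c m"
      unfolding nth sums_def .
    from LIMSEQ_unique[OF lim1 lim2] show ?thesis .
  qed
  have "G has_fps_expansion fps_expansion G 0"
    by (rule has_fps_expansion_fps_expansion[OF openD D0 holG])
  moreover have "fps_expansion G 0 = Abs_fps c"
    by (simp add: fps_expansion_def coeff)
  ultimately show thesis using that[of G] holG unfolding D_def by simp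
qed

lemma has_fps_expansion_reflect:
  fixes g :: "complex \<Rightarrow> complex"
  assumes "g has_fps_expansion G"
  shows "(\<lambda>z. g (- z)) has_fps_expansion Abs_fps (\<lambda>n. (-1) ^ n * G $ n)"
proof -
  have "(g \<circ> (\<lambda>z. - z)) has_fps_expansion fps_compose G (- fps_X)"
    by (intro has_fps_expansion_compose assms fps_expansion_intros) auto
  then show ?thesis by (simp add: o_def fps_compose_uminus')
qed

lemma has_fps_expansion_sums:
  fixes g :: "complex \<Rightarrow> complex"
  assumes "g has_fps_expansion G"
  shows "eventually (\<lambda>z. (\<lambda>n. G $ n * z ^ n) sums g z) (nhds 0)"
proof -
  obtain r where r: "r > 0" "ereal r \<le> fps_conv_radius G"
    using assms unfolding has_fps_expansion_def
    by (metis ereal_dense2 ereal_less(2) less_imp_le)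
  have "eventually (\<lambda>z::complex. z \<in> ball 0 r) (nhds 0)"
    using r by (intro eventually_nhds_in_open) auto
  moreover have "eventually (\<lambda>z. eval_fps G z = g z) (nhds 0)"
    using assms by (simp add: has_fps_expansion_def)
  ultimately show ?thesis
  proof eventually_elim
    case (elim z)
    have "ereal (norm z) < fps_conv_radius G"
      using elim(1) by (intro less_le_trans[OF _ r(2)]) simp
    from sums_eval_fps[OF this] show ?case using elim(2) by simp
  qed
qed

text \<open>|1 - \<eta> u|^2 = 1 - 2 \<eta> Re u + \<eta>^2 |u|^2 is below 1 as soon as 0 < \<eta> <
  2 Re u / |u|^2; the minimum of the two values Re u / |u|^2 serves both points.\<close>

lemma common_contraction:
  fixes a b :: complex
  assumes "Re a > 0" "Re b > 0"
  obtains \<eta> :: real where "norm (1 - of_real \<eta> * a) < 1" "norm (1 - of_real \<eta> * b) < 1"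
proof -
  define \<eta> where "\<eta> = min (Re a / norm a ^ 2) (Re b / norm b ^ 2)"
  have nz: "norm a ^ 2 > 0" "norm b ^ 2 > 0" using assms by auto
  then have \<eta>: "\<eta> > 0" using assms by (simp add: \<eta>_def)
  have *: "norm (1 - of_real \<eta> * u) < 1" if u: "Re u > 0" "\<eta> \<le> Re u / norm u ^ 2" for u
  proof -
    have "norm u ^ 2 > 0" using u(1) by auto
    then have "\<eta> * norm u ^ 2 \<le> Re u" using u(2) by (simp add: field_simps)
    then have "\<eta> * (\<eta> * norm u ^ 2) \<le> \<eta> * Re u" using \<eta> by (intro mult_left_mono) auto
    moreover have "norm (1 - of_real \<eta> * u) ^ 2 = 1 - 2 * (\<eta> * Re u) + \<eta> * (\<eta> * norm u ^ 2)"
      unfolding cmod_power2 by (simp add: power2_eq_square algebra_simps)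
    moreover have "\<eta> * Re u > 0" using \<eta> u by simp
    ultimately have "norm (1 - of_real \<eta> * u) ^ 2 < 1 ^ 2" by simp
    then show ?thesis by (rule power2_less_imp_less) simp
  qed
  show thesis by (rule that[of \<eta>]; rule *) (use assms in \<open>auto simp: \<eta>_def\<close>)
qed

lemma even_imp_logderiv_even_coeff_0:
  fixes f :: "complex \<Rightarrow> complex"
  assumes F: "f has_fps_expansion F" "F $ 0 \<noteq> 0" and even: "\<And>s. f (- s) = f s"
    and hol: "f holomorphic_on UNIV"
  shows "fps_logderiv F $ (2 * n) = 0"
proof -
  define k where "k = (\<lambda>z. deriv f z / f z)"
  have k: "k has_fps_expansion fps_logderiv F"
    unfolding k_def by (rule has_fps_expansion_logderiv[OF F])
  have "deriv f (- z) = - deriv f z" for z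
  proof -
    have "(f has_field_derivative deriv f (- z)) (at (- z))"
      using hol by (intro holomorphic_derivI[of _ UNIV]) auto
    then have "((\<lambda>z. f (- z)) has_field_derivative deriv f (- z) * (- 1)) (at z)"
      by (intro DERIV_chain2[of f _ uminus]) (auto intro!: derivative_eq_intros)
    then have "(f has_field_derivative - deriv f (- z)) (at z)" by (simp add: even)
    then have "deriv f z = - deriv f (- z)" by (rule DERIV_imp_deriv)
    then show ?thesis by simp
  qed
  then have "(\<lambda>z. k (- z)) = (\<lambda>z. - k z)" by (simp add: k_def even)
  then have "(\<lambda>z. - k z) has_fps_expansion Abs_fps (\<lambda>n. (-1) ^ n * fps_logderiv F $ n)"
    using has_fps_expansion_reflect[OF k] by simp
  moreover have "(\<lambda>z. - k z) has_fps_expansion - fps_logderiv F"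
    by (intro fps_expansion_intros k)
  ultimately have "Abs_fps (\<lambda>n. (-1) ^ n * fps_logderiv F $ n) = - fps_logderiv F"
    by (rule fps_expansion_unique_complex)
  then have "Abs_fps (\<lambda>n. (-1) ^ n * fps_logderiv F $ n) $ (2 * n) = (- fps_logderiv F) $ (2 * n)"
    by simp
  then show ?thesis by simp
qed

text \<open>For nonreal z the point L z^2 avoids [1, oo), so some disc of the Euler transform
  contains it, and f'/f continues holomorphically along the segment from 0 to z. A zero at z would
  then propagate back to 0.\<close>

lemma moment_differences_nonneg_imp_real_zeros:
  fixes f :: "complex \<Rightarrow> complex"
  assumes hol: "f holomorphic_on UNIV" and f0: "f 0 \<noteq> 0"
    and F: "f has_fps_expansion F" and even: "\<And>s. f (- s) = f s"
    and m: "\<And>k. m k = - (fps_logderiv F $ (2 * k + 3)) / 2"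
    and L: "L > 0"
    and pos: "\<And>n k. (\<Sum>j\<le>k. (-1) ^ j * of_nat (k choose j) * (m (n + j) / of_real (L ^ (n + j)))) \<ge> 0"
    and zero: "f z = 0"
  shows "z \<in> \<real>"
proof (rule ccontr)
  assume nonreal: "z \<notin> \<real>"
  define u where "u = 1 - of_real L * z\<^sup>2"
  have "u \<notin> \<real>\<^sub>\<le>\<^sub>0"
  proof
    assume "u \<in> \<real>\<^sub>\<le>\<^sub>0"
    then obtain x where x: "u = of_real x" "x \<le> 0" by (auto elim!: nonpos_Reals_cases)
    then have "z\<^sup>2 = of_real ((1 - x) / L)" using L by (simp add: u_def field_simps)
    then have "z\<^sup>2 = (of_real (sqrt ((1 - x) / L)))\<^sup>2"
      using x L by (simp flip: of_real_power)
    then have "z = of_real (sqrt ((1 - x) / L)) \<or> z = - of_real (sqrt ((1 - x) / L))"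
      by (simp add: power2_eq_iff)
    with nonreal show False by auto
  qed
  moreover have "u \<in> \<real>\<^sub>\<le>\<^sub>0" if "Re (csqrt u) = 0"
  proof -
    have "csqrt u = \<i> * of_real (Im (csqrt u))" using that by (simp add: complex_eq_iff)
    then have "u = (\<i> * of_real (Im (csqrt u)))\<^sup>2" by (metis power2_csqrt)
    then have "u = of_real (- (Im (csqrt u))\<^sup>2)" by (simp add: power_mult_distrib)
    then show ?thesis by (metis nonpos_Reals_of_real_iff neg_le_0_iff_le zero_le_power2)
  qed
  ultimately have Re_sqrt: "Re (csqrt u) > 0"
    using csqrt_principal[of u] by auto
  \<comment> \<open>Wanted is a direction w such that w and w (1 - L z^2) = w u both lie in the
    right half plane. The conjugate of the square root of u splits the argument of u evenly: a has
    the argument of 1 / sqrt u and a u that of sqrt u, both below pi/2 in modulus.\<close>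
  define a where "a = cnj (csqrt u)"
  have au: "a * u = of_real ((norm (csqrt u))\<^sup>2) * csqrt u"
  proof -
    have "a * u = (csqrt u * cnj (csqrt u)) * csqrt u"
      unfolding a_def by (subst (2) power2_csqrt[symmetric]) (simp add: power2_eq_square mult_ac)
    also have "csqrt u * cnj (csqrt u) = of_real ((norm (csqrt u))\<^sup>2)"
      by (rule complex_norm_square[symmetric])
    finally show ?thesis .
  qed
  have "Re a > 0" using Re_sqrt by (simp add: a_def)
  moreover have "Re (a * u) > 0"
    unfolding au using Re_sqrt by (auto intro!: mult_pos_pos)
  ultimately obtain \<eta> :: real where \<eta>: "norm (1 - of_real \<eta> * a) < 1" "norm (1 - of_real \<eta> * (a * u)) < 1"
    by (rule common_contraction)
  define w where "w = of_real \<eta> * a"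
  define c where "c = (\<lambda>n. m n / of_real (L ^ n))"
  have w: "norm (1 - w) < 1" using \<eta> by (simp add: w_def)
  have "moment_difference c n k \<ge> 0" for n k
    using pos[where n = n and k = k] by (simp add: moment_difference_def c_def)
  then obtain G where G: "G holomorphic_on {z. norm (1 - w + w * z) < 1}" "G has_fps_expansion Abs_fps c"
    using euler_transform_holomorphic[OF _ w] by blast
  \<comment> \<open>This open set is starlike about 0: L s^2 ranges over a disc containing 0, and
    scaling s by t moves L s^2 to t^2 L s^2, on the segment towards 0.\<close>
  define U where "U = {s. norm (1 - w + w * (of_real L * s\<^sup>2)) < 1}"
  have openU: "open U" unfolding U_def by (intro open_Collect_less continuous_intros)
  have U0: "0 \<in> U" using w by (simp add: U_def)
  have zU: "z \<in> U"
  proof -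
    have "1 - w + w * (of_real L * z\<^sup>2) = 1 - of_real \<eta> * (a * u)"
      by (simp add: w_def u_def algebra_simps)
    then have "norm (1 - w + w * (of_real L * z\<^sup>2)) < 1" using \<eta>(2) by (simp only:)
    then show ?thesis by (simp add: U_def)
  qed
  have seg: "closed_segment 0 s \<subseteq> U" if s: "s \<in> U" for s
  proof
    fix x assume "x \<in> closed_segment 0 s"
    then obtain t where t: "x = of_real t * s" "0 \<le> t" "t \<le> 1"
      by (auto simp: in_segment scaleR_conv_of_real)
    have t2: "0 \<le> t\<^sup>2" "t\<^sup>2 \<le> 1" using t by (auto simp: power_le_one)
    have "1 - w + w * (of_real L * x\<^sup>2) = of_real (1 - t\<^sup>2) * (1 - w) + of_real (t\<^sup>2) * (1 - w + w * (of_real L * s\<^sup>2))"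
      unfolding t(1) by (simp add: power_mult_distrib algebra_simps)
    moreover have "norm (of_real (1 - t\<^sup>2) * (1 - w)) = (1 - t\<^sup>2) * norm (1 - w)"
      using t2 by (simp add: norm_mult del: of_real_diff)
    moreover have "norm (of_real (t\<^sup>2) * (1 - w + w * (of_real L * s\<^sup>2))) = t\<^sup>2 * norm (1 - w + w * (of_real L * s\<^sup>2))"
      using t2 by (simp add: norm_mult norm_power)
    ultimately have "norm (1 - w + w * (of_real L * x\<^sup>2)) \<le> (1 - t\<^sup>2) * norm (1 - w) + t\<^sup>2 * norm (1 - w + w * (of_real L * s\<^sup>2))"
      by (metis norm_triangle_ineq)
    also have "\<dots> < 1"
      using convex_bound_lt[of "norm (1 - w)" 1 "norm (1 - w + w * (of_real L * s\<^sup>2))" "1 - t\<^sup>2" "t\<^sup>2"] s w t2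
      by (simp add: U_def)
    finally show "x \<in> U" by (simp add: U_def)
  qed
  have star: "starlike U" unfolding starlike_def using U0 seg by blast
  have conn: "connected U" by (rule starlike_imp_connected[OF star])
  \<comment> \<open>The moments start at the Taylor coefficient of index 3, so the linear term of
    f'/f is added by hand. The factor -2 undoes the normalisation in m, and the argument L s^2
    undoes the L^n in c.\<close>
  define h where "h = (\<lambda>s. fps_logderiv F $ 1 * s - 2 * s ^ 3 * G (of_real L * s\<^sup>2))"
  have holh: "h holomorphic_on U"
  proof -
    have "(G \<circ> (\<lambda>s. of_real L * s\<^sup>2)) holomorphic_on U"
      by (rule holomorphic_on_compose_gen[OF _ G(1)]) (auto intro!: holomorphic_intros simp: U_def)
    then have "(\<lambda>s. G (of_real L * s\<^sup>2)) holomorphic_on U" by (simp only: o_def)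
    then show ?thesis unfolding h_def by (intro holomorphic_intros)
  qed
  have F0: "F $ 0 \<noteq> 0"
    using F f0 has_fps_expansion_imp_0_eq_fps_nth_0 by metis
  have "eventually (\<lambda>s. deriv f s = f s * h s) (nhds 0)"
  proof -
    have "eventually (\<lambda>s. (\<lambda>n. Abs_fps c $ n * (of_real L * s\<^sup>2) ^ n) sums G (of_real L * s\<^sup>2)) (nhds 0)"
    proof (rule eventually_compose_filterlim[OF has_fps_expansion_sums[OF G(2)]])
      have "((\<lambda>s. of_real L * s\<^sup>2) \<longlongrightarrow> (of_real L * 0\<^sup>2 :: complex)) (nhds 0)"
        by (intro tendsto_intros filterlim_ident)
      then show "filterlim (\<lambda>s. of_real L * s\<^sup>2) (nhds 0) (nhds (0::complex))" by simp
    qed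
    moreover have "eventually (\<lambda>s. (\<lambda>n. fps_logderiv F $ n * s ^ n) sums (deriv f s / f s)) (nhds 0)"
      by (rule has_fps_expansion_sums[OF has_fps_expansion_logderiv[OF F F0]])
    moreover have "eventually (\<lambda>s. f s \<noteq> 0) (nhds 0)"
    proof -
      have "open {s. f s \<noteq> 0}"
        by (intro open_Collect_neq holomorphic_on_imp_continuous_on hol continuous_intros)
      from eventually_nhds_in_open[OF this, of 0] show ?thesis using f0 by simp
    qed
    ultimately show ?thesis
    proof eventually_elim
      case (elim s)
      \<comment> \<open>f'/f is odd, so only odd indices occur; splitting off index 1 leaves the
        indices 2 n + 3 of the moments.\<close>
      have "(\<lambda>n. fps_logderiv F $ (2 * n + 1) * s ^ (2 * n + 1)) sums (deriv f s / f s)"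
      proof (subst sums_mono_reindex)
        fix n :: nat assume "n \<notin> range (\<lambda>n. 2 * n + 1)"
        then have "even n" using oddE by blast
        then show "fps_logderiv F $ n * s ^ n = 0"
          using even_imp_logderiv_even_coeff_0[OF F F0 even hol] by (auto elim!: evenE)
      qed (use elim(2) in \<open>auto simp: strict_mono_def\<close>)
      then have "(\<lambda>n. fps_logderiv F $ (2 * Suc n + 1) * s ^ (2 * Suc n + 1)) sums (deriv f s / f s - fps_logderiv F $ (2 * 0 + 1) * s ^ (2 * 0 + 1))"
        by (subst sums_Suc_iff) simp
      moreover have "2 * Suc n + 1 = 2 * n + 3" for n by simp
      ultimately have 1: "(\<lambda>n. fps_logderiv F $ (2 * n + 3) * s ^ (2 * n + 3)) sums (deriv f s / f s - fps_logderiv F $ 1 * s)"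
        by (simp only: mult_0_right add_0 power_one_right)
      have "(\<lambda>n. - 2 * s ^ 3 * (Abs_fps c $ n * (of_real L * s\<^sup>2) ^ n)) sums (- 2 * s ^ 3 * G (of_real L * s\<^sup>2))"
        by (intro sums_mult elim(1))
      moreover have "- 2 * s ^ 3 * (Abs_fps c $ n * (of_real L * s\<^sup>2) ^ n) = fps_logderiv F $ (2 * n + 3) * s ^ (2 * n + 3)" for n
      proof -
        have "c n * (of_real L * s\<^sup>2) ^ n = m n * s ^ (2 * n)"
          using L by (simp add: c_def power_mult_distrib power_mult)
        then have "- 2 * s ^ 3 * (c n * (of_real L * s\<^sup>2) ^ n) = (- 2 * m n) * s ^ (2 * n + 3)"
          by (simp only: power_add mult_ac)
        then show ?thesis by (simp add: m)
      qed
      ultimately have "(\<lambda>n. fps_logderiv F $ (2 * n + 3) * s ^ (2 * n + 3)) sums (- 2 * s ^ 3 * G (of_real L * s\<^sup>2))"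
        by simp
      from sums_unique2[OF 1 this] have "deriv f s / f s = h s"
        by (simp add: h_def algebra_simps)
      then show ?case using elim(3) by (simp add: field_simps)
    qed
  qed
  then obtain V where V: "open V" "0 \<in> V" "\<And>s. s \<in> V \<Longrightarrow> deriv f s = f s * h s"
    unfolding eventually_nhds by blast
  have ode: "deriv f s = f s * h s" if "s \<in> U" for s
  proof (rule analytic_continuation_open[of "V \<inter> U" U "deriv f" "\<lambda>s. f s * h s"])
    show "deriv f holomorphic_on U"
      by (rule holomorphic_on_subset[OF holomorphic_deriv[OF hol open_UNIV]]) simp
    show "(\<lambda>s. f s * h s) holomorphic_on U"
      by (intro holomorphic_intros holh holomorphic_on_subset[OF hol]) simp
  qed (use V openU U0 conn that in auto)
  \<comment> \<open>With a primitive H of h, the function f exp(-H) has derivative 0 on U; its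
    values at z and at 0 are then equal, which gives the contradiction.\<close>
  obtain H where H: "\<And>s. s \<in> U \<Longrightarrow> (H has_field_derivative h s) (at s)"
    using holomorphic_starlike_primitive[OF holomorphic_on_imp_continuous_on[OF holh] star openU finite.emptyI]
      holh openU by (metis Diff_empty holomorphic_on_imp_differentiable_at)
  have der: "((\<lambda>s. f s * exp (- H s)) has_field_derivative 0) (at s)" if "s \<in> U" for s
  proof -
    have "(f has_field_derivative f s * h s) (at s)"
      using holomorphic_derivI[OF hol open_UNIV, of s] ode[OF that] by simp
    then have "((\<lambda>s. f s * exp (- H s)) has_field_derivative
        (f s * h s) * exp (- H s) + (exp (- H s) * (- h s)) * f s) (at s)"
      by (intro derivative_intros H[OF that])
    then show ?thesis by (simp add: algebra_simps)
  qed
  obtain k where k: "\<And>s. s \<in> U \<Longrightarrow> f s * exp (- H s) = k"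
  proof (rule DERIV_zero_connected_constant[OF conn openU finite.emptyI])
    show "continuous_on U (\<lambda>s. f s * exp (- H s))"
      using der by (meson DERIV_continuous continuous_at_imp_continuous_on)
  qed (use der in auto)
  from k[OF zU] zero have "k = 0" by simp
  with k[OF U0] f0 show False by simp
qed

section \<open>Fourier series and Poisson summation\<close>

text \<open>Half open, so that integer translates tile the line without overlap; of total mass 1, so
  that bounded measurable functions are integrable.\<close>

definition unit_interval :: "real measure" where
  "unit_interval = restrict_space lborel {0..<1}"

definition fourier_char :: "int \<Rightarrow> real \<Rightarrow> complex" where
  "fourier_char k v = cis (2 * pi * of_int k * v)"

definition fourier_coeff :: "(real \<Rightarrow> complex) \<Rightarrow> int \<Rightarrow> complex" where
  "fourier_coeff h k = (LINT v|unit_interval. h v * fourier_char (- k) v)"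

lemma prob_space_unit_interval: "prob_space unit_interval"
  unfolding unit_interval_def
  by (rule prob_spaceI) (simp add: emeasure_restrict_space space_restrict_space)

interpretation unit_interval: prob_space unit_interval
  by (rule prob_space_unit_interval)

lemma space_unit_interval: "space unit_interval = {0..<1}"
  by (simp add: unit_interval_def space_restrict_space)

lemma fourier_char_add: "fourier_char (k + l) v = fourier_char k v * fourier_char l v"
  by (simp add: fourier_char_def cis_mult algebra_simps)

lemma fourier_char_0: "fourier_char 0 v = 1"
  by (simp add: fourier_char_def)

lemma cnj_fourier_char: "cnj (fourier_char k v) = fourier_char (- k) v"
  by (simp add: fourier_char_def cis_cnj)

lemma norm_fourier_char: "norm (fourier_char k v) = 1"
  by (simp add: fourier_char_def)

lemma fourier_char_periodic: "fourier_char k (v + of_int n) = fourier_char k v"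
proof -
  have "2 * pi * of_int k * (v + of_int n) = 2 * pi * of_int k * v + 2 * pi * of_int (k * n)"
    by (simp add: algebra_simps)
  then show ?thesis unfolding fourier_char_def
    by (simp add: cis_multiple_2pi flip: cis_mult)
qed

lemma fourier_char_measurable [measurable]: "fourier_char k \<in> borel_measurable borel"
proof -
  have "continuous_on UNIV (fourier_char k)"
    unfolding fourier_char_def[abs_def] by (intro continuous_intros)
  then show ?thesis by (rule borel_measurable_continuous_onI)
qed

lemma borel_measurable_cnj [measurable]:
  assumes "f \<in> borel_measurable M"
  shows "(\<lambda>x. cnj (f x)) \<in> borel_measurable M"
  by (rule borel_measurable_continuous_on[OF _ assms]) (intro continuous_intros)

lemma unit_interval_measurableI:
  "f \<in> borel_measurable borel \<Longrightarrow> f \<in> borel_measurable unit_interval"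
  unfolding unit_interval_def by (intro measurable_restrict_space1) simp

lemma fourier_char_measurable_unit_interval [measurable]:
  "fourier_char k \<in> borel_measurable unit_interval"
  by (intro unit_interval_measurableI fourier_char_measurable)

lemma has_vector_derivative_fourier_char:
  "(fourier_char k has_vector_derivative (2 * pi * of_int k * \<i>) * fourier_char k v) (at v within S)"
proof -
  have "((\<lambda>z. exp (2 * pi * of_int k * \<i> * z)) has_field_derivative
          (2 * pi * of_int k * \<i>) * exp (2 * pi * of_int k * \<i> * of_real v)) (at (of_real v))"
    by (auto intro!: derivative_eq_intros)
  then have "((\<lambda>v. exp (2 * pi * of_int k * \<i> * of_real v)) has_vector_derivative
          (2 * pi * of_int k * \<i>) * exp (2 * pi * of_int k * \<i> * of_real v)) (at v within S)"
    by (rule has_vector_derivative_real_field)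
  moreover have "fourier_char k = (\<lambda>v. exp (2 * pi * of_int k * \<i> * of_real v))"
    by (rule ext) (simp add: fourier_char_def cis_conv_exp mult_ac)
  ultimately show ?thesis by simp
qed

lemma integral_fourier_char: "(LINT v|unit_interval. fourier_char k v) = (if k = 0 then 1 else 0)"
proof (cases "k = 0")
  case True
  then show ?thesis by (simp add: fourier_char_0 unit_interval.prob_space)
next
  case False
  define c where "c = (2 * pi * of_int k * \<i> :: complex)"
  have c: "c \<noteq> 0" using False by (simp add: c_def)
  have "(LINT v|unit_interval. fourier_char k v) = integral\<^sup>L lborel (\<lambda>x. indicator {0..<1} x *\<^sub>R fourier_char k x)"
    unfolding unit_interval_def by (rule integral_restrict_space) simp
  also have "\<dots> = integral\<^sup>L lborel (\<lambda>x. indicator {0..1} x *\<^sub>R fourier_char k x)"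
    using AE_lborel_singleton[of 1]
    by (intro integral_cong_AE) (auto simp: indicator_def elim!: eventually_mono)
  also have "\<dots> = fourier_char k 1 / c - fourier_char k 0 / c"
  proof (rule integral_FTC_atLeastAtMost)
    show "((\<lambda>v. fourier_char k v / c) has_vector_derivative fourier_char k v) (at v within {0..1})" for v
      using has_vector_derivative_divide[OF has_vector_derivative_fourier_char[of k v], of c] c
      by (simp add: c_def)
    show "continuous_on {0..1} (fourier_char k)"
      unfolding fourier_char_def[abs_def] by (intro continuous_intros)
  qed simp
  also have "\<dots> = 0" using fourier_char_periodic[of k 0 1] by simp
  finally show ?thesis using False by simp
qed

lemma integrable_unit_interval_bounded:
  fixes f :: "real \<Rightarrow> 'a::{banach, second_countable_topology}"
  assumes "f \<in> borel_measurable unit_interval" "\<And>v. v \<in> {0..1} \<Longrightarrow> norm (f v) \<le> B"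
  shows "integrable unit_interval f"
proof (rule unit_interval.integrable_const_bound)
  show "AE v in unit_interval. norm (f v) \<le> B"
    by (rule AE_I2) (simp add: space_unit_interval assms(2))
qed (rule assms(1))

lemma integrable_mult_fourier_char:
  assumes "integrable unit_interval h"
  shows "integrable unit_interval (\<lambda>v. h v * fourier_char k v)"
  by (rule Bochner_Integration.integrable_bound[OF assms]) (use assms in \<open>auto simp: norm_mult norm_fourier_char\<close>)

lemma integrable_fourier_char: "integrable unit_interval (fourier_char k)"
  using integrable_mult_fourier_char[of "\<lambda>_. 1"] by simp

text \<open>Bessel's inequality, from expanding the integral of |h - p|^2 >= 0 for the Fourier
  partial sum p over S: the integrals of h times the conjugate of p and of |p|^2 both equal the sum
  on the left.\<close>

lemma fourier_coeff_bessel: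
  assumes "h \<in> borel_measurable unit_interval" and B: "\<And>v. v \<in> {0..1} \<Longrightarrow> norm (h v) \<le> B"
    and S: "finite S"
  shows "(\<Sum>k\<in>S. norm (fourier_coeff h k) ^ 2) \<le> B ^ 2"
proof -
  have inth: "integrable unit_interval h"
    by (rule integrable_unit_interval_bounded[OF assms(1) B])
  define c where "c = fourier_coeff h"
  define p where "p = (\<lambda>v. \<Sum>k\<in>S. c k * fourier_char k v)"
  have intp: "integrable unit_interval p"
    unfolding p_def by (intro Bochner_Integration.integrable_sum integrable_mult_right integrable_fourier_char)
  have hp: "(LINT v|unit_interval. h v * cnj (p v)) = of_real (\<Sum>k\<in>S. norm (c k) ^ 2)"
  proof -
    have "h v * cnj (p v) = (\<Sum>k\<in>S. cnj (c k) * (h v * fourier_char (- k) v))" for v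
      unfolding p_def cnj_sum sum_distrib_left
      by (intro sum.cong refl) (simp add: cnj_fourier_char)
    then have "(LINT v|unit_interval. h v * cnj (p v)) = (LINT v|unit_interval. (\<Sum>k\<in>S. cnj (c k) * (h v * fourier_char (- k) v)))"
      by simp
    also have "\<dots> = (\<Sum>k\<in>S. cnj (c k) * c k)"
      unfolding c_def fourier_coeff_def
      by (subst Bochner_Integration.integral_sum) (auto intro!: integrable_mult_right integrable_mult_fourier_char inth)
    also have "\<dots> = (\<Sum>k\<in>S. of_real (norm (c k) ^ 2))"
      by (intro sum.cong refl) (metis complex_norm_square mult.commute of_real_power)
    finally show ?thesis by simp
  qed
  have pp: "(LINT v|unit_interval. p v * cnj (p v)) = of_real (\<Sum>k\<in>S. norm (c k) ^ 2)"
  proof -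
    have "p v * cnj (p v) = (\<Sum>k\<in>S. \<Sum>l\<in>S. (c k * cnj (c l)) * fourier_char (k - l) v)" for v
      unfolding p_def cnj_sum sum_product
      by (intro sum.cong refl) (simp add: cnj_fourier_char fourier_char_add[of _ "- _", simplified])
    then have "(LINT v|unit_interval. p v * cnj (p v)) = (LINT v|unit_interval. (\<Sum>k\<in>S. \<Sum>l\<in>S. (c k * cnj (c l)) * fourier_char (k - l) v))"
      by simp
    also have "\<dots> = (\<Sum>k\<in>S. \<Sum>l\<in>S. (c k * cnj (c l)) * (if k - l = 0 then 1 else 0))"
      by (simp only: Bochner_Integration.integral_sum Bochner_Integration.integrable_sum integrable_mult_right
          integrable_fourier_char integral_mult_right_zero integral_fourier_char)
    also have "\<dots> = (\<Sum>k\<in>S. of_real (norm (c k) ^ 2))"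
    proof (intro sum.cong refl)
      fix k assume k: "k \<in> S"
      have "(\<Sum>l\<in>S. (c k * cnj (c l)) * (if k - l = 0 then 1 else 0)) = (\<Sum>l\<in>S. if k = l then c k * cnj (c l) else 0)"
        by (intro sum.cong refl) auto
      then show "(\<Sum>l\<in>S. (c k * cnj (c l)) * (if k - l = 0 then 1 else 0)) = of_real (norm (c k) ^ 2)"
        using k S by (simp add: complex_norm_square flip: of_real_power)
    qed
    finally show ?thesis by simp
  qed
  have bdp: "norm (p v) \<le> (\<Sum>k\<in>S. norm (c k))" for v
    unfolding p_def by (rule order_trans[OF norm_sum]) (simp add: norm_mult norm_fourier_char)
  have meas: "p \<in> borel_measurable unit_interval" "(\<lambda>v. cnj (p v)) \<in> borel_measurable unit_interval"
     "(\<lambda>v. cnj (h v)) \<in> borel_measurable unit_interval"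
    using intp assms(1) by (auto intro!: borel_measurable_cnj)
  define P where "P = (\<Sum>k\<in>S. norm (c k))"
  have P0: "P \<ge> 0" unfolding P_def by (intro sum_nonneg) auto
  have B0: "B \<ge> 0" using order_trans[OF norm_ge_zero B[of 0]] by simp
  have int1: "integrable unit_interval (\<lambda>v. h v * cnj (p v))"
  proof (rule integrable_unit_interval_bounded)
    show "norm (h v * cnj (p v)) \<le> B * P" if "v \<in> {0..1}" for v
      unfolding norm_mult P_def complex_mod_cnj by (rule mult_mono[OF B[OF that] bdp B0 norm_ge_zero])
  qed (intro borel_measurable_times meas assms(1))
  have int2: "integrable unit_interval (\<lambda>v. p v * cnj (p v))"
  proof (rule integrable_unit_interval_bounded)
    show "norm (p v * cnj (p v)) \<le> P * P" for v
      unfolding norm_mult complex_mod_cnj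
      by (rule mult_mono[OF _ _ P0 norm_ge_zero]) (simp_all add: bdp P_def)
  qed (intro borel_measurable_times meas assms(1))
  have int3: "integrable unit_interval (\<lambda>v. h v * cnj (h v))"
  proof (rule integrable_unit_interval_bounded)
    show "norm (h v * cnj (h v)) \<le> B * B" if "v \<in> {0..1}" for v
      unfolding norm_mult complex_mod_cnj by (rule mult_mono[OF B[OF that] B[OF that] B0 norm_ge_zero])
  qed (intro borel_measurable_times meas assms(1))
  have eq: "complex_of_real (norm (h v - p v) ^ 2) = h v * cnj (h v) - h v * cnj (p v) - cnj (h v * cnj (p v)) + p v * cnj (p v)" for v
    by (simp add: complex_norm_square algebra_simps flip: of_real_power)
  have "complex_of_real (LINT v|unit_interval. norm (h v - p v) ^ 2) = (LINT v|unit_interval. complex_of_real (norm (h v - p v) ^ 2))"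
    by (rule integral_complex_of_real[symmetric])
  also have "\<dots> = (LINT v|unit_interval. h v * cnj (h v)) - (LINT v|unit_interval. h v * cnj (p v))
       - (LINT v|unit_interval. cnj (h v * cnj (p v))) + (LINT v|unit_interval. p v * cnj (p v))"
    unfolding eq
    by (simp only: Bochner_Integration.integral_add Bochner_Integration.integral_diff
      Bochner_Integration.integrable_add Bochner_Integration.integrable_diff int1 int2 int3 integrable_cnj)
  also have "\<dots> = (LINT v|unit_interval. h v * cnj (h v)) - of_real (\<Sum>k\<in>S. norm (c k) ^ 2)"
    unfolding Bochner_Integration.integral_cnj hp pp by simp
  also have "(LINT v|unit_interval. h v * cnj (h v)) = (LINT v|unit_interval. complex_of_real (norm (h v) ^ 2))"
    by (simp only: complex_norm_square)
  also have "\<dots> = of_real (LINT v|unit_interval. norm (h v) ^ 2)"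
    by (rule integral_complex_of_real)
  finally have "complex_of_real (LINT v|unit_interval. norm (h v - p v) ^ 2)
     = complex_of_real ((LINT v|unit_interval. norm (h v) ^ 2) - (\<Sum>k\<in>S. norm (c k) ^ 2))"
    unfolding of_real_diff .
  then have "(LINT v|unit_interval. norm (h v - p v) ^ 2) = (LINT v|unit_interval. norm (h v) ^ 2) - (\<Sum>k\<in>S. norm (c k) ^ 2)"
    by (rule of_real_eq_iff[THEN iffD1])
  moreover have "(LINT v|unit_interval. norm (h v - p v) ^ 2) \<ge> 0" by (rule integral_nonneg_AE) auto
  moreover have "(LINT v|unit_interval. norm (h v) ^ 2) \<le> (LINT v|unit_interval. B ^ 2)"
  proof (rule integral_mono)
    show "integrable unit_interval (\<lambda>v. norm (h v) ^ 2)"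
    proof (rule integrable_unit_interval_bounded)
      show "norm (norm (h v) ^ 2) \<le> B ^ 2" if "v \<in> {0..1}" for v
        using power_mono[OF B[OF that], of 2] by simp
    qed (use assms(1) in measurable)
  next
    show "norm (h v) ^ 2 \<le> B ^ 2" if "v \<in> space unit_interval" for v
      using power_mono[OF B[of v], of 2] that by (simp add: space_unit_interval)
  qed simp
  ultimately have "(\<Sum>k\<in>S. norm (c k) ^ 2) \<le> B ^ 2" by (simp add: unit_interval.prob_space)
  then show ?thesis by (simp add: c_def)
qed

text \<open>A form of the Riemann-Lebesgue lemma: by Bessel the squared coefficients are summable
  along any injective enumeration, which covers both positive and negative frequencies.\<close>

lemma fourier_coeff_tendsto_0:
  assumes "h \<in> borel_measurable unit_interval" and "\<And>v. v \<in> {0..1} \<Longrightarrow> norm (h v) \<le> B"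
    and g: "inj (g :: nat \<Rightarrow> int)"
  shows "(\<lambda>N. fourier_coeff h (g N)) \<longlonglongrightarrow> 0"
proof -
  have "summable (\<lambda>N. norm (fourier_coeff h (g N)) ^ 2)"
  proof (rule summableI_nonneg_bounded)
    show "(\<Sum>i<n. norm (fourier_coeff h (g i)) ^ 2) \<le> B ^ 2" for n
    proof -
      have "(\<Sum>i<n. norm (fourier_coeff h (g i)) ^ 2) = (\<Sum>k\<in>g ` {..<n}. norm (fourier_coeff h k) ^ 2)"
        using g by (subst sum.reindex) (auto simp: inj_on_def inj_def)
      then show ?thesis using fourier_coeff_bessel[OF assms(1,2), of "g ` {..<n}"] by simp
    qed
  qed auto
  then have "(\<lambda>N. norm (fourier_coeff h (g N)) ^ 2) \<longlonglongrightarrow> 0" by (rule summable_LIMSEQ_zero)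
  then have "(\<lambda>N. sqrt (norm (fourier_coeff h (g N)) ^ 2)) \<longlonglongrightarrow> sqrt 0" by (rule tendsto_real_sqrt)
  then show ?thesis by (simp add: tendsto_norm_zero_iff)
qed

text \<open>A linear lower bound for |exp(2 pi i v) - 1| = 2 |sin(pi v)| at both ends of [0, 1]; it
  keeps the quotient formed in \<open>fourier_series_at_0\<close> bounded.\<close>

lemma norm_fourier_char_minus_1_ge:
  assumes "0 \<le> v" "v \<le> 1"
  shows "min v (1 - v) \<le> norm (fourier_char 1 v - 1)"
proof -
  \<comment> \<open>On [0, pi/2] one has x < 2, so the Taylor remainder x^3 / 6 is at most 2 x / 3.
    The crude constant 1/3 is enough because 2 pi / 3 > 1.\<close>
  have sin_ge: "sin x \<ge> x / 3" if x: "0 \<le> x" "x \<le> pi / 2" for x :: real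
  proof -
    have "\<bar>sin x - (\<Sum>m<3. sin_coeff m * x ^ m)\<bar> \<le> inverse (fact 3) * \<bar>x\<bar> ^ 3"
      by (rule Maclaurin_sin_bound)
    then have "\<bar>sin x - x\<bar> * 6 \<le> x ^ 3"
      using x by (simp add: sin_coeff_def numeral_3_eq_3 fact_numeral)
    moreover have "x - sin x \<le> \<bar>sin x - x\<bar>" by simp
    ultimately have "(x - sin x) * 6 \<le> x ^ 3" by argo
    then have "sin x \<ge> x - x ^ 3 / 6" by (simp add: field_simps)
    moreover have "x ^ 2 \<le> 2 ^ 2" using x pi_less_4 by (intro power_mono) auto
    then have "x * x ^ 2 \<le> x * 4" using x by (intro mult_left_mono) auto
    then have "x ^ 3 \<le> 4 * x" by (simp add: power3_eq_cube power2_eq_square)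
    ultimately show ?thesis by linarith
  qed
  have "norm (fourier_char 1 v - 1) = 2 * \<bar>sin (pi * v)\<bar>"
    using dist_exp_i_1[of "2 * pi * v"] by (simp add: fourier_char_def cis_conv_exp mult_ac)
  moreover have "2 * sin (pi * v) \<ge> min v (1 - v)"
  proof (cases "v \<le> 1 / 2")
    case True
    have "sin (pi * v) \<ge> pi * v / 3" using True assms by (intro sin_ge) auto
    moreover have "pi * v \<ge> 2 * v" using pi_ge_two assms by (intro mult_right_mono) auto
    ultimately show ?thesis using assms by linarith
  next
    case False
    define u where "u = 1 - v"
    have "sin (pi * v) = sin (pi * u)" by (simp add: u_def algebra_simps sin_diff)
    moreover have "sin (pi * u) \<ge> pi * u / 3" using False assms by (intro sin_ge) (auto simp: u_def)
    moreover have "pi * u \<ge> 2 * u" using pi_ge_two assms by (intro mult_right_mono) (auto simp: u_def)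
    moreover have "min v u \<le> u" "u \<ge> 0" using assms by (auto simp: u_def)
    ultimately have "min v u \<le> 2 * sin (pi * v)" by argo
    then show ?thesis by (simp add: u_def)
  qed
  ultimately show ?thesis by linarith
qed

text \<open>Chernoff's argument: dividing \<open>G - G 0\<close> by \<open>exp (2\<pi>iv) - 1\<close> turns the partial sums of the
  Fourier series at \<open>0\<close> into telescoping ones.\<close>

lemma fourier_series_at_0:
  assumes meas: "G \<in> borel_measurable borel" and K: "K \<ge> 0"
    and left: "\<And>v. v \<in> {0..1} \<Longrightarrow> norm (G v - G 0) \<le> K * v"
    and right: "\<And>v. v \<in> {0..1} \<Longrightarrow> norm (G v - G 0) \<le> K * (1 - v)"
  shows "(\<lambda>N. \<Sum>k\<in>{- int N..int N}. fourier_coeff G k) \<longlonglongrightarrow> G 0"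
proof -
  \<comment> \<open>Where the denominator vanishes, at v = 0 and v = 1, the quotient has the value
    0. This does no harm: \<open>left\<close> and \<open>right\<close> force G v = G 0
    there.\<close>
  define h where "h = (\<lambda>v. (G v - G 0) / (fourier_char 1 v - 1))"
  have [measurable]: "h \<in> borel_measurable borel" unfolding h_def using meas by measurable
  then have meas_h: "h \<in> borel_measurable unit_interval" by (rule unit_interval_measurableI)
  have bd: "norm (h v) \<le> K" if v: "v \<in> {0..1}" for v
  proof (cases "fourier_char 1 v = 1")
    case True
    then show ?thesis using K by (simp add: h_def)
  next
    case False
    have "norm (G v - G 0) \<le> K * min v (1 - v)"
      using left[OF v] right[OF v] by (auto simp: min_def)
    also have "\<dots> \<le> K * norm (fourier_char 1 v - 1)"
      using v K by (intro mult_left_mono norm_fourier_char_minus_1_ge) auto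
    finally show ?thesis using False by (simp add: h_def norm_divide divide_simps)
  qed
  have Gh: "G v = G 0 + (fourier_char 1 v - 1) * h v" if v: "v \<in> {0..1}" for v
  proof (cases "fourier_char 1 v = 1")
    case True
    then have "min v (1 - v) \<le> 0" using norm_fourier_char_minus_1_ge[of v] v by auto
    then have "v = 0 \<or> v = 1" using v by (auto simp: min_def split: if_splits)
    then have "norm (G v - G 0) \<le> 0" using left[OF v] right[OF v] by auto
    then show ?thesis using True by simp
  qed (simp add: h_def)
  have inth: "integrable unit_interval h" by (rule integrable_unit_interval_bounded[OF meas_h bd])
  \<comment> \<open>Multiplication by exp(2 pi i v) shifts Fourier coefficients by one, so each
    coefficient of G is a difference of consecutive coefficients of h, apart from the constant G 0
    at k = 0.\<close>
  have coeff: "fourier_coeff G k = (if k = 0 then G 0 else 0) + fourier_coeff h (k - 1) - fourier_coeff h k" for k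
  proof -
    have "fourier_coeff G k = (LINT v|unit_interval. G 0 * fourier_char (- k) v + h v * fourier_char (- (k - 1)) v - h v * fourier_char (- k) v)"
      unfolding fourier_coeff_def
    proof (rule Bochner_Integration.integral_cong[OF refl])
      fix v assume "v \<in> space unit_interval"
      then have v: "v \<in> {0..1}" by (simp add: space_unit_interval)
      have "fourier_char (- (k - 1)) v = fourier_char 1 v * fourier_char (- k) v"
        using fourier_char_add[of 1 "- k" v] by simp
      then show "G v * fourier_char (- k) v = G 0 * fourier_char (- k) v + h v * fourier_char (- (k - 1)) v - h v * fourier_char (- k) v"
        by (subst Gh[OF v]) (simp add: algebra_simps)
    qed
    also have "\<dots> = G 0 * (LINT v|unit_interval. fourier_char (- k) v) + fourier_coeff h (k - 1) - fourier_coeff h k"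
      unfolding fourier_coeff_def
      by (simp only: Bochner_Integration.integral_add Bochner_Integration.integral_diff Bochner_Integration.integrable_add
          integrable_mult_right integrable_fourier_char integrable_mult_fourier_char[OF inth] integral_mult_right_zero)
    finally show ?thesis by (simp add: integral_fourier_char)
  qed
  have partial: "(\<Sum>k\<in>{- int N..int N}. fourier_coeff G k) = G 0 + fourier_coeff h (- int N - 1) - fourier_coeff h (int N)" for N
  proof (induction N)
    case 0
    then show ?case by (simp add: coeff)
  next
    case (Suc N)
    have eq: "{- int (Suc N)..int (Suc N)} = insert (- int N - 1) (insert (int N + 1) {- int N..int N})" by auto
    have "(\<Sum>k\<in>{- int (Suc N)..int (Suc N)}. fourier_coeff G k)
        = fourier_coeff G (- int N - 1) + (fourier_coeff G (int N + 1) + (\<Sum>k\<in>{- int N..int N}. fourier_coeff G k))"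
      unfolding eq by simp
    moreover have "fourier_coeff G (- int N - 1) = fourier_coeff h (- int N - 1 - 1) - fourier_coeff h (- int N - 1)"
      using coeff[of "- int N - 1"] by simp
    moreover have "fourier_coeff G (int N + 1) = fourier_coeff h (int N) - fourier_coeff h (int N + 1)"
      using coeff[of "int N + 1"] by simp
    ultimately have "(\<Sum>k\<in>{- int (Suc N)..int (Suc N)}. fourier_coeff G k)
        = G 0 + fourier_coeff h (- int N - 1 - 1) - fourier_coeff h (int N + 1)"
      unfolding Suc by simp
    moreover have "- int N - 1 - 1 = - int (Suc N) - 1" "int N + 1 = int (Suc N)" by auto
    ultimately show ?case by (simp only:)
  qed
  have "(\<lambda>N. fourier_coeff h (- int N - 1)) \<longlonglongrightarrow> 0" "(\<lambda>N. fourier_coeff h (int N)) \<longlonglongrightarrow> 0"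
    by (rule fourier_coeff_tendsto_0[OF meas_h bd]; simp add: inj_def)+
  then have "(\<lambda>N. G 0 + fourier_coeff h (- int N - 1) - fourier_coeff h (int N)) \<longlonglongrightarrow> G 0 + 0 - 0"
    by (intro tendsto_intros)
  then show ?thesis unfolding partial by simp
qed

lemma summable_inverse_1_plus_square: "summable (\<lambda>n. 1 / (1 + real n ^ 2))"
proof (rule summable_comparison_test'[OF _])
  show "summable (\<lambda>n. 1 / real n ^ 2)" using inverse_power_summable[of 2] by (simp add: inverse_eq_divide)
  show "norm (1 / (1 + real n ^ 2)) \<le> 1 / real n ^ 2" if "n \<ge> 1" for n
    using that by (simp add: frac_le)
qed

lemma integrable_inverse_1_plus_square_lborel: "integrable lborel (\<lambda>x::real. 1 / (1 + x\<^sup>2))"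
  using integrable_inverse_1_plus_square by (simp add: set_integrable_def inverse_eq_divide)

lemma norm_diff_le_of_vector_derivative:
  fixes \<phi> :: "real \<Rightarrow> 'a::real_normed_vector"
  assumes "\<And>v. v \<in> S \<Longrightarrow> (\<phi> has_vector_derivative \<phi>' v) (at v)"
    and "\<And>v. v \<in> S \<Longrightarrow> norm (\<phi>' v) \<le> B" and "convex S" "x \<in> S" "y \<in> S"
  shows "norm (\<phi> x - \<phi> y) \<le> B * \<bar>x - y\<bar>"
proof -
  have "norm (\<phi> x - \<phi> y) \<le> B * norm (x - y)"
  proof (rule differentiable_bound[of S \<phi> "\<lambda>v h. h *\<^sub>R \<phi>' v"])
    show "(\<phi> has_derivative (\<lambda>h. h *\<^sub>R \<phi>' v)) (at v within S)" if "v \<in> S" for v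
      using assms(1)[OF that] unfolding has_vector_derivative_def by (rule has_derivative_at_withinI)
    show "onorm (\<lambda>h. h *\<^sub>R \<phi>' v) \<le> B" if "v \<in> S" for v
      using assms(2)[OF that] by (intro onorm_le) (simp add: mult.commute[of B] mult_left_mono)
  qed (use assms in auto)
  then show ?thesis by simp
qed

text \<open>The symmetric Fourier series of the periodisation G of \<phi> is evaluated at 0. The
  decay of \<phi>' makes G Lipschitz on [0, 1], which together with G 1 = G 0 is the regularity that
  \<open>fourier_series_at_0\<close> asks for.\<close>

lemma poisson_summation:
  fixes \<phi> :: "real \<Rightarrow> complex"
  assumes der: "\<And>v. (\<phi> has_vector_derivative \<phi>' v) (at v)"
    and bd: "\<And>v. norm (\<phi> v) \<le> C / (1 + v\<^sup>2)" and bd': "\<And>v. norm (\<phi>' v) \<le> C / (1 + v\<^sup>2)"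
  shows "(\<lambda>N. \<Sum>k\<in>{- int N..int N}. LINT v|lborel. \<phi> v * fourier_char (- k) v)
           \<longlonglongrightarrow> (\<Sum>n. \<phi> (real n) + \<phi> (- 1 - real n))"
proof -
  have "C / (1 + 0\<^sup>2) \<ge> 0" using bd[of 0] norm_ge_zero order_trans by blast
  then have C0: "C \<ge> 0" by simp
  have cont: "continuous_on UNIV \<phi>"
    using der by (meson continuous_at_imp_continuous_on has_vector_derivative_continuous)
  have meas [measurable]: "\<phi> \<in> borel_measurable borel" by (rule borel_measurable_continuous_onI[OF cont])
  define M where "M = (\<lambda>n::nat. 2 * (C * (1 / (1 + real n ^ 2))))"
  have sumM: "summable M" unfolding M_def by (intro summable_mult summable_inverse_1_plus_square)
  \<comment> \<open>Pairing the translates by n and by -1 - n indexes all integers by naturals; for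
    v in [0, 1] both arguments are at distance at least n from 0.\<close>
  define \<psi> where "\<psi> = (\<lambda>n v. \<phi> (v + real n) + \<phi> (v - 1 - real n))"
  define G where "G = (\<lambda>v. \<Sum>n. \<psi> n v)"
  have le: "C / (1 + x\<^sup>2) \<le> C * (1 / (1 + real n ^ 2))" if "real n \<le> \<bar>x\<bar>" for n x
  proof -
    have "real n ^ 2 \<le> x ^ 2" using that by (metis abs_le_square_iff abs_of_nat)
    moreover have "1 + real n ^ 2 > 0" by (intro add_pos_nonneg) auto
    ultimately have "C / (1 + x\<^sup>2) \<le> C / (1 + real n ^ 2)" using C0 by (intro frac_le) auto
    then show ?thesis by simp
  qed
  have shift: "real n \<le> \<bar>v + real n\<bar>" "real n \<le> \<bar>v - 1 - real n\<bar>" if "v \<in> {0..1}" for n v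
    using that by auto
  have bd_psi: "norm (\<psi> n v) \<le> M n" if v: "v \<in> {0..1}" for n v
  proof -
    have "norm (\<psi> n v) \<le> norm (\<phi> (v + real n)) + norm (\<phi> (v - 1 - real n))"
      unfolding \<psi>_def by (rule norm_triangle_ineq)
    also have "\<dots> \<le> C * (1 / (1 + real n ^ 2)) + C * (1 / (1 + real n ^ 2))"
      by (intro add_mono order_trans[OF bd le] shift v)
    finally show ?thesis by (simp add: M_def)
  qed
  have lip_psi: "norm (\<psi> n x - \<psi> n y) \<le> M n * \<bar>x - y\<bar>" if xy: "x \<in> {0..1}" "y \<in> {0..1}" for n x y
  proof -
    have "norm (\<phi> (x + real n) - \<phi> (y + real n)) \<le> C * (1 / (1 + real n ^ 2)) * \<bar>(x + real n) - (y + real n)\<bar>"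
    proof (rule norm_diff_le_of_vector_derivative[where S = "{real n..real n + 1}"])
      show "norm (\<phi>' v) \<le> C * (1 / (1 + real n ^ 2))" if "v \<in> {real n..real n + 1}" for v
        by (rule order_trans[OF bd' le]) (use that in auto)
    qed (use xy der in auto)
    moreover have "norm (\<phi> (x - 1 - real n) - \<phi> (y - 1 - real n)) \<le> C * (1 / (1 + real n ^ 2)) * \<bar>(x - 1 - real n) - (y - 1 - real n)\<bar>"
    proof (rule norm_diff_le_of_vector_derivative[where S = "{- 1 - real n..- real n}"])
      show "norm (\<phi>' v) \<le> C * (1 / (1 + real n ^ 2))" if "v \<in> {- 1 - real n..- real n}" for v
        by (rule order_trans[OF bd' le]) (use that in auto)
    qed (use xy der in auto)
    moreover have "norm (\<psi> n x - \<psi> n y) \<le> norm (\<phi> (x + real n) - \<phi> (y + real n)) + norm (\<phi> (x - 1 - real n) - \<phi> (y - 1 - real n))"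
    proof -
      have "\<psi> n x - \<psi> n y = (\<phi> (x + real n) - \<phi> (y + real n)) + (\<phi> (x - 1 - real n) - \<phi> (y - 1 - real n))"
        by (simp add: \<psi>_def)
      then show ?thesis by (simp only: norm_triangle_ineq)
    qed
    moreover have "(x + real n) - (y + real n) = x - y" "(x - 1 - real n) - (y - 1 - real n) = x - y" by auto
    moreover have "M n * \<bar>x - y\<bar> = C * (1 / (1 + real n ^ 2)) * \<bar>x - y\<bar> + C * (1 / (1 + real n ^ 2)) * \<bar>x - y\<bar>"
      by (simp add: M_def)
    ultimately show ?thesis by (simp only:)
  qed
  have summ: "summable (\<lambda>n. \<psi> n v)" if "v \<in> {0..1}" for v
    by (rule summable_comparison_test'[OF sumM bd_psi[OF that]])
  have lip: "norm (G x - G y) \<le> suminf M * \<bar>x - y\<bar>" if xy: "x \<in> {0..1}" "y \<in> {0..1}" for x y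
  proof -
    have "G x - G y = (\<Sum>n. \<psi> n x - \<psi> n y)"
      unfolding G_def by (intro suminf_diff summ xy)
    also have "norm \<dots> \<le> (\<Sum>n. M n * \<bar>x - y\<bar>)"
      by (intro norm_suminf_le lip_psi xy summable_mult2 sumM)
    also have "\<dots> = suminf M * \<bar>x - y\<bar>" by (rule suminf_mult2[symmetric, OF sumM])
    finally show ?thesis .
  qed
  \<comment> \<open>Moving v from 0 to 1 shifts every translate by one, so the difference
    telescopes; its initial term and its limit are both 0.\<close>
  have periodic: "G 1 = G 0"
  proof -
    have lim0: "(\<lambda>n. C / (1 + real n ^ 2)) \<longlonglongrightarrow> 0"
      using summable_LIMSEQ_zero[OF summable_mult[OF summable_inverse_1_plus_square, of C]] by simp
    have "(\<lambda>n. \<phi> (real n)) \<longlonglongrightarrow> 0" "(\<lambda>n. \<phi> (- real n)) \<longlonglongrightarrow> 0"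
      by (rule Lim_null_comparison[OF always_eventually lim0], use bd[of "real _"] bd[of "- real _"] in auto)+
    then have "(\<lambda>n. (\<phi> (real n) - \<phi> (- real n)) - (\<phi> (real (Suc n)) - \<phi> (- real (Suc n)))) sums ((\<phi> (real 0) - \<phi> (- real 0)) - (0 - 0))"
      by (intro telescope_sums' tendsto_diff)
    moreover have "\<psi> n 0 - \<psi> n 1 = (\<phi> (real n) - \<phi> (- real n)) - (\<phi> (real (Suc n)) - \<phi> (- real (Suc n)))" for n
      by (simp add: \<psi>_def algebra_simps)
    ultimately have "(\<Sum>n. \<psi> n 0 - \<psi> n 1) = 0" by (simp add: sums_iff)
    then show ?thesis unfolding G_def using suminf_diff[OF summ[of 0] summ[of 1]] by simp
  qed
  have measG: "G \<in> borel_measurable borel" unfolding G_def \<psi>_def by measurable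
  have M0: "suminf M \<ge> 0" using C0 by (intro suminf_nonneg sumM) (simp add: M_def)
  have series: "(\<lambda>N. \<Sum>k\<in>{- int N..int N}. fourier_coeff G k) \<longlonglongrightarrow> G 0"
  proof (rule fourier_series_at_0[OF measG M0])
    show "norm (G v - G 0) \<le> suminf M * v" if "v \<in> {0..1}" for v
      using lip[OF that, of 0] that by simp
    show "norm (G v - G 0) \<le> suminf M * (1 - v)" if "v \<in> {0..1}" for v
      using lip[OF that, of 1] that by (simp add: periodic)
  qed
  have coeff: "fourier_coeff G k = (LINT v|lborel. \<phi> v * fourier_char (- k) v)" for k
  proof -
    define F where "F = (\<lambda>v. \<phi> v * fourier_char (- k) v)"
    have measF [measurable]: "F \<in> borel_measurable borel" unfolding F_def by measurable
    have intF: "integrable lborel F"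
    proof (rule Bochner_Integration.integrable_bound)
      show "integrable lborel (\<lambda>v. C * (1 / (1 + v\<^sup>2)))"
        by (intro integrable_mult_right integrable_inverse_1_plus_square_lborel)
      show "AE v in lborel. norm (F v) \<le> norm (C * (1 / (1 + v\<^sup>2)))"
        using bd C0 by (intro AE_I2) (simp add: F_def norm_mult norm_fourier_char)
    qed measurable
    have lim1: "(\<lambda>N. LINT v|unit_interval. (\<Sum>n<N. \<psi> n v) * fourier_char (- k) v) \<longlonglongrightarrow> fourier_coeff G k"
      unfolding fourier_coeff_def
    proof (rule integral_dominated_convergence)
      show "integrable unit_interval (\<lambda>_. suminf M)" by simp
      show "AE v in unit_interval. (\<lambda>N. (\<Sum>n<N. \<psi> n v) * fourier_char (- k) v) \<longlonglongrightarrow> G v * fourier_char (- k) v"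
        unfolding G_def by (intro AE_I2 tendsto_mult_right summable_LIMSEQ summ) (auto simp: space_unit_interval)
      show "AE v in unit_interval. norm ((\<Sum>n<N. \<psi> n v) * fourier_char (- k) v) \<le> suminf M" for N
      proof (rule AE_I2)
        fix v assume "v \<in> space unit_interval"
        then have v: "v \<in> {0..1}" by (simp add: space_unit_interval)
        have "norm ((\<Sum>n<N. \<psi> n v) * fourier_char (- k) v) \<le> (\<Sum>n<N. M n)"
          by (simp add: norm_mult norm_fourier_char sum_norm_le bd_psi[OF v])
        also have "\<dots> \<le> suminf M" using C0 by (intro sum_le_suminf sumM) (auto simp: M_def)
        finally show "norm ((\<Sum>n<N. \<psi> n v) * fourier_char (- k) v) \<le> suminf M" .
      qed
      show "(\<lambda>v. G v * fourier_char (- k) v) \<in> borel_measurable unit_interval"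
        by (rule unit_interval_measurableI) (use measG in measurable)
      show "(\<lambda>v. (\<Sum>n<N. \<psi> n v) * fourier_char (- k) v) \<in> borel_measurable unit_interval" for N
        by (rule unit_interval_measurableI) (unfold \<psi>_def, measurable)
    qed
    \<comment> \<open>Unfolding: integrating a translate over the unit interval is integrating over
      the translated interval, and the first N pairs of translates cover [-N, N).\<close>
    have piece: "(LINT v|unit_interval. F (v + c)) = (LINT v|lborel. indicator {c..<c + 1} v *\<^sub>R F v)" for c
    proof -
      have "(LINT v|unit_interval. F (v + c)) = (LINT v|lborel. indicator {0..<1} v *\<^sub>R F (v + c))"
        unfolding unit_interval_def by (rule integral_restrict_space) simp
      also have "\<dots> = (LINT v|lborel. indicator {c..<c + 1} (c + 1 * v) *\<^sub>R F (c + 1 * v))"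
        by (intro Bochner_Integration.integral_cong) (auto simp: indicator_def add.commute)
      also have "\<dots> = (LINT v|lborel. indicator {c..<c + 1} v *\<^sub>R F v)"
        using lborel_integral_real_affine[of 1 "\<lambda>v. indicator {c..<c + 1} v *\<^sub>R F v" c] by simp
      finally show ?thesis .
    qed
    have int_ind: "integrable lborel (\<lambda>v. indicator {a..<b} v *\<^sub>R F v)" for a b
      by (rule integrable_mult_indicator) (use intF in auto)
    have partial: "(LINT v|unit_interval. (\<Sum>n<N. \<psi> n v) * fourier_char (- k) v) = (LINT v|lborel. indicator {- real N..<real N} v *\<^sub>R F v)" for N
    proof -
      have intU: "integrable unit_interval (\<lambda>v. F (v + c))" for c
      proof (rule integrable_unit_interval_bounded)
        show "(\<lambda>v. F (v + c)) \<in> borel_measurable unit_interval" by (rule unit_interval_measurableI) measurable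
        show "norm (F (v + c)) \<le> C" for v
        proof -
          have "C / (1 + (v + c)\<^sup>2) \<le> C / 1" using C0 by (intro frac_le) auto
          then have "norm (\<phi> (v + c)) \<le> C" using bd[of "v + c"] by simp
          then show ?thesis by (simp add: F_def norm_mult norm_fourier_char)
        qed
      qed
      have "(\<Sum>n<N. \<psi> n v) * fourier_char (- k) v = (\<Sum>n<N. F (v + real n) + F (v + (- 1 - real n)))" for v
        unfolding sum_distrib_right
      proof (intro sum.cong refl)
        fix n
        have "fourier_char (- k) (v + real n) = fourier_char (- k) v" "fourier_char (- k) (v + (- 1 - real n)) = fourier_char (- k) v"
          using fourier_char_periodic[of "- k" v "int n"] fourier_char_periodic[of "- k" v "- 1 - int n"] by auto
        then show "\<psi> n v * fourier_char (- k) v = F (v + real n) + F (v + (- 1 - real n))"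
          by (simp add: \<psi>_def F_def algebra_simps)
      qed
      then have "(LINT v|unit_interval. (\<Sum>n<N. \<psi> n v) * fourier_char (- k) v) =
          (\<Sum>n<N. (LINT v|lborel. indicator {real n..<real n + 1} v *\<^sub>R F v) + (LINT v|lborel. indicator {- 1 - real n..<- 1 - real n + 1} v *\<^sub>R F v))"
        using intU by (simp add: Bochner_Integration.integral_sum Bochner_Integration.integral_add piece)
      also have "\<dots> = (LINT v|lborel. indicator {- real N..<real N} v *\<^sub>R F v)"
      proof (induction N)
        case (Suc N)
        have "(LINT v|lborel. indicator {- real (Suc N)..<real (Suc N)} v *\<^sub>R F v) =
            (LINT v|lborel. indicator {- real N..<real N} v *\<^sub>R F v +
               (indicator {real N..<real N + 1} v *\<^sub>R F v + indicator {- 1 - real N..<- 1 - real N + 1} v *\<^sub>R F v))"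
          by (intro Bochner_Integration.integral_cong) (auto simp: indicator_def)
        then show ?case using Suc int_ind by (simp add: Bochner_Integration.integral_add)
      qed simp
      finally show ?thesis .
    qed
    have lim2: "(\<lambda>N. LINT v|lborel. indicator {- real N..<real N} v *\<^sub>R F v) \<longlonglongrightarrow> (LINT v|lborel. F v)"
    proof (rule integral_dominated_convergence)
      show "integrable lborel (\<lambda>v. norm (F v))" using intF by simp
      show "AE v in lborel. (\<lambda>N. indicator {- real N..<real N} v *\<^sub>R F v) \<longlonglongrightarrow> F v"
      proof (rule AE_I2)
        fix v :: real
        obtain N where N: "\<bar>v\<bar> < real N" using reals_Archimedean2 by blast
        have "eventually (\<lambda>n. indicator {- real n..<real n} v *\<^sub>R F v = F v) sequentially"
          using eventually_ge_at_top[of N] by eventually_elim (use N in \<open>auto simp: indicator_def\<close>)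
        then show "(\<lambda>N. indicator {- real N..<real N} v *\<^sub>R F v) \<longlonglongrightarrow> F v"
          by (rule tendsto_eventually)
      qed
      show "AE v in lborel. norm (indicator {- real N..<real N} v *\<^sub>R F v) \<le> norm (F v)" for N
        by (intro AE_I2) (auto simp: indicator_def)
    qed measurable
    from LIMSEQ_unique[OF lim1[unfolded partial] lim2] show ?thesis by (simp add: F_def)
  qed
  have "G 0 = (\<Sum>n. \<phi> (real n) + \<phi> (- 1 - real n))" by (simp add: G_def \<psi>_def)
  with series show ?thesis by (simp add: coeff)
qed

section \<open>Gaussians, their Fourier transforms and their Poisson formula\<close>

lemma fourier_integral_gauss:
  assumes t: "t > 0"
  shows "(LINT v|lborel. complex_of_real (exp (- pi * t * v\<^sup>2)) * fourier_char (- k) v)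
           = of_real (exp (- pi * (of_int k)\<^sup>2 / t) / sqrt t)"
proof -
  \<comment> \<open>The scaling c turns the standard normal exponent -(c x)^2 / 2 into -pi t x^2, so
    the transform is the normal characteristic function evaluated at s.\<close>
  define c where "c = sqrt (2 * pi * t)"
  have c: "c > 0" "c\<^sup>2 = 2 * pi * t" using t by (auto simp: c_def)
  define s where "s = - 2 * pi * of_int k / c"
  have "of_real (exp (- (s\<^sup>2) / 2)) = char std_normal_distribution s"
    by (simp add: char_std_normal_distribution)
  also have "\<dots> = (LINT x|lborel. std_normal_density x *\<^sub>R iexp (s * x))"
    unfolding char_def by (subst integral_density) auto
  also have "\<dots> = \<bar>c\<bar> *\<^sub>R (LINT x|lborel. std_normal_density (0 + c * x) *\<^sub>R iexp (s * (0 + c * x)))"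
    using c by (intro lborel_integral_real_affine) auto
  also have "(\<lambda>x. std_normal_density (0 + c * x) *\<^sub>R iexp (s * (0 + c * x))) = (\<lambda>x. (1 / sqrt (2 * pi)) *\<^sub>R (complex_of_real (exp (- pi * t * x\<^sup>2)) * fourier_char (- k) x))"
  proof
    fix x
    have 1: "s * (0 + c * x) = 2 * pi * of_int (- k) * x" using c by (simp add: s_def)
    have 2: "- (0 + c * x)\<^sup>2 / 2 = - pi * t * x\<^sup>2" by (simp add: power_mult_distrib c)
    show "std_normal_density (0 + c * x) *\<^sub>R iexp (s * (0 + c * x)) = (1 / sqrt (2 * pi)) *\<^sub>R (complex_of_real (exp (- pi * t * x\<^sup>2)) * fourier_char (- k) x)"
      unfolding std_normal_density_def 1 2 fourier_char_def cis_conv_exp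
      by (simp add: scaleR_conv_of_real)
  qed
  also have "\<bar>c\<bar> *\<^sub>R (LINT x|lborel. (1 / sqrt (2 * pi)) *\<^sub>R (complex_of_real (exp (- pi * t * x\<^sup>2)) * fourier_char (- k) x))
      = (c / sqrt (2 * pi)) *\<^sub>R (LINT x|lborel. complex_of_real (exp (- pi * t * x\<^sup>2)) * fourier_char (- k) x)"
    using c by simp
  also have "c / sqrt (2 * pi) = sqrt t" by (simp add: c_def real_sqrt_mult)
  finally have "(LINT v|lborel. complex_of_real (exp (- pi * t * v\<^sup>2)) * fourier_char (- k) v) = of_real (exp (- (s\<^sup>2) / 2)) / of_real (sqrt t)"
    using t by (simp add: scaleR_conv_of_real)
  moreover have "s\<^sup>2 = 2 * pi * (of_int k)\<^sup>2 / t"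
    using t by (simp add: s_def power_divide power_mult_distrib c) (simp add: power2_eq_square field_simps)
  then have "- (s\<^sup>2) / 2 = - pi * (of_int k)\<^sup>2 / t" by simp
  ultimately show ?thesis by simp
qed

lemma gauss_polynomial_bound:
  assumes t: "t > 0"
  obtains C :: real where "C > 0" "\<And>v. (1 + v\<^sup>2) * exp (- pi * t * v\<^sup>2) \<le> C / (1 + v\<^sup>2)"
proof -
  \<comment> \<open>With this d, d (1 + v^2) <= 1 + (pi t / 2) v^2 <= exp((pi t / 2) v^2); squaring
    gives the constant 1 / d^2.\<close>
  define d where "d = min 1 (pi * t / 2)"
  have d: "d > 0" using t by (simp add: d_def)
  have "(1 + v\<^sup>2) * exp (- pi * t * v\<^sup>2) \<le> (1 / d\<^sup>2) / (1 + v\<^sup>2)" for v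
  proof -
    have pos: "1 + v\<^sup>2 > 0" by (intro add_pos_nonneg) auto
    have "d * (1 + v\<^sup>2) \<le> 1 + pi * t / 2 * v\<^sup>2"
      unfolding distrib_left by (intro add_mono mult_right_mono) (auto simp: d_def)
    also have "\<dots> \<le> exp (pi * t / 2 * v\<^sup>2)" by (rule exp_ge_add_one_self)
    finally have "(d * (1 + v\<^sup>2))\<^sup>2 \<le> (exp (pi * t / 2 * v\<^sup>2))\<^sup>2"
      using d pos by (intro power_mono) auto
    also have "(exp (pi * t / 2 * v\<^sup>2))\<^sup>2 = exp (pi * t * v\<^sup>2)"
      by (simp add: exp_double[symmetric] power2_eq_square exp_add[symmetric])
    finally have "d\<^sup>2 * ((1 + v\<^sup>2) * (1 + v\<^sup>2)) \<le> exp (pi * t * v\<^sup>2)"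
      by (simp add: power2_eq_square mult_ac)
    then have "d\<^sup>2 * ((1 + v\<^sup>2) * (1 + v\<^sup>2)) * exp (- pi * t * v\<^sup>2) \<le> 1"
      by (simp add: exp_minus field_simps)
    then have "(1 + v\<^sup>2) * exp (- pi * t * v\<^sup>2) * (1 + v\<^sup>2) * d\<^sup>2 \<le> 1" by (simp only: mult_ac)
    then have "(1 + v\<^sup>2) * exp (- pi * t * v\<^sup>2) * (1 + v\<^sup>2) \<le> 1 / d\<^sup>2"
      using d by (subst pos_le_divide_eq) auto
    then show ?thesis using pos by (subst pos_le_divide_eq) auto
  qed
  then show thesis using that[of "1 / d\<^sup>2"] d by simp
qed

text \<open>The exponent \<kappa> will be the parity: 0 for even characters and 1 for odd
  ones.\<close>

definition gauss :: "nat \<Rightarrow> real \<Rightarrow> real \<Rightarrow> real" where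
  "gauss \<kappa> t v = v ^ \<kappa> * exp (- pi * t * v\<^sup>2)"

text \<open>For \<kappa> = 0 the truncated exponent \<kappa> - 1 is 0, which is harmless in view of
  the factor \<kappa>.\<close>

definition gauss_deriv :: "nat \<Rightarrow> real \<Rightarrow> real \<Rightarrow> real" where
  "gauss_deriv \<kappa> t v = (of_nat \<kappa> * v ^ (\<kappa> - 1) - 2 * pi * t * v ^ Suc \<kappa>) * exp (- pi * t * v\<^sup>2)"

lemma has_real_derivative_gauss: "(gauss \<kappa> t has_real_derivative gauss_deriv \<kappa> t v) (at v)"
  unfolding gauss_def[abs_def] gauss_deriv_def
  by (auto intro!: derivative_eq_intros simp: algebra_simps)

lemma gauss_bounds:
  assumes t: "t > 0" and \<kappa>: "\<kappa> \<le> 1"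
  obtains C :: real where "C > 0" "\<And>v. \<bar>gauss \<kappa> t v\<bar> \<le> C / (1 + v\<^sup>2)" "\<And>v. \<bar>gauss_deriv \<kappa> t v\<bar> \<le> C / (1 + v\<^sup>2)"
proof -
  obtain C where C: "C > 0" "\<And>v. (1 + v\<^sup>2) * exp (- pi * t * v\<^sup>2) \<le> C / (1 + v\<^sup>2)"
    using gauss_polynomial_bound[OF t] by blast
  have abs_le: "\<bar>v\<bar> \<le> 1 + v\<^sup>2" for v :: real
  proof -
    have "0 \<le> (\<bar>v\<bar> - 1 / 2)\<^sup>2" by simp
    then show ?thesis by (simp add: power2_eq_square algebra_simps abs_if split: if_splits)
  qed
  have \<kappa>': "\<kappa> = 0 \<or> \<kappa> = 1" using \<kappa> by auto
  have pow: "\<bar>v\<bar> ^ \<kappa> \<le> 1 + v\<^sup>2" "\<bar>v\<bar> ^ Suc \<kappa> \<le> 1 + v\<^sup>2" for v :: real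
    using \<kappa>' abs_le[of v] by (auto simp: power2_eq_square)
  have low: "\<bar>of_nat \<kappa> * v ^ (\<kappa> - 1)\<bar> \<le> 1 + v\<^sup>2" for v :: real
    using \<kappa>' by auto
  have K: "C \<le> C * (1 + 2 * pi * t)" using C t by (simp add: algebra_simps)
  show thesis
  proof (rule that)
    \<comment> \<open>The derivative is the Gaussian times a polynomial of size at most (1 + 2 pi t)
      (1 + v^2), whence this constant; it also dominates C.\<close>
    show "C * (1 + 2 * pi * t) > 0" using C t by (intro mult_pos_pos add_pos_pos) auto
    fix v :: real
    have pos: "1 + v\<^sup>2 > 0" by (intro add_pos_nonneg) auto
    have "\<bar>gauss \<kappa> t v\<bar> = \<bar>v\<bar> ^ \<kappa> * exp (- pi * t * v\<^sup>2)" by (simp add: gauss_def abs_mult power_abs)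
    also have "\<dots> \<le> (1 + v\<^sup>2) * exp (- pi * t * v\<^sup>2)" by (intro mult_right_mono pow) auto
    also have "\<dots> \<le> C / (1 + v\<^sup>2)" by (rule C)
    also have "\<dots> \<le> C * (1 + 2 * pi * t) / (1 + v\<^sup>2)" using K pos by (intro divide_right_mono) auto
    finally show "\<bar>gauss \<kappa> t v\<bar> \<le> C * (1 + 2 * pi * t) / (1 + v\<^sup>2)" .
    have "\<bar>of_nat \<kappa> * v ^ (\<kappa> - 1) - 2 * pi * t * v ^ Suc \<kappa>\<bar> \<le> \<bar>of_nat \<kappa> * v ^ (\<kappa> - 1)\<bar> + \<bar>2 * pi * t * v ^ Suc \<kappa>\<bar>"
      by (rule abs_triangle_ineq4)
    also have "\<bar>2 * pi * t * v ^ Suc \<kappa>\<bar> = 2 * pi * t * \<bar>v\<bar> ^ Suc \<kappa>" using t by (simp add: abs_mult power_abs)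
    also have "\<bar>of_nat \<kappa> * v ^ (\<kappa> - 1)\<bar> + 2 * pi * t * \<bar>v\<bar> ^ Suc \<kappa> \<le> (1 + v\<^sup>2) + 2 * pi * t * (1 + v\<^sup>2)"
      using t by (intro add_mono low mult_left_mono pow) auto
    finally have "\<bar>of_nat \<kappa> * v ^ (\<kappa> - 1) - 2 * pi * t * v ^ Suc \<kappa>\<bar> \<le> (1 + 2 * pi * t) * (1 + v\<^sup>2)"
      by (simp add: distrib_right)
    then have "\<bar>gauss_deriv \<kappa> t v\<bar> \<le> (1 + 2 * pi * t) * (1 + v\<^sup>2) * exp (- pi * t * v\<^sup>2)"
      unfolding gauss_deriv_def abs_mult abs_exp_cancel by (intro mult_right_mono) auto
    also have "\<dots> = (1 + 2 * pi * t) * ((1 + v\<^sup>2) * exp (- pi * t * v\<^sup>2))" by (simp only: mult.assoc)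
    also have "\<dots> \<le> (1 + 2 * pi * t) * (C / (1 + v\<^sup>2))" using t by (intro mult_left_mono C) auto
    finally show "\<bar>gauss_deriv \<kappa> t v\<bar> \<le> C * (1 + 2 * pi * t) / (1 + v\<^sup>2)" by (simp add: mult.commute)
  qed
qed

lemma continuous_on_gauss: "continuous_on A (gauss \<kappa> t)"
  unfolding gauss_def[abs_def] by (intro continuous_intros)

lemma integrable_gauss_fourier_char:
  assumes t: "t > 0" and \<kappa>: "\<kappa> \<le> 1"
  shows "integrable lborel (\<lambda>v. complex_of_real (gauss \<kappa> t v) * fourier_char k v)"
proof -
  obtain C where C: "C > 0" "\<And>v. \<bar>gauss \<kappa> t v\<bar> \<le> C / (1 + v\<^sup>2)" "\<And>v. \<bar>gauss_deriv \<kappa> t v\<bar> \<le> C / (1 + v\<^sup>2)"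
    by (rule gauss_bounds[OF t \<kappa>]; rule that; assumption)
  have [measurable]: "gauss \<kappa> t \<in> borel_measurable borel"
    by (rule borel_measurable_continuous_onI[OF continuous_on_gauss])
  show ?thesis
  proof (rule Bochner_Integration.integrable_bound)
    show "integrable lborel (\<lambda>v. C * (1 / (1 + v\<^sup>2)))"
      by (intro integrable_mult_right integrable_inverse_1_plus_square_lborel)
    show "AE v in lborel. norm (complex_of_real (gauss \<kappa> t v) * fourier_char k v) \<le> norm (C * (1 / (1 + v\<^sup>2)))"
      using C by (intro AE_I2) (simp add: norm_mult norm_fourier_char)
  qed measurable
qed

lemma gauss_tendsto_0:
  assumes "t > 0" "\<kappa> \<le> 1"
  shows "(gauss \<kappa> t \<longlongrightarrow> 0) at_top" "(gauss \<kappa> t \<longlongrightarrow> 0) at_bot"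
proof -
  obtain C where C: "C > 0" "\<And>v. \<bar>gauss \<kappa> t v\<bar> \<le> C / (1 + v\<^sup>2)" "\<And>v. \<bar>gauss_deriv \<kappa> t v\<bar> \<le> C / (1 + v\<^sup>2)"
    by (rule gauss_bounds[OF assms]; rule that; assumption)
  have "((\<lambda>v::real. C / (1 + v\<^sup>2)) \<longlongrightarrow> 0) at_top" "((\<lambda>v::real. C / (1 + v\<^sup>2)) \<longlongrightarrow> 0) at_bot"
    by real_asymp+
  moreover have "(gauss \<kappa> t \<longlongrightarrow> 0) F" if "((\<lambda>v. C / (1 + v\<^sup>2)) \<longlongrightarrow> 0) F" for F
    by (rule Lim_null_comparison[OF _ that]) (simp add: C(2))
  ultimately show "(gauss \<kappa> t \<longlongrightarrow> 0) at_top" "(gauss \<kappa> t \<longlongrightarrow> 0) at_bot" by blast+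
qed

text \<open>For \<kappa> = 1 the transform is reduced to \<kappa> = 0 by integrating the derivative
  of \<open>gauss 0 t v * fourier_char (- k) v\<close> over the line: the boundary terms vanish, and
  the two terms of the derivative give t I(1) + i k I(0) = 0.\<close>

lemma fourier_integral_gauss_kappa:
  assumes t: "t > 0" and \<kappa>: "\<kappa> \<le> 1"
  shows "(LINT v|lborel. complex_of_real (gauss \<kappa> t v) * fourier_char (- k) v)
           = (- \<i> * of_int k / of_real t) ^ \<kappa> * of_real (exp (- pi * (of_int k)\<^sup>2 / t) / sqrt t)"
proof (cases "\<kappa> = 0")
  case True
  then show ?thesis using fourier_integral_gauss[OF t] by (simp add: gauss_def)
next
  case False
  then have [simp]: "\<kappa> = 1" using \<kappa> by simp
  define I where "I = (\<lambda>\<kappa>. LINT v|lborel. complex_of_real (gauss \<kappa> t v) * fourier_char (- k) v)"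
  define F where "F = (\<lambda>v. complex_of_real (gauss 0 t v) * fourier_char (- k) v)"
  define F' where "F' = (\<lambda>v. - (2 * pi * t) * (complex_of_real (gauss 1 t v) * fourier_char (- k) v)
       + (2 * pi * of_int (- k) * \<i>) * (complex_of_real (gauss 0 t v) * fourier_char (- k) v))"
  have intF': "integrable lborel F'"
    unfolding F'_def by (intro Bochner_Integration.integrable_add integrable_mult_right integrable_gauss_fourier_char t) auto
  have "(F \<longlongrightarrow> 0) l" if "(gauss 0 t \<longlongrightarrow> 0) l" for l
  proof (rule Lim_null_comparison)
    show "((\<lambda>v. \<bar>gauss 0 t v\<bar>) \<longlongrightarrow> 0) l" using that by (rule tendsto_rabs_zero)
  qed (simp add: F_def norm_mult norm_fourier_char)
  then have lim: "(F \<longlongrightarrow> 0) at_top" "(F \<longlongrightarrow> 0) at_bot"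
    using gauss_tendsto_0[OF t, of 0] by auto
  have "(LBINT x=-\<infinity>..\<infinity>. F' x) = 0 - 0"
  proof (rule interval_integral_FTC_integrable)
    fix v :: real
    have g0: "((\<lambda>v. complex_of_real (gauss 0 t v)) has_vector_derivative complex_of_real (gauss_deriv 0 t v)) (at v)"
      by (intro has_vector_derivative_of_real has_real_derivative_gauss)
    have "(F has_vector_derivative complex_of_real (gauss 0 t v) * (2 * pi * of_int (- k) * \<i> * fourier_char (- k) v) +
              complex_of_real (gauss_deriv 0 t v) * fourier_char (- k) v) (at v)"
      unfolding F_def by (intro has_vector_derivative_mult g0 has_vector_derivative_fourier_char)
    also have "complex_of_real (gauss 0 t v) * (2 * pi * of_int (- k) * \<i> * fourier_char (- k) v) +
              complex_of_real (gauss_deriv 0 t v) * fourier_char (- k) v = F' v"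
      by (simp add: F'_def gauss_def gauss_deriv_def algebra_simps)
    finally show "(F has_vector_derivative F' v) (at v)" .
    have "continuous_on UNIV F'"
      unfolding F'_def fourier_char_def by (intro continuous_intros continuous_on_gauss)
    then show "isCont F' v" by (simp add: continuous_on_eq_continuous_at)
  next
    show "set_integrable lborel (einterval (- \<infinity>) \<infinity>) F'" using intF' by (simp add: set_integrable_def)
    show "((F \<circ> real_of_ereal) \<longlongrightarrow> 0) (at_right (- \<infinity>))" "((F \<circ> real_of_ereal) \<longlongrightarrow> 0) (at_left \<infinity>)"
      using lim by (simp_all add: ereal_tendsto_simps)
  qed simp
  then have "(LINT v|lborel. F' v) = 0"
    by (simp add: interval_lebesgue_integral_def set_lebesgue_integral_def)
  moreover have "(LINT v|lborel. F' v) = - (2 * pi * t) * I 1 + (2 * pi * of_int (- k) * \<i>) * I 0"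
    unfolding F'_def I_def
    using integrable_gauss_fourier_char[OF t, of 0 "- k"] integrable_gauss_fourier_char[OF t, of 1 "- k"]
    by (subst Bochner_Integration.integral_add) auto
  ultimately have "- (2 * pi * t) * I 1 + (2 * pi * of_int (- k) * \<i>) * I 0 = 0" by simp
  then have "(- 2 * complex_of_real pi) * (of_real t * I 1 + \<i> * of_int k * I 0) = 0"
    by (simp add: algebra_simps)
  then have "of_real t * I 1 + \<i> * of_int k * I 0 = 0" by (subst (asm) mult_eq_0_iff) auto
  then have "of_real t * I 1 = - \<i> * of_int k * I 0" by (simp add: eq_neg_iff_add_eq_0)
  moreover have "I 1 = of_real t * I 1 / of_real t" using t by simp
  ultimately have "I 1 = (- \<i> * of_int k / of_real t) * I 0" by (simp only: times_divide_eq_left)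
  moreover have "I 0 = of_real (exp (- pi * (of_int k)\<^sup>2 / t) / sqrt t)"
    using fourier_integral_gauss[OF t, of k] by (simp add: I_def gauss_def)
  ultimately show ?thesis by (simp add: I_def)
qed

text \<open>Poisson summation for the Gaussian shifted by u; on the dual side the shift becomes the
  character at u. Shifts by u = a / q will pick out residue classes modulo q.\<close>

lemma gauss_poisson:
  assumes t: "t > 0" and \<kappa>: "\<kappa> \<le> 1"
  shows "(\<lambda>N. \<Sum>k\<in>{- int N..int N}. (- \<i> * of_int k / of_real t) ^ \<kappa> * of_real (exp (- pi * (of_int k)\<^sup>2 / t) / sqrt t) * fourier_char k u)
      \<longlonglongrightarrow> (\<Sum>n. complex_of_real (gauss \<kappa> t (real n + u)) + complex_of_real (gauss \<kappa> t (u - 1 - real n)))"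
proof -
  obtain C where C: "C > 0" "\<And>v. \<bar>gauss \<kappa> t v\<bar> \<le> C / (1 + v\<^sup>2)" "\<And>v. \<bar>gauss_deriv \<kappa> t v\<bar> \<le> C / (1 + v\<^sup>2)"
    by (rule gauss_bounds[OF t \<kappa>]; rule that; assumption)
  \<comment> \<open>The constant comes from 1 + v^2 <= (2 + 2 u^2) (1 + (v + u)^2), which transfers
    the decay from v + u to v.\<close>
  define D where "D = C * (2 + 2 * u\<^sup>2)"
  have CD: "C / (1 + (v + u)\<^sup>2) \<le> D / (1 + v\<^sup>2)" for v
  proof -
    have pos: "1 + v\<^sup>2 > 0" "1 + (v + u)\<^sup>2 > 0" by (intro add_pos_nonneg; auto)+
    have "0 \<le> (v + 2 * u)\<^sup>2" by simp
    then have "v\<^sup>2 \<le> 2 * (v + u)\<^sup>2 + 2 * u\<^sup>2" by (simp add: power2_eq_square algebra_simps)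
    moreover have "0 \<le> u\<^sup>2 * (v + u)\<^sup>2" by simp
    moreover have "(2 + 2 * u\<^sup>2) * (1 + (v + u)\<^sup>2) = 2 + 2 * u\<^sup>2 + 2 * (v + u)\<^sup>2 + 2 * (u\<^sup>2 * (v + u)\<^sup>2)"
      by (simp add: distrib_left distrib_right)
    ultimately have "1 + v\<^sup>2 \<le> (2 + 2 * u\<^sup>2) * (1 + (v + u)\<^sup>2)"
      by linarith
    then have "C * (1 + v\<^sup>2) \<le> C * ((2 + 2 * u\<^sup>2) * (1 + (v + u)\<^sup>2))" using C(1) by (intro mult_left_mono) auto
    then show ?thesis using pos by (simp add: D_def divide_simps mult_ac)
  qed
  have "(\<lambda>N. \<Sum>k\<in>{- int N..int N}. LINT v|lborel. complex_of_real (gauss \<kappa> t (v + u)) * fourier_char (- k) v)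
           \<longlonglongrightarrow> (\<Sum>n. complex_of_real (gauss \<kappa> t (real n + u)) + complex_of_real (gauss \<kappa> t (- 1 - real n + u)))"
  proof (rule poisson_summation)
    fix v
    have "((\<lambda>v. gauss \<kappa> t (v + u)) has_real_derivative gauss_deriv \<kappa> t (v + u)) (at v)"
      using has_real_derivative_gauss[of \<kappa> t "v + u"] by (simp add: DERIV_shift)
    then show "((\<lambda>v. complex_of_real (gauss \<kappa> t (v + u))) has_vector_derivative complex_of_real (gauss_deriv \<kappa> t (v + u))) (at v)"
      by (rule has_vector_derivative_of_real)
    show "norm (complex_of_real (gauss \<kappa> t (v + u))) \<le> D / (1 + v\<^sup>2)"
      using order_trans[OF C(2) CD] by simp
    show "norm (complex_of_real (gauss_deriv \<kappa> t (v + u))) \<le> D / (1 + v\<^sup>2)"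
      using order_trans[OF C(3) CD] by simp
  qed
  moreover have "(LINT v|lborel. complex_of_real (gauss \<kappa> t (v + u)) * fourier_char (- k) v) =
       (- \<i> * of_int k / of_real t) ^ \<kappa> * of_real (exp (- pi * (of_int k)\<^sup>2 / t) / sqrt t) * fourier_char k u" for k
  proof -
    have "(LINT v|lborel. complex_of_real (gauss \<kappa> t v) * fourier_char (- k) v * fourier_char k u) =
          (LINT v|lborel. complex_of_real (gauss \<kappa> t (u + 1 * v)) * fourier_char (- k) (u + 1 * v) * fourier_char k u)"
      using lborel_integral_real_affine[of 1 "\<lambda>v. complex_of_real (gauss \<kappa> t v) * fourier_char (- k) v * fourier_char k u" u] by simp
    also have "\<dots> = (LINT v|lborel. complex_of_real (gauss \<kappa> t (v + u)) * fourier_char (- k) v)"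
    proof (rule Bochner_Integration.integral_cong[OF refl])
      fix v
      have "fourier_char (- k) (u + 1 * v) * fourier_char k u = fourier_char (- k) v"
        by (simp add: fourier_char_def cis_mult algebra_simps)
      then show "complex_of_real (gauss \<kappa> t (u + 1 * v)) * fourier_char (- k) (u + 1 * v) * fourier_char k u = complex_of_real (gauss \<kappa> t (v + u)) * fourier_char (- k) v"
        by (simp add: add.commute mult.assoc)
    qed
    finally show ?thesis
      using fourier_integral_gauss_kappa[OF t \<kappa>, of k] by simp
  qed
  moreover have "- 1 - real n + u = u - 1 - real n" for n by simp
  ultimately show ?thesis by (simp only:)
qed

section \<open>Gauss sums and the theta function\<close>

lemma periodic_mult:
  fixes F :: "int \<Rightarrow> 'a"
  assumes "\<And>n. F (n + p) = F n"
  shows "F (n + k * p) = F n"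
proof (induction k rule: int_induct[where k = 0])
  case (step1 i)
  have "n + (i + 1) * p = (n + i * p) + p" by (simp add: algebra_simps)
  then have "F (n + (i + 1) * p) = F (n + i * p)" using assms[of "n + i * p"] by (simp only:)
  then show ?case using step1 by simp
next
  case (step2 i)
  have "n + i * p = (n + (i - 1) * p) + p" by (simp add: algebra_simps)
  then have "F (n + i * p) = F (n + (i - 1) * p)" using assms[of "n + (i - 1) * p"] by (simp only:)
  then show ?case using step2 by simp
qed simp

lemma periodic_mod:
  fixes F :: "int \<Rightarrow> 'a"
  assumes "\<And>n. F (n + p) = F n"
  shows "F (n mod p) = F n"
  using periodic_mult[of F p "n mod p" "n div p", OF assms] by (simp add: mult.commute)

lemma periodic_cong:
  fixes F :: "int \<Rightarrow> 'a"
  assumes "\<And>n. F (n + p) = F n" "[m = n] (mod p)"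
  shows "F m = F n"
  using periodic_mod[of F p, OF assms(1)] assms(2) by (metis cong_def)

text \<open>Multiplication by a unit permutes the residues modulo p.\<close>

lemma sum_periodic_coprime_reindex:
  fixes F :: "int \<Rightarrow> 'a::comm_monoid_add"
  assumes per: "\<And>n. F (n + p) = F n" and p: "p > 0" and c: "coprime c p"
  shows "(\<Sum>a\<in>{0..<p}. F (c * a)) = (\<Sum>a\<in>{0..<p}. F a)"
proof -
  have inj: "inj_on (\<lambda>a. (c * a) mod p) {0..<p}"
  proof (rule inj_onI)
    fix a b assume ab: "a \<in> {0..<p}" "b \<in> {0..<p}" "(c * a) mod p = (c * b) mod p"
    then have "[a = b] (mod p)" using c by (metis cong_def cong_mult_lcancel coprime_commute)
    then show "a = b" using ab by (simp add: cong_def)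
  qed
  moreover have "(\<lambda>a. (c * a) mod p) ` {0..<p} = {0..<p}"
    by (rule endo_inj_surj[OF _ _ inj]) (use p in auto)
  ultimately have "bij_betw (\<lambda>a. (c * a) mod p) {0..<p} {0..<p}" by (simp add: bij_betw_def)
  then have "(\<Sum>a\<in>{0..<p}. F ((c * a) mod p)) = (\<Sum>a\<in>{0..<p}. F a)"
    by (rule sum.reindex_bij_betw)
  then show ?thesis by (simp add: periodic_mod[of F p, OF per])
qed

definition gauss_sum :: "nat \<Rightarrow> (int \<Rightarrow> complex) \<Rightarrow> int \<Rightarrow> complex" where
  "gauss_sum q chi k = (\<Sum>a\<in>{0..<int q}. chi a * fourier_char (k * a) (1 / real q))"

context
  fixes q :: nat and chi :: "int \<Rightarrow> complex"
  assumes character: "dirichlet_character q chi"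
begin

lemma character_modulus_pos: "q > 0"
  and character_mult: "chi (m * n) = chi m * chi n"
  and character_periodic: "chi (n + int q) = chi n"
  and character_nonzero_iff: "chi n \<noteq> 0 \<longleftrightarrow> coprime n (int q)"
  using character by (auto simp: dirichlet_character_def)

lemma character_cong: "[m = n] (mod int q) \<Longrightarrow> chi m = chi n"
  by (rule periodic_cong[of chi, OF character_periodic])

lemma character_1: "chi 1 = 1"
proof -
  have "chi 1 * chi 1 = chi 1 * 1" using character_mult[of 1 1] by simp
  moreover have "chi 1 \<noteq> 0" by (simp add: character_nonzero_iff)
  ultimately show ?thesis by (metis mult_cancel_left)
qed

lemma character_power: "chi (n ^ k) = chi n ^ k"
  by (induction k) (simp_all add: character_1 character_mult)

text \<open>By Euler's theorem the values of a character at units are roots of unity.\<close>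

lemma norm_character:
  assumes "coprime n (int q)"
  shows "norm (chi n) = 1"
proof -
  define c where "c = nat (n mod int q)"
  have c: "int c = n mod int q" using character_modulus_pos by (simp add: c_def)
  have "coprime (int c) (int q)" using assms character_modulus_pos unfolding c by simp
  then have "coprime c q" by simp
  then have "[c ^ totient q = 1] (mod q)" by (rule euler_theorem)
  then have "[int (c ^ totient q) = int 1] (mod int q)" by (simp only: cong_int_iff)
  then have "chi (int c ^ totient q) = 1" using character_cong[of "int c ^ totient q" 1] character_1 by simp
  moreover have "chi (int c) = chi n"
    unfolding c by (rule character_cong) (simp add: cong_def)
  ultimately have "chi n ^ totient q = 1" by (simp add: character_power)
  then show ?thesis using power_eq_1_iff[of "chi n" "totient q"] character_modulus_pos by auto
qed

lemma norm_character_le: "norm (chi n) \<le> 1"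
  using norm_character[of n] character_nonzero_iff[of n] by (cases "coprime n (int q)") auto

lemma fourier_char_modulus_periodic: "fourier_char (n + int q) (1 / real q) = fourier_char n (1 / real q)"
proof -
  have "fourier_char (int q) (1 / real q) = 1"
    using character_modulus_pos by (simp add: fourier_char_def)
  then show ?thesis by (simp add: fourier_char_add)
qed

lemma gauss_sum_coprime_shift:
  assumes "coprime c (int q)"
  shows "chi c * gauss_sum q chi (k * c) = gauss_sum q chi k"
proof -
  have "chi c * gauss_sum q chi (k * c) = (\<Sum>a\<in>{0..<int q}. chi (c * a) * fourier_char (k * (c * a)) (1 / real q))"
    by (simp add: gauss_sum_def sum_distrib_left character_mult mult_ac)
  also have "\<dots> = gauss_sum q chi k"
    unfolding gauss_sum_def
  proof (rule sum_periodic_coprime_reindex[where F = "\<lambda>a. chi a * fourier_char (k * a) (1 / real q)"])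
    fix n
    have "fourier_char (k * (n + int q)) (1 / real q) = fourier_char (k * n) (1 / real q)"
      using periodic_mult[of "\<lambda>n. fourier_char n (1 / real q)" "int q" "k * n" k, OF fourier_char_modulus_periodic]
      by (simp add: algebra_simps)
    then show "chi (n + int q) * fourier_char (k * (n + int q)) (1 / real q) = chi n * fourier_char (k * n) (1 / real q)"
      by (simp add: character_periodic)
  qed (use assms character_modulus_pos in auto)
  finally show ?thesis .
qed

lemma coprime_if_no_common_prime:
  fixes a b :: int
  assumes "b \<noteq> 0" and "\<And>p. prime p \<Longrightarrow> p dvd a \<Longrightarrow> p dvd b \<Longrightarrow> False"
  shows "coprime a b"
proof (rule ccontr)
  assume "\<not> coprime a b"
  then have "\<not> is_unit (gcd a b)" by (simp add: coprime_iff_gcd_eq_1)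
  moreover have "gcd a b \<noteq> 0" using assms(1) by simp
  ultimately obtain p where "p dvd gcd a b" "prime p" using prime_divisor_exists by blast
  with assms(2)[of p] show False by simp
qed

text \<open>Units modulo d lift to units modulo q. Adding d t to n, with t the product of the primes
  that divide q but neither n nor d, works because every prime factor of q divides exactly one of n
  and d t.\<close>

lemma coprime_lift:
  assumes d: "d dvd int q" and n: "coprime n d"
  obtains n' where "coprime n' (int q)" "[n' = n] (mod d)"
proof -
  define P where "P = {p \<in> prime_factors (int q). \<not> p dvd n \<and> \<not> p dvd d}"
  have finP: "finite P" by (simp add: P_def)
  define t where "t = \<Prod>P"
  have q0: "int q \<noteq> 0" using character_modulus_pos by simp
  have "coprime (n + d * t) (int q)"
  proof (rule coprime_if_no_common_prime)
    fix p :: int assume p: "prime p" "p dvd n + d * t" "p dvd int q"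
    have pf: "p \<in> prime_factors (int q)" using p q0 by (simp add: in_prime_factors_iff)
    have dvd_t: "p dvd t \<longleftrightarrow> p \<in> P"
    proof
      assume "p dvd t"
      then obtain r where r: "r \<in> P" "p dvd r"
        unfolding t_def using prime_dvd_prod_iff[OF finP p(1)] by auto
      then have "prime r" by (auto simp: P_def)
      then show "p \<in> P" using r p(1) primes_dvd_imp_eq by blast
    next
      assume "p \<in> P"
      then show "p dvd t" unfolding t_def using finP by (intro dvd_prodI[where f = "\<lambda>x. x", simplified])
    qed
    consider "p dvd n" | "\<not> p dvd n" "p dvd d" | "p \<in> P" using pf by (auto simp: P_def)
    then show False
    proof cases
      case 1
      then have "p dvd d * t" using p(2) by (simp add: dvd_add_right_iff)
      moreover have "\<not> p dvd d" using 1 p(1) coprime_common_divisor[OF n, of p] not_prime_unit by blast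
      ultimately have "p \<in> P" using p(1) dvd_t by (simp add: prime_dvd_mult_iff)
      with 1 show ?thesis by (simp add: P_def)
    next
      case 2
      then have "p dvd n" using p(2) by (simp add: dvd_add_left_iff)
      with 2 show ?thesis by simp
    next
      case 3
      then have "p dvd d * t" using dvd_t by simp
      then have "p dvd n" using p(2) by (simp add: dvd_add_left_iff)
      with 3 show ?thesis by (simp add: P_def)
    qed
  qed (use q0 in auto)
  moreover have "[n + d * t = n] (mod d)" by (simp add: cong_def)
  ultimately show thesis using that by blast
qed

text \<open>A character that is trivial on the units congruent to 1 modulo d depends, on units, only
  on the class modulo d. Composing with a choice of lifts gives the inducing character.\<close>

lemma trivial_on_kernel_imp_induced:
  assumes d: "d dvd q" and triv: "\<And>c. coprime c (int q) \<Longrightarrow> [c = 1] (mod int d) \<Longrightarrow> chi c = 1"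
  shows "induced_from q chi d"
proof -
  have dq: "int d dvd int q" using d by simp
  have d0: "d > 0" using d character_modulus_pos by (rule dvd_pos_nat[rotated])
  \<comment> \<open>With k inverse to m modulo q, n k is a unit congruent to 1 modulo d, so chi
    takes the value 1 at both n k and m k.\<close>
  have same: "chi m = chi n" if m: "coprime m (int q)" and n: "coprime n (int q)" and mn: "[m = n] (mod int d)" for m n
  proof -
    obtain k where k: "[m * k = 1] (mod int q)" using cong_solve_coprime_int[OF m] by blast
    have "coprime (m * k) (int q)" by (rule cong_imp_coprime[OF cong_sym[OF k]]) simp
    then have ck: "coprime k (int q)" by simp
    have "[n * k = m * k] (mod int d)" using cong_scalar_right[OF cong_sym[OF mn]] .
    also have "[m * k = 1] (mod int d)" using k dq by (rule cong_dvd_modulus)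
    finally have "[n * k = 1] (mod int d)" .
    then have "chi (n * k) = 1" using n ck by (intro triv) auto
    moreover have "chi (m * k) = 1" using character_cong[OF k] character_1 by simp
    moreover have "chi k \<noteq> 0" using ck character_nonzero_iff by blast
    ultimately have "chi m * chi k = chi n * chi k" by (simp add: character_mult)
    then show ?thesis using \<open>chi k \<noteq> 0\<close> by simp
  qed
  define lift where "lift = (\<lambda>n. SOME n'. coprime n' (int q) \<and> [n' = n] (mod int d))"
  have lift: "coprime (lift n) (int q)" "[lift n = n] (mod int d)" if n: "coprime n (int d)" for n
  proof -
    obtain n' where "coprime n' (int q)" "[n' = n] (mod int d)" by (rule coprime_lift[OF dq n])
    then have "coprime n' (int q) \<and> [n' = n] (mod int d)" by blast
    then have "coprime (lift n) (int q) \<and> [lift n = n] (mod int d)" unfolding lift_def by (rule someI)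
    then show "coprime (lift n) (int q)" "[lift n = n] (mod int d)" by auto
  qed
  define \<psi> where "\<psi> = (\<lambda>n. if coprime n (int d) then chi (lift n) else 0)"
  have "dirichlet_character d \<psi>"
    unfolding dirichlet_character_def
  proof (intro conjI allI)
    fix m n
    show "\<psi> (m * n) = \<psi> m * \<psi> n"
    proof (cases "coprime m (int d) \<and> coprime n (int d)")
      case True
      then have mn: "coprime m (int d)" "coprime n (int d)" "coprime (m * n) (int d)" by auto
      have "[lift (m * n) = lift m * lift n] (mod int d)"
        by (rule cong_trans[OF lift(2)[OF mn(3)] cong_sym[OF cong_mult[OF lift(2)[OF mn(1)] lift(2)[OF mn(2)]]]])
      then have "chi (lift (m * n)) = chi (lift m * lift n)"
        using lift(1) mn by (intro same) auto
      then show ?thesis using True by (simp add: \<psi>_def character_mult)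
    qed (auto simp: \<psi>_def)
    show "\<psi> (n + int d) = \<psi> n"
    proof (cases "coprime n (int d)")
      case True
      then have c: "coprime (n + int d) (int d)" by (simp add: coprime_iff_gcd_eq_1)
      have "[n + int d = n] (mod int d)" by (simp add: cong_def)
      then have "[lift (n + int d) = lift n] (mod int d)"
        by (rule cong_trans[OF cong_trans[OF lift(2)[OF c]] cong_sym[OF lift(2)[OF True]]])
      then show ?thesis using True c same[OF lift(1)[OF c] lift(1)[OF True]] by (simp add: \<psi>_def)
    next
      case False
      then have "\<not> coprime (n + int d) (int d)" by (simp add: coprime_iff_gcd_eq_1)
      with False show ?thesis by (simp add: \<psi>_def)
    qed
    show "(\<psi> n \<noteq> 0) = coprime n (int d)"
      using lift(1) character_nonzero_iff by (auto simp: \<psi>_def)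
  qed (use d0 in simp)
  moreover have "chi n = \<psi> n" if n: "coprime n (int q)" for n
  proof -
    have c: "coprime n (int d)" using n dq by (meson coprime_divisors dvd_refl)
    show ?thesis using same[OF n lift(1)[OF c]] lift(2)[OF c] c by (simp add: \<psi>_def cong_sym)
  qed
  ultimately show ?thesis unfolding induced_from_def by blast
qed

end

text \<open>For k prime to q this is reindexing. Otherwise both sides vanish: with g = gcd(k, q) and
  d = q / g, primitivity supplies a unit c congruent to 1 modulo d with chi c \<noteq> 1, and k c is
  congruent to k modulo q, so multiplying the Gauss sum at k by chi c does not change it.\<close>

lemma gauss_sum_primitive:
  assumes prim: "primitive_character q chi"
  shows "gauss_sum q chi k = cnj (chi k) * gauss_sum q chi 1"
proof -
  have character: "dirichlet_character q chi" using prim by (simp add: primitive_character_def)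
  note char = character_modulus_pos[OF character] character_nonzero_iff[OF character]
  show ?thesis
  proof (cases "coprime k (int q)")
    case True
    have "chi k * gauss_sum q chi k = gauss_sum q chi 1"
      using gauss_sum_coprime_shift[OF character True, of 1] by simp
    then have "cnj (chi k) * gauss_sum q chi 1 = (chi k * cnj (chi k)) * gauss_sum q chi k" by (simp add: mult_ac)
    also have "chi k * cnj (chi k) = 1"
      using norm_character[OF character True] by (simp flip: complex_norm_square)
    finally show ?thesis by simp
  next
    case False
    define g where "g = gcd k (int q)"
    have g: "g > 1" using False char(1) 
    proof -
      have "g > 0" using char(1) by (simp add: g_def)
      moreover have "g \<noteq> 1" using False by (simp add: g_def coprime_iff_gcd_eq_1)
      ultimately show ?thesis by simp
    qed
    define d where "d = nat (int q div g)"
    have "int q div g \<ge> 0" using g by (simp add: pos_imp_zdiv_nonneg_iff)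
    then have gq: "int q = g * int d" by (simp add: d_def g_def)
    have d0: "d > 0" using gq char(1) by (cases "d = 0") auto
    have "int d < int q" using gq g d0 by (simp add: mult_less_cancel_right1)
    then have "d < q" by simp
    moreover have "d dvd q" using gq by (metis dvd_triv_right int_dvd_int_iff)
    ultimately have "\<not> induced_from q chi d" using prim by (simp add: primitive_character_def)
    then obtain c where c: "coprime c (int q)" "[c = 1] (mod int d)" "chi c \<noteq> 1"
      using trivial_on_kernel_imp_induced[OF character \<open>d dvd q\<close>] by blast
    have "gauss_sum q chi (k * c) = gauss_sum q chi k"
    proof -
      obtain x where x: "c - 1 = int d * x" using c(2) by (auto simp: cong_iff_dvd_diff)
      obtain y where y: "k = g * y" unfolding g_def by (metis dvdE gcd_dvd1)
      have "k * c * a = k * a + (y * x * a) * int q" for a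
      proof -
        have "k * c * a = k * a + k * (c - 1) * a" by (simp add: algebra_simps)
        then show ?thesis unfolding x y gq by (simp add: mult_ac)
      qed
      then show ?thesis unfolding gauss_sum_def
        using periodic_mult[of "\<lambda>n. fourier_char n (1 / real q)" "int q", OF fourier_char_modulus_periodic[OF character]]
        by simp
    qed
    then have "chi c * gauss_sum q chi k = 1 * gauss_sum q chi k"
      using gauss_sum_coprime_shift[OF character c(1), of k] by simp
    then have "gauss_sum q chi k = 0" using c(3) by (metis mult_cancel_right)
    moreover have "chi k = 0" using False char(2) by blast
    ultimately show ?thesis by simp
  qed
qed

section \<open>Parity, conjugate characters and the theta series\<close>

lemma character_minus_1:
  assumes "dirichlet_character q chi"
  shows "chi (-1) = (-1) ^ char_parity chi"
proof -
  have "chi (-1) * chi (-1) = 1"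
    using character_mult[OF assms, of "-1" "-1"] character_1[OF assms] by simp
  then have "chi (-1) = 1 \<or> chi (-1) = -1" by (simp add: square_eq_1_iff)
  then show ?thesis by (auto simp: char_parity_def)
qed

lemma character_minus:
  assumes "dirichlet_character q chi"
  shows "chi (- n) = (-1) ^ char_parity chi * chi n"
  using character_mult[OF assms, of "-1" n] character_minus_1[OF assms] by simp

lemma char_parity_le_1: "char_parity chi \<le> 1"
  by (simp add: char_parity_def)

lemma character_0:
  assumes "dirichlet_character q chi" "q > 1"
  shows "chi 0 = 0"
  using character_nonzero_iff[OF assms(1), of 0] assms(2) by auto

lemma dirichlet_character_conj:
  assumes "dirichlet_character q chi"
  shows "dirichlet_character q (conj_character chi)"
  using assms by (auto simp: dirichlet_character_def conj_character_def)

lemma conj_character_conj [simp]: "conj_character (conj_character chi) = chi"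
  by (simp add: conj_character_def fun_eq_iff)

lemma char_parity_conj [simp]: "char_parity (conj_character chi) = char_parity chi"
proof -
  have "cnj (chi (-1)) = 1 \<longleftrightarrow> chi (-1) = 1" by (metis complex_cnj_cnj complex_cnj_one)
  then show ?thesis by (simp add: char_parity_def conj_character_def)
qed

lemma primitive_character_conj:
  assumes "primitive_character q chi"
  shows "primitive_character q (conj_character chi)"
  unfolding primitive_character_def
proof (intro conjI allI impI)
  show "dirichlet_character q (conj_character chi)"
    using assms dirichlet_character_conj by (simp add: primitive_character_def)
  fix d assume d: "d dvd q \<and> d < q"
  show "\<not> induced_from q (conj_character chi) d"
  proof
    assume "induced_from q (conj_character chi) d"
    then obtain \<psi> where \<psi>: "dirichlet_character d \<psi>" "\<And>n. coprime n (int q) \<Longrightarrow> conj_character chi n = \<psi> n"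
      by (auto simp: induced_from_def)
    then have "chi n = conj_character \<psi> n" if "coprime n (int q)" for n
      using that by (metis conj_character_def conj_character_conj)
    then have "induced_from q chi d"
      using dirichlet_character_conj[OF \<psi>(1)] by (auto simp: induced_from_def)
    then show False using assms d by (auto simp: primitive_character_def)
  qed
qed

text \<open>Half of the usual theta series over all integers: the terms at n and -n agree by parity,
  and for q > 1 the term n = 0 is 0.\<close>

definition char_theta :: "nat \<Rightarrow> (int \<Rightarrow> complex) \<Rightarrow> real \<Rightarrow> complex" where
  "char_theta q chi x = (\<Sum>n. chi (int n) * of_real (gauss (char_parity chi) (x / real q) (real n)))"

lemma summable_gauss:
  assumes "t > 0" "\<kappa> \<le> 1"
  shows "summable (\<lambda>n. \<bar>gauss \<kappa> t (real n)\<bar>)"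
proof -
  obtain C :: real where C: "C > 0" "\<And>v. \<bar>gauss \<kappa> t v\<bar> \<le> C / (1 + v\<^sup>2)" "\<And>v. \<bar>gauss_deriv \<kappa> t v\<bar> \<le> C / (1 + v\<^sup>2)"
    by (rule gauss_bounds[OF assms]; rule that; assumption)
  show ?thesis
  proof (rule summable_comparison_test')
    show "summable (\<lambda>n. C * (1 / (1 + real n ^ 2)))"
      by (intro summable_mult summable_inverse_1_plus_square)
    show "norm \<bar>gauss \<kappa> t (real n)\<bar> \<le> C * (1 / (1 + real n ^ 2))" for n
      using C(2)[of "real n"] by simp
  qed
qed

lemma summable_char_theta:
  assumes chi: "dirichlet_character q chi" and x: "x > 0"
  shows "summable (\<lambda>n. chi (int n) * of_real (gauss (char_parity chi) (x / real q) (real n)))"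
proof (rule summable_comparison_test')
  have "x / real q > 0" using x character_modulus_pos[OF chi] by simp
  then show "summable (\<lambda>n. \<bar>gauss (char_parity chi) (x / real q) (real n)\<bar>)"
    by (rule summable_gauss[OF _ char_parity_le_1])
  show "norm (chi (int n) * of_real (gauss (char_parity chi) (x / real q) (real n)))
      \<le> \<bar>gauss (char_parity chi) (x / real q) (real n)\<bar>" for n
    using mult_right_mono[OF norm_character_le[OF chi, of "int n"]] by (simp add: norm_mult)
qed

text \<open>Splitting the theta series into residue classes modulo q produces the two-sided sums to
  which Poisson summation applies. The arguments n + a/q = m/q with m = n q + a run through m >= 0,
  the arguments a/q - 1 - n = -m/q with m = n q + q - a through m >= 1, and by parity each family
  contributes the theta series once; hence the factor 2.\<close>

lemma char_theta_residue_sums: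
  assumes chi: "dirichlet_character q chi" and q: "q > 1" and x: "x > 0"
  defines "\<kappa> \<equiv> char_parity chi" and "t \<equiv> real q * x"
  shows "(\<lambda>n. \<Sum>a\<in>{0..<int q}. chi a * (complex_of_real (gauss \<kappa> t (real n + of_int a / real q)) +
               complex_of_real (gauss \<kappa> t (of_int a / real q - 1 - real n))))
         sums (2 / of_nat q ^ \<kappa> * char_theta q chi x)"
proof -
  define H where "H = (\<lambda>n. chi (int n) * complex_of_real (gauss \<kappa> (x / real q) (real n)))"
  have H: "H sums char_theta q chi x"
    unfolding H_def char_theta_def \<kappa>_def by (rule summable_sums[OF summable_char_theta[OF chi x]])
  have H0: "H 0 = 0" using character_0[OF chi q] by (simp add: H_def)
  have q0: "real q > 0" using q by simp
  have scale: "gauss \<kappa> t (v / real q) = gauss \<kappa> (x / real q) v / real q ^ \<kappa>" for v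
  proof -
    have "- pi * t * (v / real q)\<^sup>2 = - pi * (x / real q) * v\<^sup>2"
      using q0 by (simp add: t_def power2_eq_square)
    then show ?thesis by (simp add: gauss_def power_divide)
  qed
  have ints: "(\<Sum>a\<in>{0..<int q}. F a) = (\<Sum>a<q. F (int a))" for F :: "int \<Rightarrow> complex"
  proof -
    have "{0..<int q} = int ` {..<q}" by (auto simp: image_iff intro!: bexI[of _ "nat _"])
    then show ?thesis by (simp add: sum.reindex)
  qed
  have "(\<lambda>n. \<Sum>m\<in>{n * q..<n * q + q}. H m) sums char_theta q chi x"
    by (rule sums_group[OF H]) (use q in simp)
  moreover have "(\<Sum>m\<in>{n * q..<n * q + q}. H m) = of_nat q ^ \<kappa> * (\<Sum>a\<in>{0..<int q}. chi a * complex_of_real (gauss \<kappa> t (real n + of_int a / real q)))" for n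
  proof -
    have "(\<Sum>m\<in>{n * q..<n * q + q}. H m) = (\<Sum>a<q. H (n * q + a))"
      using sum.shift_bounds_nat_ivl[of H 0 "n * q" q] by (simp add: atLeast0LessThan add.commute)
    also have "\<dots> = (\<Sum>a<q. of_nat q ^ \<kappa> * (chi (int a) * complex_of_real (gauss \<kappa> t (real n + of_int (int a) / real q))))"
    proof (intro sum.cong refl)
      fix a
      have "chi (int (n * q + a)) = chi (int a)"
        by (rule character_cong[OF chi]) (simp add: cong_def)
      moreover have "real n + of_int (int a) / real q = real (n * q + a) / real q"
        using q0 by (simp add: field_simps)
      ultimately show "H (n * q + a) = of_nat q ^ \<kappa> * (chi (int a) * complex_of_real (gauss \<kappa> t (real n + of_int (int a) / real q)))"
        using q0 by (simp only: H_def scale) simp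
    qed
    finally show ?thesis by (simp add: ints sum_distrib_left)
  qed
  ultimately have s1: "(\<lambda>n. of_nat q ^ \<kappa> * (\<Sum>a\<in>{0..<int q}. chi a * complex_of_real (gauss \<kappa> t (real n + of_int a / real q)))) sums char_theta q chi x"
    by simp
  \<comment> \<open>The term at 0 vanishes, so the series may be shifted by one; the second family
    consists of the blocks n q + 1, ..., n q + q.\<close>
  have "(\<lambda>n. H (Suc n)) sums char_theta q chi x"
    using H H0 by (simp add: sums_Suc_iff)
  then have "(\<lambda>n. \<Sum>m\<in>{n * q..<n * q + q}. H (Suc m)) sums char_theta q chi x"
    by (rule sums_group) (use q in simp)
  moreover have "(\<Sum>m\<in>{n * q..<n * q + q}. H (Suc m)) = of_nat q ^ \<kappa> * (\<Sum>a\<in>{0..<int q}. chi a * complex_of_real (gauss \<kappa> t (of_int a / real q - 1 - real n)))" for n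
  proof -
    have "(\<Sum>m\<in>{n * q..<n * q + q}. H (Suc m)) = (\<Sum>a<q. H (Suc (n * q + a)))"
      using sum.shift_bounds_nat_ivl[of "\<lambda>m. H (Suc m)" 0 "n * q" q] by (simp add: atLeast0LessThan add.commute)
    \<comment> \<open>The block is read backwards, since larger a means smaller m = n q + q -
      a.\<close>
    also have "\<dots> = (\<Sum>a<q. H (Suc (n * q + (q - Suc a))))"
      by (rule sum.nat_diff_reindex[symmetric])
    also have "\<dots> = (\<Sum>a<q. of_nat q ^ \<kappa> * (chi (int a) * complex_of_real (gauss \<kappa> t (of_int (int a) / real q - 1 - real n))))"
    proof (intro sum.cong refl)
      fix a assume "a \<in> {..<q}"
      then have a: "a < q" by simp
      define m where "m = Suc (n * q + (q - Suc a))"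
      have m: "int m = int n * int q + int q - int a" using a by (simp add: m_def of_nat_diff)
      have "chi (int m) = chi (- int a)"
        unfolding m by (rule character_cong[OF chi]) (simp add: cong_iff_dvd_diff algebra_simps)
      also have "\<dots> = (-1) ^ \<kappa> * chi (int a)" unfolding \<kappa>_def by (rule character_minus[OF chi])
      finally have c: "chi (int m) = (-1) ^ \<kappa> * chi (int a)" .
      have rm: "real m = real n * real q + real q - real a"
        using arg_cong[OF m, of real_of_int] by simp
      have "of_int (int a) / real q - 1 - real n = - (real m) / real q"
        using q0 unfolding rm by (simp add: field_simps)
      then have "gauss \<kappa> t (of_int (int a) / real q - 1 - real n) = gauss \<kappa> (x / real q) (- real m) / real q ^ \<kappa>"
        by (simp only: scale)
      also have "gauss \<kappa> (x / real q) (- real m) = (-1) ^ \<kappa> * gauss \<kappa> (x / real q) (real m)"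
        using power_minus[of "real m" \<kappa>] by (simp add: gauss_def)
      finally have "of_nat q ^ \<kappa> * (chi (int a) * complex_of_real (gauss \<kappa> t (of_int (int a) / real q - 1 - real n)))
          = (-1) ^ \<kappa> * chi (int a) * complex_of_real (gauss \<kappa> (x / real q) (real m))"
        using q0 by simp
      then show "H (Suc (n * q + (q - Suc a))) = of_nat q ^ \<kappa> * (chi (int a) * complex_of_real (gauss \<kappa> t (of_int (int a) / real q - 1 - real n)))"
        unfolding m_def[symmetric] by (simp only: H_def c)
    qed
    finally show ?thesis by (simp add: ints sum_distrib_left)
  qed
  ultimately have s2: "(\<lambda>n. of_nat q ^ \<kappa> * (\<Sum>a\<in>{0..<int q}. chi a * complex_of_real (gauss \<kappa> t (of_int a / real q - 1 - real n)))) sums char_theta q chi x"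
    by simp
  have "(\<lambda>n. (1 / of_nat q ^ \<kappa>) * (of_nat q ^ \<kappa> * (\<Sum>a\<in>{0..<int q}. chi a * complex_of_real (gauss \<kappa> t (real n + of_int a / real q)))
       + of_nat q ^ \<kappa> * (\<Sum>a\<in>{0..<int q}. chi a * complex_of_real (gauss \<kappa> t (of_int a / real q - 1 - real n)))))
      sums ((1 / of_nat q ^ \<kappa>) * (char_theta q chi x + char_theta q chi x))"
    by (intro sums_mult sums_add s1 s2)
  moreover have "(1 / of_nat q ^ \<kappa>) * (of_nat q ^ \<kappa> * A + of_nat q ^ \<kappa> * B) = A + B" for A B :: complex
    using q by (simp add: distrib_left)
  ultimately show ?thesis
    using q by (simp add: sum.distrib[symmetric] distrib_left[symmetric])
qed

text \<open>The constant of the functional equation: the Gauss sum divided by i^\<kappa> sqrt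
  q.\<close>

definition root_number :: "nat \<Rightarrow> (int \<Rightarrow> complex) \<Rightarrow> complex" where
  "root_number q chi = gauss_sum q chi 1 * (- \<i>) ^ char_parity chi / of_real (sqrt (real q))"

text \<open>Poisson summation at u = a / q with t = q x, weighted by chi a and summed over a, yields
  on the dual side the Gauss sums of all frequencies k. Primitivity replaces them by the conjugate
  of chi k times a constant, which turns the dual side into the theta series of the conjugate
  character at 1 / x.\<close>

lemma char_theta_functional_equation:
  assumes prim: "primitive_character q chi" and q: "q > 1" and x: "x > 0"
  shows "char_theta q chi x = root_number q chi * of_real (1 / (x ^ char_parity chi * sqrt x)) * char_theta q (conj_character chi) (1 / x)"
proof -
  have chi: "dirichlet_character q chi" using prim by (simp add: primitive_character_def)
  define \<kappa> where "\<kappa> = char_parity chi"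
  define t where "t = real q * x"
  have t: "t > 0" using q x by (simp add: t_def)
  have \<kappa>: "\<kappa> \<le> 1" unfolding \<kappa>_def by (rule char_parity_le_1)
  define W where "W = (\<lambda>k::int. (- \<i> * of_int k / of_real t) ^ \<kappa> * complex_of_real (exp (- pi * (of_int k)\<^sup>2 / t) / sqrt t))"
  define S where "S = (\<lambda>a. \<Sum>n. complex_of_real (gauss \<kappa> t (real n + a)) + complex_of_real (gauss \<kappa> t (a - 1 - real n)))"
  define \<tau> where "\<tau> = gauss_sum q chi 1"
  have "(\<lambda>N. \<Sum>a\<in>{0..<int q}. chi a * (\<Sum>k\<in>{- int N..int N}. W k * fourier_char k (of_int a / real q)))
       \<longlonglongrightarrow> (\<Sum>a\<in>{0..<int q}. chi a * S (of_int a / real q))"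
    unfolding W_def S_def by (intro tendsto_intros gauss_poisson t \<kappa>)
  moreover have "(\<Sum>a\<in>{0..<int q}. chi a * (\<Sum>k\<in>{- int N..int N}. W k * fourier_char k (of_int a / real q)))
      = \<tau> * (2 * (\<Sum>n<Suc N. cnj (chi (int n)) * W (int n)))" for N
  proof -
    have "(\<Sum>a\<in>{0..<int q}. chi a * (\<Sum>k\<in>{- int N..int N}. W k * fourier_char k (of_int a / real q)))
       = (\<Sum>k\<in>{- int N..int N}. W k * gauss_sum q chi k)"
    proof -
      have "fourier_char k (of_int a / real q) = fourier_char (k * a) (1 / real q)" for k a
        by (simp add: fourier_char_def mult.assoc)
      then have "(\<Sum>a\<in>{0..<int q}. chi a * (\<Sum>k\<in>{- int N..int N}. W k * fourier_char k (of_int a / real q)))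
          = (\<Sum>a\<in>{0..<int q}. \<Sum>k\<in>{- int N..int N}. W k * (chi a * fourier_char (k * a) (1 / real q)))"
        by (simp add: sum_distrib_left mult_ac)
      also have "\<dots> = (\<Sum>k\<in>{- int N..int N}. \<Sum>a\<in>{0..<int q}. W k * (chi a * fourier_char (k * a) (1 / real q)))"
        by (rule sum.swap)
      finally show ?thesis by (simp add: gauss_sum_def sum_distrib_left)
    qed
    also have "\<dots> = \<tau> * (\<Sum>k\<in>{- int N..int N}. cnj (chi k) * W k)"
      unfolding sum_distrib_left \<tau>_def
      by (intro sum.cong refl) (subst gauss_sum_primitive[OF prim], simp)
    also have "(\<Sum>k\<in>{- int N..int N}. cnj (chi k) * W k) = 2 * (\<Sum>n<Suc N. cnj (chi (int n)) * W (int n))"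
    proof (induction N)
      case 0
      then show ?case by (simp add: character_0[OF chi q])
    next
      case (Suc N)
      have eq: "{- int (Suc N)..int (Suc N)} = insert (- int (Suc N)) (insert (int (Suc N)) {- int N..int N})" by auto
      \<comment> \<open>The conjugate of chi k and the factor k^\<kappa> in W both change by
        (-1)^\<kappa>, so k and -k contribute equally and the symmetric sum is twice a sum over
        naturals.\<close>
      have W: "cnj (chi (- k)) * W (- k) = cnj (chi k) * W k" for k
      proof -
        have "(- \<i> * of_int (- k) / of_real t) ^ \<kappa> = (-1) ^ \<kappa> * (- \<i> * of_int k / of_real t :: complex) ^ \<kappa>"
          unfolding power_mult_distrib[symmetric] by simp
        moreover have "cnj (chi (- k)) = (-1) ^ \<kappa> * cnj (chi k)"
          by (simp add: character_minus[OF chi] \<kappa>_def)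
        moreover have "(-1) ^ \<kappa> * (-1) ^ \<kappa> = (1 :: complex)" by (simp flip: power_mult_distrib)
        ultimately show ?thesis by (simp add: W_def)
      qed
      have "(\<Sum>k\<in>{- int (Suc N)..int (Suc N)}. cnj (chi k) * W k) =
          cnj (chi (- int (Suc N))) * W (- int (Suc N)) + (cnj (chi (int (Suc N))) * W (int (Suc N)) + (\<Sum>k\<in>{- int N..int N}. cnj (chi k) * W k))"
        unfolding eq by simp
      then show ?case unfolding W Suc by (simp only: sum.lessThan_Suc[of _ "Suc N"] distrib_left mult_2) simp
    qed
    finally show ?thesis .
  qed
  ultimately have lim1: "(\<lambda>N. \<tau> * (2 * (\<Sum>n<Suc N. cnj (chi (int n)) * W (int n)))) \<longlonglongrightarrow> (\<Sum>a\<in>{0..<int q}. chi a * S (of_int a / real q))"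
    by simp
  \<comment> \<open>D is the part of W that does not depend on n: exp(-pi n^2 / t) with t = q x is
    already the Gaussian of the theta series at 1 / x.\<close>
  define D where "D = (- \<i>) ^ \<kappa> * complex_of_real (1 / (t ^ \<kappa> * sqrt t))"
  have W: "cnj (chi (int n)) * W (int n) = D * (conj_character chi (int n) * of_real (gauss (char_parity (conj_character chi)) ((1 / x) / real q) (real n)))" for n
  proof -
    have "- pi * (of_int (int n))\<^sup>2 / t = - pi * ((1 / x) / real q) * (real n)\<^sup>2"
      using q x by (simp add: t_def)
    then have W': "W (int n) = (- \<i> * of_nat n / of_real t) ^ \<kappa> * complex_of_real (exp (- pi * ((1 / x) / real q) * (real n)\<^sup>2) / sqrt t)"
      by (simp only: W_def of_int_of_nat_eq)
    have pw: "(- \<i> * of_nat n / complex_of_real t) ^ \<kappa> = (- \<i>) ^ \<kappa> * of_nat n ^ \<kappa> / of_real t ^ \<kappa>"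
      by (simp only: power_mult_distrib power_divide)
    show ?thesis unfolding W' pw D_def gauss_def char_parity_conj \<kappa>_def[symmetric] conj_character_def
      by simp
  qed
  have "(\<lambda>n. cnj (chi (int n)) * W (int n)) sums (D * char_theta q (conj_character chi) (1 / x))"
    unfolding W char_theta_def
    by (intro sums_mult summable_sums summable_char_theta dirichlet_character_conj chi) (use x in simp)
  then have "(\<lambda>N. \<Sum>n<Suc N. cnj (chi (int n)) * W (int n)) \<longlonglongrightarrow> D * char_theta q (conj_character chi) (1 / x)"
    unfolding sums_def by (rule LIMSEQ_Suc)
  then have "(\<lambda>N. \<tau> * (2 * (\<Sum>n<Suc N. cnj (chi (int n)) * W (int n)))) \<longlonglongrightarrow> \<tau> * (2 * (D * char_theta q (conj_character chi) (1 / x)))"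
    by (intro tendsto_intros)
  from LIMSEQ_unique[OF lim1 this] have eq1: "(\<Sum>a\<in>{0..<int q}. chi a * S (of_int a / real q)) = \<tau> * (2 * (D * char_theta q (conj_character chi) (1 / x)))" .
  have "(\<Sum>a\<in>{0..<int q}. chi a * S (of_int a / real q)) = 2 / of_nat q ^ \<kappa> * char_theta q chi x"
  proof (rule sums_unique2)
    show "(\<lambda>n. \<Sum>a\<in>{0..<int q}. chi a * (complex_of_real (gauss \<kappa> t (real n + of_int a / real q)) +
               complex_of_real (gauss \<kappa> t (of_int a / real q - 1 - real n))))
         sums (2 / of_nat q ^ \<kappa> * char_theta q chi x)"
      unfolding \<kappa>_def t_def by (rule char_theta_residue_sums[OF chi q x])
    show "(\<lambda>n. \<Sum>a\<in>{0..<int q}. chi a * (complex_of_real (gauss \<kappa> t (real n + of_int a / real q)) +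
               complex_of_real (gauss \<kappa> t (of_int a / real q - 1 - real n)))) sums (\<Sum>a\<in>{0..<int q}. chi a * S (of_int a / real q))"
    proof (intro sums_sum sums_mult)
      fix a :: int
      obtain C :: real where C: "C > 0" "\<And>v. \<bar>gauss \<kappa> t v\<bar> \<le> C / (1 + v\<^sup>2)" "\<And>v. \<bar>gauss_deriv \<kappa> t v\<bar> \<le> C / (1 + v\<^sup>2)"
        by (rule gauss_bounds[OF t \<kappa>]; rule that; assumption)
      assume a: "a \<in> {0..<int q}"
      define u where "u = of_int a / real q"
      have u: "0 \<le> u" "u \<le> 1" using a q by (auto simp: u_def)
      have le: "\<bar>gauss \<kappa> t v\<bar> \<le> C * (1 / (1 + real n ^ 2))" if "real n \<le> \<bar>v\<bar>" for n v
      proof -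
        have "real n ^ 2 \<le> v ^ 2" using that by (metis abs_le_square_iff abs_of_nat)
        moreover have "1 + real n ^ 2 > 0" by (intro add_pos_nonneg) auto
        ultimately have "C / (1 + v\<^sup>2) \<le> C / (1 + real n ^ 2)" using C by (intro frac_le) auto
        then show ?thesis using C(2)[of v] by simp
      qed
      have "summable (\<lambda>n. complex_of_real (gauss \<kappa> t (real n + u)) + complex_of_real (gauss \<kappa> t (u - 1 - real n)))"
      proof (rule summable_comparison_test')
        show "summable (\<lambda>n. C * (1 / (1 + real n ^ 2)) + C * (1 / (1 + real n ^ 2)))"
          by (intro summable_add summable_mult summable_inverse_1_plus_square)
        fix n
        have "norm (complex_of_real (gauss \<kappa> t (real n + u)) + complex_of_real (gauss \<kappa> t (u - 1 - real n)))
           \<le> \<bar>gauss \<kappa> t (real n + u)\<bar> + \<bar>gauss \<kappa> t (u - 1 - real n)\<bar>"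
          by (metis norm_triangle_ineq norm_of_real)
        also have "\<dots> \<le> C * (1 / (1 + real n ^ 2)) + C * (1 / (1 + real n ^ 2))"
          using u by (intro add_mono le) auto
        finally show "norm (complex_of_real (gauss \<kappa> t (real n + u)) + complex_of_real (gauss \<kappa> t (u - 1 - real n))) \<le> C * (1 / (1 + real n ^ 2)) + C * (1 / (1 + real n ^ 2))" .
      qed
      then show "(\<lambda>n. complex_of_real (gauss \<kappa> t (real n + of_int a / real q)) + complex_of_real (gauss \<kappa> t (of_int a / real q - 1 - real n))) sums S (of_int a / real q)"
        unfolding S_def u_def by (rule summable_sums)
    qed
  qed
  with eq1 have "2 / of_nat q ^ \<kappa> * char_theta q chi x = \<tau> * (2 * (D * char_theta q (conj_character chi) (1 / x)))" by simp
  then have "of_nat q ^ \<kappa> * (2 / of_nat q ^ \<kappa> * char_theta q chi x) = of_nat q ^ \<kappa> * (\<tau> * (2 * (D * char_theta q (conj_character chi) (1 / x))))" by simp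
  then have "char_theta q chi x = of_nat q ^ \<kappa> * \<tau> * D * char_theta q (conj_character chi) (1 / x)"
    using q by simp
  moreover have "of_nat q ^ \<kappa> * \<tau> * D = root_number q chi * of_real (1 / (x ^ \<kappa> * sqrt x))"
    using q x by (simp add: D_def root_number_def \<tau>_def \<kappa>_def t_def power_mult_distrib real_sqrt_mult)
  ultimately show ?thesis by (simp add: \<kappa>_def)
qed

section \<open>Entire continuation of the completed L-function\<close>

definition fourier_laplace :: "(real \<Rightarrow> complex) \<Rightarrow> complex \<Rightarrow> complex" where
  "fourier_laplace \<phi> s = (LINT y|lborel. \<phi> y * exp (\<i> * s * of_real y))"

lemma integrable_exp_minus_square: "integrable lborel (\<lambda>y::real. exp (- (y\<^sup>2) / 2))"
proof -
  have "integrable lborel (\<lambda>v. complex_of_real (gauss 0 (1 / (2 * pi)) v) * fourier_char 0 v)"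
    by (rule integrable_gauss_fourier_char) auto
  then have "integrable lborel (\<lambda>v. norm (complex_of_real (gauss 0 (1 / (2 * pi)) v) * fourier_char 0 v))"
    by (rule integrable_norm)
  then show ?thesis by (simp add: gauss_def norm_mult norm_fourier_char)
qed

text \<open>From (|y| - r)^2 >= 0: half of the Gaussian decay is given up to absorb exp(r |y|), at
  the price of exp(r^2 / 2).\<close>

lemma gaussian_exponent_bound: "- (y\<^sup>2) + r * \<bar>y\<bar> \<le> - (y\<^sup>2) / 2 + r\<^sup>2 / 2" for y r :: real
proof -
  have "0 \<le> (\<bar>y\<bar> - r)\<^sup>2" by simp
  then show ?thesis by (simp add: power2_eq_square algebra_simps abs_mult_self_eq)
qed

context
  fixes \<phi> :: "real \<Rightarrow> complex" and C :: real
  assumes meas: "\<phi> \<in> borel_measurable borel" and bound: "\<And>y. norm (\<phi> y) \<le> C * exp (- (y\<^sup>2))"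
begin

lemma kernel_const_nonneg: "C \<ge> 0"
  using order_trans[OF norm_ge_zero bound[of 0]] by simp

lemma kernel_exp_bound: "norm (\<phi> y) * exp (r * \<bar>y\<bar>) \<le> C * exp (r\<^sup>2 / 2) * exp (- (y\<^sup>2) / 2)"
proof -
  have "norm (\<phi> y) * exp (r * \<bar>y\<bar>) \<le> (C * exp (- (y\<^sup>2))) * exp (r * \<bar>y\<bar>)"
    by (intro mult_right_mono bound) auto
  also have "\<dots> = C * exp (- (y\<^sup>2) + r * \<bar>y\<bar>)" by (simp only: exp_add mult.assoc)
  also have "\<dots> \<le> C * exp (- (y\<^sup>2) / 2 + r\<^sup>2 / 2)"
    using gaussian_exponent_bound[of y r] kernel_const_nonneg by (intro mult_left_mono) auto
  also have "\<dots> = C * exp (r\<^sup>2 / 2) * exp (- (y\<^sup>2) / 2)" by (simp only: exp_add mult_ac)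
  finally show ?thesis .
qed

lemma integrable_kernel_exp_abs: "integrable lborel (\<lambda>y. norm (\<phi> y) * exp (r * \<bar>y\<bar>))"
proof (rule Bochner_Integration.integrable_bound)
  show "integrable lborel (\<lambda>y. C * exp (r\<^sup>2 / 2) * exp (- (y\<^sup>2) / 2))"
    by (intro integrable_mult_right integrable_exp_minus_square)
  show "(\<lambda>y. norm (\<phi> y) * exp (r * \<bar>y\<bar>)) \<in> borel_measurable lborel" using meas by measurable
  show "AE y in lborel. norm (norm (\<phi> y) * exp (r * \<bar>y\<bar>)) \<le> norm (C * exp (r\<^sup>2 / 2) * exp (- (y\<^sup>2) / 2))"
  proof (rule AE_I2)
    fix y
    show "norm (norm (\<phi> y) * exp (r * \<bar>y\<bar>)) \<le> norm (C * exp (r\<^sup>2 / 2) * exp (- (y\<^sup>2) / 2))"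
      using kernel_exp_bound[of y r] kernel_const_nonneg by (simp add: abs_mult)
  qed
qed

lemma norm_exp_le: "norm (exp (\<i> * s * of_real y)) \<le> exp (norm s * \<bar>y\<bar>)"
proof -
  have "norm (exp (\<i> * s * of_real y)) = exp (Re (\<i> * s * of_real y))" by (rule norm_exp_eq_Re)
  also have "Re (\<i> * s * of_real y) \<le> norm (\<i> * s * of_real y)" by (rule complex_Re_le_cmod)
  finally show ?thesis by (simp add: norm_mult)
qed

lemma measurable_kernel_exp: "(\<lambda>y. \<phi> y * exp (\<i> * s * of_real y)) \<in> borel_measurable borel"
proof -
  have "(\<lambda>y. exp (\<i> * s * complex_of_real y)) \<in> borel_measurable borel"
    by (intro borel_measurable_continuous_onI continuous_intros)
  then show ?thesis using meas by measurable
qed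

lemma integrable_kernel_exp: "integrable lborel (\<lambda>y. \<phi> y * exp (\<i> * s * of_real y))"
proof (rule Bochner_Integration.integrable_bound)
  show "integrable lborel (\<lambda>y. norm (\<phi> y) * exp (norm s * \<bar>y\<bar>))" by (rule integrable_kernel_exp_abs)
  show "(\<lambda>y. \<phi> y * exp (\<i> * s * of_real y)) \<in> borel_measurable lborel" using measurable_kernel_exp by simp
  show "AE y in lborel. norm (\<phi> y * exp (\<i> * s * of_real y)) \<le> norm (norm (\<phi> y) * exp (norm s * \<bar>y\<bar>))"
    using norm_exp_le by (intro AE_I2) (simp add: norm_mult mult_left_mono)
qed

lemma norm_fourier_laplace_le:
  \<comment> \<open>The exponent |s|^2 / 2 becomes |s|^2 for a product of two transforms, the form
    of growth that \<open>logderiv_coeff_limit\<close> takes.\<close>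
  "norm (fourier_laplace \<phi> s) \<le> C * (LINT y|lborel. exp (- (y\<^sup>2) / 2)) * exp (norm s ^ 2 / 2)"
proof -
  have "norm (fourier_laplace \<phi> s) \<le> (LINT y|lborel. norm (\<phi> y * exp (\<i> * s * of_real y)))"
    unfolding fourier_laplace_def by (rule integral_norm_bound)
  also have "\<dots> \<le> (LINT y|lborel. C * exp (norm s ^ 2 / 2) * exp (- (y\<^sup>2) / 2))"
  proof (rule integral_mono)
    show "integrable lborel (\<lambda>y. norm (\<phi> y * exp (\<i> * s * of_real y)))"
      by (rule integrable_norm[OF integrable_kernel_exp])
    show "integrable lborel (\<lambda>y. C * exp (norm s ^ 2 / 2) * exp (- (y\<^sup>2) / 2))"
      by (intro integrable_mult_right integrable_exp_minus_square)
    fix y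
    have "norm (\<phi> y * exp (\<i> * s * of_real y)) \<le> norm (\<phi> y) * exp (norm s * \<bar>y\<bar>)"
      unfolding norm_mult by (intro mult_left_mono norm_exp_le) auto
    then show "norm (\<phi> y * exp (\<i> * s * of_real y)) \<le> C * exp (norm s ^ 2 / 2) * exp (- (y\<^sup>2) / 2)"
      using kernel_exp_bound[of y "norm s"] by linarith
  qed
  finally show ?thesis by (simp add: mult_ac)
qed

text \<open>Termwise integration of the exponential series, dominated by the integrable function
  |\<phi> y| exp(|s| |y|). An everywhere convergent power series gives holomorphy without
  differentiation under the integral.\<close>

lemma fourier_laplace_power_series:
  "(\<lambda>n. (LINT y|lborel. \<phi> y * (\<i> * of_real y) ^ n / fact n) * s ^ n) sums fourier_laplace \<phi> s"
proof -
  define T where "T = (\<lambda>n y. \<phi> y * ((\<i> * of_real y) ^ n / fact n) * s ^ n)"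
  have normT: "norm (T n y) = norm (\<phi> y) * ((norm s * \<bar>y\<bar>) ^ n / fact n)" for n y
    by (simp add: T_def norm_mult norm_power norm_divide power_mult_distrib)
  have expsum: "(\<lambda>n. (norm s * \<bar>y\<bar>) ^ n / fact n) sums exp (norm s * \<bar>y\<bar>)" for y
    using exp_converges[of "norm s * \<bar>y\<bar>"] by (simp add: scaleR_conv_of_real divide_inverse mult.commute)
  have le_exp: "(\<Sum>n<N. norm (T n y)) \<le> norm (\<phi> y) * exp (norm s * \<bar>y\<bar>)" for N y
  proof -
    have "(\<Sum>n<N. norm (T n y)) = norm (\<phi> y) * (\<Sum>n<N. (norm s * \<bar>y\<bar>) ^ n / fact n)"
      by (simp add: normT sum_distrib_left)
    also have "\<dots> \<le> norm (\<phi> y) * exp (norm s * \<bar>y\<bar>)"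
    proof (rule mult_left_mono)
      have "(\<Sum>n<N. (norm s * \<bar>y\<bar>) ^ n / fact n) \<le> (\<Sum>n. (norm s * \<bar>y\<bar>) ^ n / fact n)"
        by (rule sum_le_suminf[OF sums_summable[OF expsum]]) auto
      also have "\<dots> = exp (norm s * \<bar>y\<bar>)" by (rule sums_unique[OF expsum, symmetric])
      finally show "(\<Sum>n<N. (norm s * \<bar>y\<bar>) ^ n / fact n) \<le> exp (norm s * \<bar>y\<bar>)" .
    qed simp
    finally show ?thesis .
  qed
  have measT: "T n \<in> borel_measurable borel" for n
  proof -
    have "(\<lambda>y. (\<i> * complex_of_real y) ^ n / fact n) \<in> borel_measurable borel"
      by (intro borel_measurable_continuous_onI continuous_intros) auto
    then show ?thesis unfolding T_def using meas by measurable
  qed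
  have intT: "integrable lborel (T n)" for n
  proof (rule Bochner_Integration.integrable_bound[OF integrable_kernel_exp_abs[of "norm s"]])
    show "T n \<in> borel_measurable lborel" using measT by simp
    have "norm (T n y) \<le> (\<Sum>k<Suc n. norm (T k y))" for y by (simp add: sum_nonneg)
    then have "norm (T n y) \<le> norm (\<phi> y) * exp (norm s * \<bar>y\<bar>)" for y using le_exp[where N = "Suc n"] order_trans by blast
    then show "AE y in lborel. norm (T n y) \<le> norm (norm (\<phi> y) * exp (norm s * \<bar>y\<bar>))" by simp
  qed
  have sumT: "(\<lambda>n. T n y) sums (\<phi> y * exp (\<i> * s * of_real y))" for y
  proof -
    have "(\<lambda>n. (\<i> * s * of_real y) ^ n /\<^sub>R fact n) sums exp (\<i> * s * of_real y)" by (rule exp_converges)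
    then have "(\<lambda>n. \<phi> y * ((\<i> * s * of_real y) ^ n /\<^sub>R fact n)) sums (\<phi> y * exp (\<i> * s * of_real y))" by (rule sums_mult)
    moreover have "\<phi> y * ((\<i> * s * of_real y) ^ n /\<^sub>R fact n) = T n y" for n
      by (simp add: T_def scaleR_conv_of_real power_mult_distrib divide_inverse mult_ac)
    ultimately show ?thesis by simp
  qed
  have "(\<lambda>n. LINT y|lborel. T n y) sums (LINT y|lborel. (\<Sum>n. T n y))"
  proof (rule sums_integral[OF intT])
    have "summable (\<lambda>n. norm (T n y))" for y
      unfolding normT by (intro summable_mult sums_summable[OF expsum])
    then show "AE y in lborel. summable (\<lambda>n. norm (T n y))" by simp
    show "summable (\<lambda>n. LINT y|lborel. norm (T n y))"
    proof (rule summableI_nonneg_bounded)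
      fix N
      have "(\<Sum>n<N. LINT y|lborel. norm (T n y)) = (LINT y|lborel. (\<Sum>n<N. norm (T n y)))"
        by (rule Bochner_Integration.integral_sum[symmetric]) (use intT in auto)
      also have "\<dots> \<le> (LINT y|lborel. norm (\<phi> y) * exp (norm s * \<bar>y\<bar>))"
        by (rule integral_mono) (use intT integrable_kernel_exp_abs le_exp in auto)
      finally show "(\<Sum>n<N. LINT y|lborel. norm (T n y)) \<le> (LINT y|lborel. norm (\<phi> y) * exp (norm s * \<bar>y\<bar>))" .
    qed simp
  qed
  moreover have "(\<Sum>n. T n y) = \<phi> y * exp (\<i> * s * of_real y)" for y using sumT[of y] by (simp add: sums_iff)
  moreover have "(LINT y|lborel. T n y) = (LINT y|lborel. \<phi> y * (\<i> * of_real y) ^ n / fact n) * s ^ n" for n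
    unfolding T_def by simp
  ultimately show ?thesis by (simp add: fourier_laplace_def)
qed

lemma holomorphic_fourier_laplace: "fourier_laplace \<phi> holomorphic_on A"
proof -
  have "fourier_laplace \<phi> holomorphic_on ball 0 (norm z + 1)" for z :: complex
  proof (rule power_series_holomorphic)
    show "(\<lambda>n. (LINT y|lborel. \<phi> y * (\<i> * of_real y) ^ n / fact n) * (w - 0) ^ n) sums fourier_laplace \<phi> w" for w
      using fourier_laplace_power_series by simp
  qed
  then have "fourier_laplace \<phi> field_differentiable (at z)" for z
    by (rule holomorphic_on_imp_differentiable_at[where s = "ball 0 (norm z + 1)"]) auto
  then show ?thesis by (simp add: holomorphic_on_def field_differentiable_at_within)
qed

end

text \<open>The kernel of the Fourier integral for \<open>xi_line\<close>. With x = exp(2 y), the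
  exponent (\<kappa> + 1/2) y balances the factor x^(-\<kappa> - 1/2) of the theta functional
  equation, so that y -> -y changes the kernel only by a constant and conjugation of the
  character.\<close>

definition char_kernel :: "nat \<Rightarrow> (int \<Rightarrow> complex) \<Rightarrow> real \<Rightarrow> complex" where
  "char_kernel q chi y = 2 * char_theta q chi (exp (2 * y)) * of_real (exp ((real (char_parity chi) + 1 / 2) * y))"

lemma char_kernel_functional_equation:
  assumes "primitive_character q chi" "q > 1"
  shows "char_kernel q chi (- y) = root_number q chi * char_kernel q (conj_character chi) y"
proof -
  define \<kappa> where "\<kappa> = char_parity chi"
  have "1 / (exp (2 * (- y)) ^ \<kappa> * sqrt (exp (2 * (- y)))) = exp (2 * real \<kappa> * y + y)"
  proof -
    have "sqrt (exp (2 * (- y))) = exp (- y)"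
      by (rule real_sqrt_unique) (simp_all add: power2_eq_square flip: exp_add)
    then show ?thesis
      by (simp add: exp_of_nat_mult[symmetric] exp_add exp_minus field_simps)
  qed
  moreover have "exp (2 * real \<kappa> * y + y) * exp ((real \<kappa> + 1 / 2) * (- y)) = exp ((real \<kappa> + 1 / 2) * y)"
    by (simp add: algebra_simps flip: exp_add)
  moreover have "1 / exp (2 * (- y)) = exp (2 * y)" by (simp add: exp_minus field_simps)
  ultimately show ?thesis
    using char_theta_functional_equation[OF assms, of "exp (2 * (- y))"]
    by (simp add: char_kernel_def \<kappa>_def[symmetric] mult_ac flip: of_real_mult)
qed

text \<open>For n, x >= 1 one has n^2 x >= (n^2 + x) / 2, so the exponent splits into a part that
  keeps the series convergent, with t = 1 / (2 q), and a part that is exponential decay in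
  x.\<close>

lemma char_theta_decay:
  assumes chi: "dirichlet_character q chi" and q: "q > 1"
  obtains C where "C \<ge> 0" "\<And>x. x \<ge> 1 \<Longrightarrow> norm (char_theta q chi x) \<le> C * exp (- (pi / (2 * real q)) * x)"
proof -
  define \<kappa> where "\<kappa> = char_parity chi"
  define t where "t = 1 / (2 * real q)"
  have t: "t > 0" using q by (simp add: t_def)
  have summ: "summable (\<lambda>n. \<bar>gauss \<kappa> t (real n)\<bar>)"
    unfolding \<kappa>_def by (rule summable_gauss[OF t char_parity_le_1])
  show thesis
  proof (rule that)
    show "(\<Sum>n. \<bar>gauss \<kappa> t (real n)\<bar>) \<ge> 0" by (intro suminf_nonneg summ) auto
    fix x :: real assume x: "x \<ge> 1"
    have le: "norm (chi (int n) * of_real (gauss \<kappa> (x / real q) (real n))) \<le> \<bar>gauss \<kappa> t (real n)\<bar> * exp (- (pi / (2 * real q)) * x)" for n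
    proof (cases "n = 0")
      case True
      then show ?thesis using character_0[OF chi q] by simp
    next
      case False
      then have n: "real n ^ 2 \<ge> 1" by (simp add: one_le_power)
      have "real n ^ 2 + x \<le> 2 * (x * real n ^ 2)"
      proof -
        have "1 * real n ^ 2 \<le> x * real n ^ 2" using x by (intro mult_right_mono) auto
        moreover have "x * 1 \<le> x * real n ^ 2" using x n by (intro mult_left_mono) auto
        ultimately show ?thesis by linarith
      qed
      then have "(pi * t) * (real n ^ 2 + x) \<le> (pi * t) * (2 * (x * real n ^ 2))" using t by (intro mult_left_mono) auto
      moreover have "(pi * t) * (2 * (x * real n ^ 2)) = pi * (x / real q) * real n ^ 2" using q by (simp add: t_def)
      moreover have "(pi * t) * (real n ^ 2 + x) = pi * t * real n ^ 2 + pi / (2 * real q) * x"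
        by (simp add: t_def distrib_left)
      ultimately have "- pi * (x / real q) * real n ^ 2 \<le> - pi * t * real n ^ 2 + - (pi / (2 * real q)) * x"
        by linarith
      then have "exp (- pi * (x / real q) * real n ^ 2) \<le> exp (- pi * t * real n ^ 2) * exp (- (pi / (2 * real q)) * x)"
        unfolding exp_add[symmetric] by simp
      then have "real n ^ \<kappa> * exp (- pi * (x / real q) * real n ^ 2) \<le> real n ^ \<kappa> * (exp (- pi * t * real n ^ 2) * exp (- (pi / (2 * real q)) * x))"
        by (intro mult_left_mono) auto
      then have "\<bar>gauss \<kappa> (x / real q) (real n)\<bar> \<le> \<bar>gauss \<kappa> t (real n)\<bar> * exp (- (pi / (2 * real q)) * x)"
        by (simp add: gauss_def abs_mult mult.assoc)
      moreover have "norm (chi (int n) * of_real (gauss \<kappa> (x / real q) (real n))) \<le> 1 * \<bar>gauss \<kappa> (x / real q) (real n)\<bar>"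
        unfolding norm_mult norm_of_real by (intro mult_right_mono norm_character_le[OF chi]) auto
      ultimately show ?thesis by linarith
    qed
    have "norm (char_theta q chi x) \<le> (\<Sum>n. \<bar>gauss \<kappa> t (real n)\<bar> * exp (- (pi / (2 * real q)) * x))"
      unfolding char_theta_def \<kappa>_def[symmetric] by (intro norm_suminf_le le summable_mult2 summ)
    also have "\<dots> = (\<Sum>n. \<bar>gauss \<kappa> t (real n)\<bar>) * exp (- (pi / (2 * real q)) * x)"
      by (rule suminf_mult2[OF summ, symmetric])
    finally show "norm (char_theta q chi x) \<le> (\<Sum>n. \<bar>gauss \<kappa> t (real n)\<bar>) * exp (- (pi / (2 * real q)) * x)" .
  qed
qed

text \<open>The double exponential beats y^2 + a y at infinity, and compactness takes care of the
  rest.\<close>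

lemma double_exponential_bound:
  assumes "c > (0::real)"
  obtains K where "\<And>y. y \<ge> 0 \<Longrightarrow> a * y - c * exp (2 * y) \<le> K - y\<^sup>2"
proof -
  define g where "g = (\<lambda>y::real. y\<^sup>2 + a * y - c * exp (2 * y))"
  have "filterlim g at_bot at_top" unfolding g_def using assms by real_asymp
  then have "eventually (\<lambda>y. g y \<le> 0) at_top" by (simp add: filterlim_at_bot)
  then obtain Y where Y: "\<And>y. y \<ge> Y \<Longrightarrow> g y \<le> 0" by (auto simp: eventually_at_top_linorder)
  have "compact (g ` {0..Y})"
    unfolding g_def by (intro compact_continuous_image continuous_intros) auto
  then have "bounded (g ` {0..Y})" by (rule compact_imp_bounded)
  then obtain B where "\<forall>v\<in>g ` {0..Y}. norm v \<le> B" unfolding bounded_iff by blast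
  then have B: "\<bar>g y\<bar> \<le> B" if "y \<in> {0..Y}" for y using that by auto
  have "g y \<le> \<bar>B\<bar>" if "y \<ge> 0" for y
    using Y[of y] B[of y] that by (cases "y \<le> Y") auto
  then show thesis using that[of "\<bar>B\<bar>"] by (simp add: g_def algebra_simps)
qed

lemma char_kernel_measurable: "char_kernel q chi \<in> borel_measurable borel"
proof -
  have "(\<lambda>y. chi (int n) * complex_of_real (gauss (char_parity chi) (exp (2 * y) / real q) (real n))) \<in> borel_measurable borel" for n
    unfolding gauss_def by measurable
  then have "(\<lambda>y. char_theta q chi (exp (2 * y))) \<in> borel_measurable borel"
    unfolding char_theta_def by (rule borel_measurable_suminf)
  then show ?thesis unfolding char_kernel_def[abs_def] by measurable
qed

text \<open>For y >= 0 the theta series decays doubly exponentially in y. Termwise estimates give no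
  decay as y tends to -oo; negative y are reduced to positive ones for the conjugate character by
  the functional equation.\<close>

lemma char_kernel_bound:
  assumes prim: "primitive_character q chi" and q: "q > 1"
  obtains C where "\<And>y. norm (char_kernel q chi y) \<le> C * exp (- (y\<^sup>2))"
proof -
  have pos: "\<exists>C\<ge>0. \<forall>y\<ge>0. norm (char_kernel q \<psi> y) \<le> C * exp (- (y\<^sup>2))" if \<psi>: "primitive_character q \<psi>" for \<psi>
  proof -
    define a where "a = real (char_parity \<psi>) + 1 / 2"
    define c where "c = pi / (2 * real q)"
    have c: "c > 0" using q by (simp add: c_def)
    have dc: "dirichlet_character q \<psi>" using \<psi> by (simp add: primitive_character_def)
    obtain B where B: "B \<ge> 0" "\<And>x. x \<ge> 1 \<Longrightarrow> norm (char_theta q \<psi> x) \<le> B * exp (- c * x)"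
      unfolding c_def using char_theta_decay[OF dc q] by blast
    obtain K where K: "\<And>y. y \<ge> 0 \<Longrightarrow> a * y - c * exp (2 * y) \<le> K - y\<^sup>2"
      using double_exponential_bound[OF c, of a] by blast
    have "norm (char_kernel q \<psi> y) \<le> (2 * B * exp K) * exp (- (y\<^sup>2))" if y: "y \<ge> 0" for y
    proof -
      have "norm (char_kernel q \<psi> y) = 2 * norm (char_theta q \<psi> (exp (2 * y))) * exp (a * y)"
        by (simp add: char_kernel_def a_def norm_mult)
      also have "\<dots> \<le> 2 * (B * exp (- c * exp (2 * y))) * exp (a * y)"
        using y by (intro mult_right_mono mult_left_mono B) auto
      also have "\<dots> = 2 * B * exp (a * y - c * exp (2 * y))"
      proof -
        have "exp (a * y - c * exp (2 * y)) = exp (- c * exp (2 * y)) * exp (a * y)" by (simp flip: exp_add)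
        then show ?thesis by simp
      qed
      also have "\<dots> \<le> 2 * B * exp (K - y\<^sup>2)" using K[OF y] B by (intro mult_left_mono) auto
      also have "\<dots> = (2 * B * exp K) * exp (- (y\<^sup>2))"
      proof -
        have "exp (K - y\<^sup>2) = exp K * exp (- (y\<^sup>2))" by (simp flip: exp_add)
        then show ?thesis by simp
      qed
      finally show ?thesis .
    qed
    then show ?thesis using B(1) by (intro exI[of _ "2 * B * exp K"]) auto
  qed
  obtain C1 where C1: "C1 \<ge> 0" "\<And>y. y \<ge> 0 \<Longrightarrow> norm (char_kernel q chi y) \<le> C1 * exp (- (y\<^sup>2))"
    using pos[OF prim] by blast
  obtain C2 where C2: "C2 \<ge> 0" "\<And>y. y \<ge> 0 \<Longrightarrow> norm (char_kernel q (conj_character chi) y) \<le> C2 * exp (- (y\<^sup>2))"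
    using pos[OF primitive_character_conj[OF prim]] by blast
  have "norm (char_kernel q chi y) \<le> (C1 + norm (root_number q chi) * C2) * exp (- (y\<^sup>2))" for y
  proof (cases "y \<ge> 0")
    case True
    have "0 \<le> norm (root_number q chi) * C2 * exp (- (y\<^sup>2))" using C2 by simp
    then show ?thesis using C1(2)[OF True] by (simp add: distrib_right)
  next
    case False
    then have "norm (char_kernel q chi (- (- y))) \<le> norm (root_number q chi) * (C2 * exp (- ((- y)\<^sup>2)))"
      unfolding char_kernel_functional_equation[OF prim q] norm_mult by (intro mult_left_mono C2) auto
    moreover have "0 \<le> C1 * exp (- (y\<^sup>2))" using C1 by simp
    ultimately show ?thesis by (simp add: distrib_right mult.assoc)
  qed
  then show thesis using that by blast
qed

section \<open>Gamma integrals and the Dirichlet series of the completed function\<close>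

lemma integrable_real_substitution_exp:
  fixes f :: "real \<Rightarrow> real"
  assumes c: "c > 0" and f: "f absolutely_integrable_on {0<..}" and meas: "f \<in> borel_measurable borel"
  shows "integrable lborel (\<lambda>y. 2 * c * exp (2 * y) * f (c * exp (2 * y)))"
    and "(LINT y|lborel. 2 * c * exp (2 * y) * f (c * exp (2 * y))) = integral {0<..} f"
proof -
  define g where "g = (\<lambda>y::real. c * exp (2 * y))"
  define h where "h = (\<lambda>y::real. 2 * c * exp (2 * y) * f (c * exp (2 * y)))"
  have der: "(g has_field_derivative 2 * c * exp (2 * y)) (at y within UNIV)" for y
    unfolding g_def by (auto intro!: derivative_eq_intros)
  have inj: "inj_on g UNIV" using c by (auto simp: inj_on_def g_def)
  have img: "g ` UNIV = {0<..}"
  proof (intro equalityI subsetI)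
    fix x :: real assume "x \<in> {0<..}"
    then have "x = g (ln (x / c) / 2)" using c by (simp add: g_def)
    then show "x \<in> g ` UNIV" by blast
  qed (use c in \<open>auto simp: g_def\<close>)
  have abs: "\<bar>2 * c * exp (2 * y)\<bar> = 2 * c * exp (2 * y)" for y :: real using c by simp
  have "f absolutely_integrable_on g ` UNIV \<and> integral (g ` UNIV) f = integral {0<..} f"
    using f img by simp
  then have "(\<lambda>y. \<bar>2 * c * exp (2 * y)\<bar> * f (g y)) absolutely_integrable_on UNIV \<and>
      integral UNIV (\<lambda>y. \<bar>2 * c * exp (2 * y)\<bar> * f (g y)) = integral {0<..} f"
    by (subst has_absolute_integral_change_of_variables_1'[OF _ der inj]) auto
  then have *: "h absolutely_integrable_on UNIV" "integral UNIV h = integral {0<..} f"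
    by (auto simp: abs g_def h_def)
  have [measurable]: "h \<in> borel_measurable lborel" unfolding h_def using meas by measurable
  have "integrable lebesgue h" using *(1) by (simp add: set_integrable_def)
  then have inth: "integrable lborel h" by (simp add: integrable_completion)
  then have "(LINT y|lborel. h y) = integral UNIV h" by (rule integral_lborel[symmetric])
  with *(2) inth show "integrable lborel (\<lambda>y. 2 * c * exp (2 * y) * f (c * exp (2 * y)))"
    "(LINT y|lborel. 2 * c * exp (2 * y) * f (c * exp (2 * y))) = integral {0<..} f"
    by (simp_all add: h_def)
qed

text \<open>Substitute t = c exp(2 y) in the Gamma integral; c = pi n^2 / q will give the n-th term
  of the theta kernel.\<close>

lemma Gamma_integral_exp_substitution:
  assumes c: "c > 0" and w: "Re w > 0"
  shows "integrable lborel (\<lambda>y. complex_of_real (2 * exp (- c * exp (2 * y))) * exp (2 * w * of_real y))"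
    and "(LINT y|lborel. complex_of_real (2 * exp (- c * exp (2 * y))) * exp (2 * w * of_real y)) = Gamma w * of_real c powr (- w)"
proof -
  define f where "f = (\<lambda>t. complex_of_real t powr (w - 1) / of_real (exp t))"
  have meas: "f \<in> borel_measurable borel" unfolding f_def by measurable
  have absf: "f absolutely_integrable_on {0<..}" unfolding f_def by (rule absolutely_integrable_Gamma_integral'[OF w])
  have If: "(f has_integral Gamma w) {0<..}" unfolding f_def by (rule Gamma_integral_complex'[OF w])
  define h where "h = (\<lambda>y. complex_of_real (2 * c * exp (2 * y)) * f (c * exp (2 * y)))"
  have int: "integrable lebesgue (\<lambda>t. indicator {0<..} t *\<^sub>R f t)"
    using absf by (simp add: set_integrable_def)
  have Re: "(\<lambda>t. Re (f t)) absolutely_integrable_on {0<..}"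
    using integrable_bounded_linear[OF bounded_linear_Re int] by (simp add: set_integrable_def)
  have Im: "(\<lambda>t. Im (f t)) absolutely_integrable_on {0<..}"
    using integrable_bounded_linear[OF bounded_linear_Im int] by (simp add: set_integrable_def)
  have measRe: "(\<lambda>t. Re (f t)) \<in> borel_measurable borel" "(\<lambda>t. Im (f t)) \<in> borel_measurable borel"
    using meas by measurable
  \<comment> \<open>The change of variables is carried out for real-valued functions, so real and
    imaginary parts are treated apart and recombined in h.\<close>
  define r where "r = (\<lambda>y::real. 2 * c * exp (2 * y) * Re (f (c * exp (2 * y))))"
  define i where "i = (\<lambda>y::real. 2 * c * exp (2 * y) * Im (f (c * exp (2 * y))))"
  have r: "integrable lborel r" "(LINT y|lborel. r y) = Re (Gamma w)"
    using integrable_real_substitution_exp[OF c Re measRe(1)] integral_unique[OF has_integral_Re[OF If]]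
    by (simp_all add: r_def)
  have i: "integrable lborel i" "(LINT y|lborel. i y) = Im (Gamma w)"
    using integrable_real_substitution_exp[OF c Im measRe(2)] integral_unique[OF has_integral_Im[OF If]]
    by (simp_all add: i_def)
  have h: "h y = of_real (r y) + \<i> * of_real (i y)" for y
    by (simp add: h_def r_def i_def complex_eq_iff)
  have inth: "integrable lborel h" unfolding h
    by (intro Bochner_Integration.integrable_add integrable_mult_right integrable_of_real r i)
  have Ih: "(LINT y|lborel. h y) = Gamma w"
    unfolding h using r i by (simp add: complex_eq_iff)
  define T where "T = (\<lambda>y::real. complex_of_real (2 * exp (- c * exp (2 * y))) * exp (2 * w * of_real y))"
  have hT: "h y = of_real c powr w * T y" for y
  proof -
    have "complex_of_real (c * exp (2 * y)) powr (w - 1) = exp ((w - 1) * of_real (ln (c * exp (2 * y))))"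
      using c by (simp add: powr_def Ln_of_real del: of_real_mult)
    also have "ln (c * exp (2 * y)) = ln c + 2 * y" using c by (simp add: ln_mult)
    finally have 1: "complex_of_real (c * exp (2 * y)) powr (w - 1) = exp ((w - 1) * of_real (ln c + 2 * y))" .
    have 2: "complex_of_real (2 * c * exp (2 * y)) = 2 * exp (of_real (ln c + 2 * y))"
      using c by (simp only: exp_of_real exp_add exp_ln) simp
    have 3: "complex_of_real c powr w = exp (w * of_real (ln c))"
      using c by (simp add: powr_def Ln_of_real)
    have 4: "exp (of_real (ln c + 2 * y)) * exp ((w - 1) * of_real (ln c + 2 * y)) = exp (w * of_real (ln c)) * exp (2 * w * of_real y)"
      unfolding exp_add[symmetric] by (simp add: algebra_simps)
    have 5: "complex_of_real (exp (- c * exp (2 * y))) = 1 / of_real (exp (c * exp (2 * y)))"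
      by (simp add: exp_minus inverse_eq_divide)
    have "h y = 2 * (exp (of_real (ln c + 2 * y)) * exp ((w - 1) * of_real (ln c + 2 * y))) * (1 / of_real (exp (c * exp (2 * y))))"
      unfolding h_def f_def 1 2 by simp
    also have "\<dots> = of_real c powr w * T y"
      unfolding 4 3 T_def of_real_mult 5 by simp
    finally show ?thesis .
  qed
  have nz: "complex_of_real c powr w \<noteq> 0" using c by simp
  have T: "T y = of_real c powr (- w) * h y" for y
    unfolding hT powr_minus using nz by simp
  have "integrable lborel T" unfolding T by (rule integrable_mult_right) (rule inth)
  moreover have "(LINT y|lborel. T y) = Gamma w * of_real c powr (- w)"
    unfolding T using Ih by (simp add: mult.commute)
  ultimately show "integrable lborel (\<lambda>y. complex_of_real (2 * exp (- c * exp (2 * y))) * exp (2 * w * of_real y))"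
    "(LINT y|lborel. complex_of_real (2 * exp (- c * exp (2 * y))) * exp (2 * w * of_real y)) = Gamma w * of_real c powr (- w)"
    by (simp_all add: T_def)
qed

text \<open>The argument -i (s - 1/2) inverts s = 1/2 + i z and so passes from the variable of
  \<open>xi_line\<close> to that of the L-function.\<close>

definition completed_L :: "nat \<Rightarrow> (int \<Rightarrow> complex) \<Rightarrow> complex \<Rightarrow> complex" where
  "completed_L q chi s = fourier_laplace (char_kernel q chi) (- \<i> * (s - 1 / 2))"

lemma holomorphic_fourier_laplace_char_kernel:
  assumes "primitive_character q chi" "q > 1"
  shows "fourier_laplace (char_kernel q chi) holomorphic_on A"
proof -
  obtain C where "\<And>y. norm (char_kernel q chi y) \<le> C * exp (- (y\<^sup>2))"
    using char_kernel_bound[OF assms] by blast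
  then show ?thesis by (rule holomorphic_fourier_laplace[OF char_kernel_measurable])
qed

lemma holomorphic_completed_L:
  assumes "primitive_character q chi" "q > 1"
  shows "completed_L q chi holomorphic_on A"
proof -
  have "(fourier_laplace (char_kernel q chi) \<circ> (\<lambda>s. - \<i> * (s - 1 / 2))) holomorphic_on A"
    by (rule holomorphic_on_compose_gen[OF _ holomorphic_fourier_laplace_char_kernel[OF assms, of UNIV]])
       (auto intro!: holomorphic_intros)
  then show ?thesis by (simp only: completed_L_def[abs_def] o_def)
qed

text \<open>The kernel is integrated term by term. The n-th term gives a Gamma integral with c = pi
  n^2 / q, and 2 w = s + \<kappa> makes n^\<kappa> c^(-w) equal to (q / pi)^w n^(-s). Re s > 1
  enters through the sum of n^(-Re s), which up to a constant majorises the integrals of the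
  absolute values.\<close>

lemma completed_L_dirichlet_series:
  assumes prim: "primitive_character q chi" and q: "q > 1" and s: "Re s > 1"
  defines "w \<equiv> (s + of_nat (char_parity chi)) / 2"
  shows "(\<lambda>n. of_real (real q / pi) powr w * Gamma w * (chi (int (Suc n)) * of_nat (Suc n) powr (- s))) sums completed_L q chi s"
    and "summable (\<lambda>n. norm (chi (int (Suc n)) * of_nat (Suc n) powr (- s)))"
proof -
  have chi: "dirichlet_character q chi" using prim by (simp add: primitive_character_def)
  define \<kappa> where "\<kappa> = char_parity chi"
  define c where "c = (\<lambda>n. pi * (real (Suc n))\<^sup>2 / real q)"
  have c: "c n > 0" for n using q by (simp add: c_def)
  have w: "Re w > 0" using s by (simp add: w_def)
  define I where "I = (\<lambda>n y. complex_of_real (2 * exp (- c n * exp (2 * y))) * exp (2 * w * of_real y))"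
  define a where "a = (\<lambda>n. chi (int (Suc n)) * of_nat (Suc n) ^ \<kappa>)"
  define T where "T = (\<lambda>n y. a n * I n y)"
  have intI: "integrable lborel (I n)" "(LINT y|lborel. I n y) = Gamma w * of_real (c n) powr (- w)" for n
    unfolding I_def by (rule Gamma_integral_exp_substitution[OF c w])+
  have norm_powr: "norm (complex_of_real x powr z) = x powr Re z" if "x > 0" for x z
    using that by (simp add: norm_powr_real_powr)
  have normI: "(LINT y|lborel. norm (I n y)) = Gamma (Re w) * c n powr (- Re w)" for n
  proof -
    have "complex_of_real (LINT y|lborel. norm (I n y)) = (LINT y|lborel. complex_of_real (norm (I n y)))"
      by (rule integral_complex_of_real[symmetric])
    also have "(\<lambda>y. complex_of_real (norm (I n y))) = (\<lambda>y. complex_of_real (2 * exp (- c n * exp (2 * y))) * exp (2 * of_real (Re w) * of_real y))"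
      by (rule ext) (simp add: I_def norm_mult flip: exp_of_real)
    also have "integral\<^sup>L lborel \<dots> = Gamma (of_real (Re w)) * of_real (c n) powr (- of_real (Re w))"
      by (rule Gamma_integral_exp_substitution[OF c]) (use w in simp)
    also have "\<dots> = complex_of_real (Gamma (Re w) * c n powr (- Re w))"
      using c[of n] by (simp add: Gamma_complex_of_real powr_of_real flip: of_real_minus)
    finally show ?thesis by (simp only: of_real_eq_iff)
  qed
  have norm_a: "norm (a n) \<le> real (Suc n) ^ \<kappa>" for n
    using mult_right_mono[OF norm_character_le[OF chi, of "int (Suc n)"], of "real (Suc n) ^ \<kappa>"]
    by (simp add: a_def norm_mult norm_power del: of_nat_Suc)
  have real_powers: "real (Suc n) ^ \<kappa> * c n powr (- Re w) = (pi / real q) powr (- Re w) * real (Suc n) powr (- Re s)" for n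
  proof -
    have "c n powr (- Re w) = (pi / real q) powr (- Re w) * ((real (Suc n))\<^sup>2) powr (- Re w)"
      using q by (simp add: c_def powr_mult[symmetric] del: of_nat_Suc)
    also have "((real (Suc n))\<^sup>2) powr (- Re w) = real (Suc n) powr (- (Re s + real \<kappa>))"
    proof -
      have "(real (Suc n))\<^sup>2 = real (Suc n) powr 2" by (simp add: powr_numeral del: of_nat_Suc)
      moreover have "2 * (- Re w) = - (Re s + real \<kappa>)" by (simp add: w_def \<kappa>_def field_simps)
      ultimately show ?thesis by (simp only: powr_powr)
    qed
    also have "\<dots> = real (Suc n) powr (- Re s) * real (Suc n) powr (- real \<kappa>)"
      by (simp add: powr_add[symmetric])
    finally show ?thesis
      by (simp add: powr_minus powr_realpow divide_inverse del: of_nat_Suc)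
  qed
  have summ: "summable (\<lambda>n. real (Suc n) powr (- Re s))"
    using s summable_real_powr_iff[of "- Re s"] by (subst summable_Suc_iff) simp
  have series: "char_kernel q chi y * exp (\<i> * (- \<i> * (s - 1 / 2)) * of_real y) = (\<Sum>n. T n y)"
    and summT: "summable (\<lambda>n. norm (T n y))" for y :: real
  proof -
    define x where "x = exp (2 * y)"
    have x: "x > 0" by (simp add: x_def)
    define e where "e = 2 * exp (2 * w * complex_of_real y)"
    have T: "T n y = e * (chi (int (Suc n)) * of_real (gauss \<kappa> (x / real q) (real (Suc n))))" for n
    proof -
      have "- c n * exp (2 * y) = - pi * (x / real q) * (real (Suc n))\<^sup>2"
        by (simp add: c_def x_def)
      then show ?thesis by (simp add: T_def I_def a_def gauss_def e_def del: of_nat_Suc)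
    qed
    have "(\<lambda>n. chi (int n) * of_real (gauss \<kappa> (x / real q) (real n))) sums char_theta q chi x"
      unfolding \<kappa>_def char_theta_def by (rule summable_sums[OF summable_char_theta[OF chi x]])
    then have "(\<lambda>n. chi (int (Suc n)) * of_real (gauss \<kappa> (x / real q) (real (Suc n)))) sums char_theta q chi x"
      by (subst sums_Suc_iff) (simp add: character_0[OF chi q])
    then have "(\<lambda>n. T n y) sums (e * char_theta q chi x)" unfolding T by (rule sums_mult)
    moreover have "e * char_theta q chi x = char_kernel q chi y * exp (\<i> * (- \<i> * (s - 1 / 2)) * of_real y)"
    proof -
      have "exp (2 * w * complex_of_real y) = exp ((of_nat \<kappa> + 1 / 2) * of_real y) * exp ((s - 1 / 2) * of_real y)"
      proof -
        have "2 * w = s + of_nat \<kappa>" by (simp add: w_def \<kappa>_def)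
        then show ?thesis unfolding exp_add[symmetric] by (simp add: algebra_simps)
      qed
      moreover have "\<i> * (- \<i> * (s - 1 / 2)) = s - 1 / 2" by (simp add: complex_eq_iff)
      moreover have "complex_of_real (exp ((real \<kappa> + 1 / 2) * y)) = exp ((of_nat \<kappa> + 1 / 2) * of_real y)"
        by (simp flip: exp_of_real)
      ultimately show ?thesis by (simp only: e_def char_kernel_def \<kappa>_def[symmetric] x_def mult_ac)
    qed
    ultimately show "char_kernel q chi y * exp (\<i> * (- \<i> * (s - 1 / 2)) * of_real y) = (\<Sum>n. T n y)"
      by (simp add: sums_iff)
    have "summable (\<lambda>n. \<bar>gauss \<kappa> (x / real q) (real (Suc n))\<bar>)"
      using summable_gauss[OF _ char_parity_le_1, of "x / real q" chi] x q unfolding \<kappa>_def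
      by (subst summable_Suc_iff) simp
    then have "summable (\<lambda>n. norm e * \<bar>gauss \<kappa> (x / real q) (real (Suc n))\<bar>)" by (rule summable_mult)
    then show "summable (\<lambda>n. norm (T n y))"
    proof (rule summable_comparison_test')
      show "norm (norm (T n y)) \<le> norm e * \<bar>gauss \<kappa> (x / real q) (real (Suc n))\<bar>" for n
        using mult_right_mono[OF norm_character_le[OF chi, of "int (Suc n)"], of "\<bar>gauss \<kappa> (x / real q) (real (Suc n))\<bar>"]
        unfolding T by (simp add: norm_mult mult_left_mono del: of_nat_Suc)
    qed
  qed
  have "(\<lambda>n. LINT y|lborel. T n y) sums (LINT y|lborel. (\<Sum>n. T n y))"
  proof (rule sums_integral)
    show "integrable lborel (T n)" for n unfolding T_def by (intro integrable_mult_right intI)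
    show "AE y in lborel. summable (\<lambda>n. norm (T n y))" using summT by simp
    show "summable (\<lambda>n. LINT y|lborel. norm (T n y))"
    proof (rule summable_comparison_test')
      show "summable (\<lambda>n. Gamma (Re w) * ((pi / real q) powr (- Re w) * real (Suc n) powr (- Re s)))"
        by (intro summable_mult summ)
      show "norm (LINT y|lborel. norm (T n y)) \<le> Gamma (Re w) * ((pi / real q) powr (- Re w) * real (Suc n) powr (- Re s))" for n
      proof -
        have "norm (LINT y|lborel. norm (T n y)) = norm (a n) * (Gamma (Re w) * c n powr (- Re w))"
          using w by (simp add: T_def norm_mult normI abs_mult Gamma_real_pos less_imp_le)
        also have "\<dots> \<le> real (Suc n) ^ \<kappa> * (Gamma (Re w) * c n powr (- Re w))"
          using w by (intro mult_right_mono norm_a mult_nonneg_nonneg) (auto simp: Gamma_real_pos less_imp_le)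
        finally show ?thesis using real_powers[of n] by (simp add: mult_ac del: of_nat_Suc)
      qed
    qed
  qed
  moreover have "(LINT y|lborel. (\<Sum>n. T n y)) = completed_L q chi s"
    by (simp only: completed_L_def fourier_laplace_def series)
  moreover have "(LINT y|lborel. T n y) = of_real (real q / pi) powr w * Gamma w * (chi (int (Suc n)) * of_nat (Suc n) powr (- s))" for n
  proof -
    define N where "N = real (Suc n)"
    have N: "N > 0" by (simp add: N_def)
    have lnc: "ln (c n) = 2 * ln N - ln (real q / pi)"
    proof -
      have "c n = pi * N\<^sup>2 / real q" by (simp add: c_def N_def)
      then show ?thesis using q N by (simp add: ln_mult ln_div ln_realpow)
    qed
    have "of_nat (Suc n) ^ \<kappa> * complex_of_real (c n) powr (- w) = exp (of_nat \<kappa> * of_real (ln N)) * exp (- w * of_real (ln (c n)))"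
    proof -
      have "complex_of_nat (Suc n) ^ \<kappa> = exp (of_nat \<kappa> * of_real (ln N))"
        using N by (simp add: exp_of_nat_mult exp_of_real N_def del: of_nat_Suc)
      then show ?thesis using c[of n] by (simp add: powr_def Ln_of_real)
    qed
    also have "\<dots> = exp (w * of_real (ln (real q / pi))) * exp (- s * of_real (ln N))"
    proof -
      have "of_nat \<kappa> * x + - w * (2 * x - z) = w * z + (of_nat \<kappa> - 2 * w) * x" for x z :: complex
        by (simp add: algebra_simps)
      moreover have "2 * w = s + of_nat \<kappa>" by (simp add: w_def \<kappa>_def)
      then have "of_nat \<kappa> - 2 * w = - s" by (simp only:) simp
      ultimately show ?thesis unfolding exp_add[symmetric] lnc by simp
    qed
    also have "\<dots> = of_real (real q / pi) powr w * of_nat (Suc n) powr (- s)"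
    proof -
      have "complex_of_nat (Suc n) = of_real N" by (simp add: N_def)
      then show ?thesis using N q by (simp add: powr_def Ln_of_real del: of_nat_Suc of_real_divide)
    qed
    finally show ?thesis by (simp add: T_def intI a_def mult_ac del: of_nat_Suc)
  qed
  ultimately show "(\<lambda>n. of_real (real q / pi) powr w * Gamma w * (chi (int (Suc n)) * of_nat (Suc n) powr (- s))) sums completed_L q chi s"
    by simp
  show "summable (\<lambda>n. norm (chi (int (Suc n)) * of_nat (Suc n) powr (- s)))"
  proof (rule summable_comparison_test'[OF summ])
    fix n
    have "norm (of_nat (Suc n) powr (- s)) = real (Suc n) powr (- Re s)"
      using norm_powr[of "real (Suc n)" "- s"] by simp
    then show "norm (norm (chi (int (Suc n)) * of_nat (Suc n) powr (- s))) \<le> real (Suc n) powr (- Re s)"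
      using mult_right_mono[OF norm_character_le[OF chi, of "int (Suc n)"], of "real (Suc n) powr (- Re s)"]
      by (simp add: norm_mult del: of_nat_Suc)
  qed
qed

section \<open>Identification of \<open>xi_line\<close> with the transform, and consequences\<close>

lemma mult_cancel_pairs:
  fixes a b c d x :: "'a::comm_ring_1"
  assumes "a * c = 1" "b * d = 1"
  shows "a * b * (c * d * x) = x"
proof -
  have "a * b * (c * d * x) = (a * c) * (b * d) * x" by (simp only: mult_ac)
  then show ?thesis by (simp add: assms)
qed

context
  fixes q :: nat and chi :: "int \<Rightarrow> complex"
  assumes q: "q > 1" and prim: "primitive_character q chi"
begin

definition gamma_arg :: "complex \<Rightarrow> complex" where
  "gamma_arg s = (s + of_nat (char_parity chi)) / 2"

lemma holomorphic_gamma_arg: "gamma_arg holomorphic_on A"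
  unfolding gamma_arg_def[abs_def] by (intro holomorphic_intros) auto

text \<open>The definite description needs two halves. Existence: \<open>rGamma\<close> is entire,
  so the right-hand side is entire, and for Re s > 1 its factors undo those of the completed
  Dirichlet series. Uniqueness: the identity theorem, starting from that half plane.\<close>

lemma dirichlet_L_eq:
  "dirichlet_L chi = (\<lambda>s. of_real (real q / pi) powr (- gamma_arg s) * rGamma (gamma_arg s) * completed_L q chi s)"
  (is "_ = ?F")
  unfolding dirichlet_L_def
proof (rule the_equality)
  have qpi: "complex_of_real (real q / pi) \<noteq> 0" using q by simp
  have hol: "?F holomorphic_on UNIV"
  proof -
    have "(rGamma \<circ> gamma_arg) holomorphic_on UNIV"
      by (rule holomorphic_on_compose_gen[OF _ holomorphic_rGamma[of UNIV]])
         (auto intro!: holomorphic_gamma_arg)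
    then have "(\<lambda>s. rGamma (gamma_arg s)) holomorphic_on UNIV" by (simp only: o_def)
    moreover have "(\<lambda>s. complex_of_real (real q / pi) powr (- gamma_arg s)) holomorphic_on UNIV"
      using qpi by (intro holomorphic_intros holomorphic_gamma_arg)
    ultimately show ?thesis
      by (intro holomorphic_on_mult holomorphic_completed_L prim q)
  qed
  have sums: "(\<lambda>n. chi (int (Suc n)) * of_nat (Suc n) powr (- s)) sums ?F s" if s: "Re s > 1" for s
  proof -
    have w: "Re (gamma_arg s) > 0" using s by (simp add: gamma_arg_def)
    then have "gamma_arg s \<notin> \<int>\<^sub>\<le>\<^sub>0" by (auto elim!: nonpos_Ints_cases)
    then have G: "Gamma (gamma_arg s) \<noteq> 0" by (simp add: Gamma_eq_zero_iff)
    have "(\<lambda>n. of_real (real q / pi) powr (- gamma_arg s) * rGamma (gamma_arg s) *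
        (of_real (real q / pi) powr gamma_arg s * Gamma (gamma_arg s) * (chi (int (Suc n)) * of_nat (Suc n) powr (- s)))) sums ?F s"
      using completed_L_dirichlet_series(1)[OF prim q s] unfolding gamma_arg_def by (rule sums_mult)
    moreover have "of_real (real q / pi) powr (- gamma_arg s) * rGamma (gamma_arg s) *
        (of_real (real q / pi) powr gamma_arg s * Gamma (gamma_arg s) * x) = x" for x
    proof -
      have "complex_of_real (real q / pi) powr (- gamma_arg s) * of_real (real q / pi) powr gamma_arg s = 1"
        using qpi by (simp add: powr_add[symmetric] del: of_real_divide)
      moreover have "rGamma (gamma_arg s) * Gamma (gamma_arg s) = 1" using G by (simp add: rGamma_inverse_Gamma)
      ultimately show ?thesis by (rule mult_cancel_pairs)
    qed
    ultimately show ?thesis by (simp only:)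
  qed
  show "?F holomorphic_on UNIV \<and> (\<forall>s. 1 < Re s \<longrightarrow> (\<lambda>n. chi (int (Suc n)) * of_nat (Suc n) powr (- s)) sums ?F s)"
    using hol sums by blast
  fix G
  assume G: "G holomorphic_on UNIV \<and> (\<forall>s. 1 < Re s \<longrightarrow> (\<lambda>n. chi (int (Suc n)) * of_nat (Suc n) powr (- s)) sums G s)"
  show "G = ?F"
  proof
    fix z
    show "G z = ?F z"
    proof (rule analytic_continuation_open[of "{s. Re s > 1}" UNIV G ?F])
      show "open {s. Re s > 1}" by (rule open_halfspace_Re_gt)
      show "{s. Re s > 1} \<noteq> {}" by (auto intro!: exI[of _ 2])
      show "G s = ?F s" if "s \<in> {s. Re s > 1}" for s
        using sums_unique2 G sums[of s] that by blast
    qed (use G hol in auto)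
  qed
qed

lemma eventually_not_nonpos_Int: "eventually (\<lambda>w::complex. w \<notin> \<int>\<^sub>\<le>\<^sub>0) (at z)"
proof (cases "z \<in> \<int>")
  case True
  have "w \<notin> \<int>\<^sub>\<le>\<^sub>0" if w: "w \<noteq> z" "dist w z < 1" for w
  proof
    assume "w \<in> \<int>\<^sub>\<le>\<^sub>0"
    then obtain a b where ab: "w = of_int a" "z = of_int b" using True by (auto elim!: nonpos_Ints_cases Ints_cases)
    then have "norm (of_int (a - b) :: complex) < 1" using w(2) by (simp add: dist_norm)
    then have "\<bar>a - b\<bar> < 1" by (simp only: norm_of_int)
    then show False using w(1) ab by simp
  qed
  then show ?thesis unfolding eventually_at by (intro exI[of _ 1]) auto
next
  case False
  have "eventually (\<lambda>w. w \<in> - \<int>) (nhds z)"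
    using False by (intro eventually_nhds_in_open) (auto simp: closed_Ints)
  then show ?thesis
    using nonpos_Ints_subset_Ints by (auto simp: eventually_at_filter elim!: eventually_mono)
qed

text \<open>Where the Gamma factor has no pole the defining product equals
  \<open>completed_L\<close>. The poles are isolated, so around any point the equality holds on a
  punctured neighbourhood, and \<open>remove_sings\<close> picks up the value of the continuous
  function \<open>completed_L\<close>, also where Gamma is 0 by convention.\<close>

lemma xi_eq_completed_L: "xi q chi = completed_L q chi"
proof
  fix z
  have qpi: "complex_of_real (real q / pi) \<noteq> 0" using q by simp
  have "eventually (\<lambda>w. w \<notin> \<int>\<^sub>\<le>\<^sub>0) (at (gamma_arg z))" by (rule eventually_not_nonpos_Int)
  moreover have "filterlim gamma_arg (at (gamma_arg z)) (at z)"
    unfolding filterlim_at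
  proof
    show "eventually (\<lambda>s. gamma_arg s \<in> UNIV \<and> gamma_arg s \<noteq> gamma_arg z) (at z)"
      by (auto simp: gamma_arg_def eventually_at_filter)
    show "filterlim gamma_arg (nhds (gamma_arg z)) (at z)"
      unfolding gamma_arg_def by (intro tendsto_intros) auto
  qed
  ultimately have "eventually (\<lambda>s. gamma_arg s \<notin> \<int>\<^sub>\<le>\<^sub>0) (at z)" by (rule eventually_compose_filterlim)
  then have ev: "eventually (\<lambda>s. completed_L q chi s =
       of_real (real q / pi) powr gamma_arg s * Gamma (gamma_arg s) * dirichlet_L chi s) (at z)"
  proof eventually_elim
    case (elim s)
    then have "Gamma (gamma_arg s) \<noteq> 0" by (simp add: Gamma_eq_zero_iff)
    then have 1: "Gamma (gamma_arg s) * rGamma (gamma_arg s) = 1" by (simp add: rGamma_inverse_Gamma)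
    have 2: "complex_of_real (real q / pi) powr gamma_arg s * of_real (real q / pi) powr (- gamma_arg s) = 1"
      using qpi by (simp add: powr_add[symmetric] del: of_real_divide)
    show ?case unfolding dirichlet_L_eq by (rule mult_cancel_pairs[OF 2 1, symmetric])
  qed
  have "isCont (completed_L q chi) z"
    using holomorphic_on_imp_continuous_on[OF holomorphic_completed_L[OF prim q, of UNIV]]
    by (simp add: continuous_on_eq_continuous_at)
  then have "completed_L q chi \<midarrow>z\<rightarrow> completed_L q chi z" by (simp add: isCont_def)
  then have "(\<lambda>s. of_real (real q / pi) powr gamma_arg s * Gamma (gamma_arg s) * dirichlet_L chi s) \<midarrow>z\<rightarrow> completed_L q chi z"
    using ev by (rule Lim_transform_eventually)
  then show "xi q chi z = completed_L q chi z"
    unfolding xi_def gamma_arg_def by (rule remove_sings_eqI)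
qed

lemma xi_line_eq: "xi_line q chi = fourier_laplace (char_kernel q chi)"
proof
  fix z
  have "- \<i> * (1 / 2 + \<i> * z - 1 / 2) = z" by (simp add: complex_eq_iff)
  then show "xi_line q chi z = fourier_laplace (char_kernel q chi) z"
    by (simp only: xi_line_def xi_eq_completed_L completed_L_def)
qed

lemma holomorphic_xi_line: "xi_line q chi holomorphic_on A"
  unfolding xi_line_eq by (rule holomorphic_fourier_laplace_char_kernel[OF prim q])

lemma xi_line_growth:
  obtains B where "\<And>z. norm (xi_line q chi z) \<le> B * exp (norm z ^ 2 / 2)"
proof -
  obtain C where C: "\<And>y. norm (char_kernel q chi y) \<le> C * exp (- (y\<^sup>2))"
    using char_kernel_bound[OF prim q] by blast
  show thesis
    using that norm_fourier_laplace_le[OF char_kernel_measurable C] unfolding xi_line_eq by blast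
qed

text \<open>At s = 3 the first term 1 of the Dirichlet series dominates: the others add up to at
  most half of pi^2/6 - 1 in modulus, as 1/N^3 <= 1/(2 N^2) for N >= 2. So xi does not vanish
  identically, and no Euler product is involved.\<close>

lemma completed_L_3_nonzero: "completed_L q chi 3 \<noteq> 0"
proof -
  have chi: "dirichlet_character q chi" using prim by (simp add: primitive_character_def)
  define w where "w = ((3::complex) + of_nat (char_parity chi)) / 2"
  define K where "K = of_real (real q / pi) powr w * Gamma w"
  define a where "a = (\<lambda>n. chi (int (Suc n)) * of_nat (Suc n) powr (- (3::complex)))"
  have "Re w > 0" by (simp add: w_def)
  then have "w \<notin> \<int>\<^sub>\<le>\<^sub>0" by (auto elim!: nonpos_Ints_cases)
  then have K: "K \<noteq> 0" using q by (simp add: K_def Gamma_eq_zero_iff)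
  have s1: "(\<lambda>n. K * a n) sums completed_L q chi 3"
    using completed_L_dirichlet_series(1)[OF prim q, of 3] by (simp add: K_def w_def a_def)
  then have "(\<lambda>n. a n) sums (completed_L q chi 3 / K)"
    using sums_mult_D[of K a, OF _ K] sums_mult_iff[OF K, of a "completed_L q chi 3 / K"] K by simp
  moreover have a0: "a 0 = 1" by (simp add: a_def character_1[OF chi])
  ultimately have sa: "(\<lambda>n. a (Suc n)) sums (completed_L q chi 3 / K - 1)"
    by (subst sums_Suc_iff) simp
  have sq: "(\<lambda>n. 1 / (real (Suc n) + 1) ^ 2) sums (pi\<^sup>2 / 6 - 1)"
    using inverse_squares_sums by (subst sums_Suc_iff) (simp add: add.commute)
  have le: "norm (a (Suc n)) \<le> (1 / 2) * (1 / (real (Suc n) + 1) ^ 2)" for n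
  proof -
    define N where "N = real (Suc (Suc n))"
    have N: "N \<ge> 2" by (simp add: N_def)
    have "norm (complex_of_nat (Suc (Suc n)) powr (- 3)) = N powr (- 3)"
      using norm_powr_real_powr[of "of_real N" "-3"] N by (simp add: N_def)
    also have "N powr (- 3) = 1 / N ^ 3" using N by (simp add: powr_minus powr_numeral inverse_eq_divide)
    also have "\<dots> \<le> (1 / 2) * (1 / N ^ 2)"
    proof -
      have "N ^ 2 * 2 \<le> N ^ 2 * N" using N by (intro mult_left_mono) auto
      then have "2 * N ^ 2 \<le> N ^ 3" by (simp add: power2_eq_square power3_eq_cube mult_ac)
      moreover have "2 * N ^ 2 > 0" using N by auto
      ultimately have "1 / N ^ 3 \<le> 1 / (2 * N ^ 2)" by (intro frac_le) auto
      then show ?thesis by simp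
    qed
    finally have "norm (complex_of_nat (Suc (Suc n)) powr (- 3)) \<le> (1 / 2) * (1 / N ^ 2)" .
    moreover have "norm (a (Suc n)) \<le> 1 * norm (complex_of_nat (Suc (Suc n)) powr (- 3))"
      unfolding a_def norm_mult by (intro mult_right_mono norm_character_le[OF chi]) auto
    moreover have "N = real (Suc n) + 1" by (simp add: N_def)
    ultimately show ?thesis by simp
  qed
  have sumsq: "(\<lambda>n. (1 / 2) * (1 / (real (Suc n) + 1) ^ 2)) sums ((1 / 2) * (pi\<^sup>2 / 6 - 1))"
    by (rule sums_mult[OF sq])
  have "norm (completed_L q chi 3 / K - 1) = norm (\<Sum>n. a (Suc n))" using sa by (simp add: sums_iff)
  also have "\<dots> \<le> (\<Sum>n. (1 / 2) * (1 / (real (Suc n) + 1) ^ 2))"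
    by (rule norm_suminf_le[OF le sums_summable[OF sumsq]])
  also have "\<dots> = (1 / 2) * (pi\<^sup>2 / 6 - 1)" by (rule sums_unique[OF sumsq, symmetric])
  also have "\<dots> < 1"
  proof -
    have "pi\<^sup>2 < 4\<^sup>2" using pi_less_4 by (intro power_strict_mono) auto
    then show ?thesis by simp
  qed
  finally have "completed_L q chi 3 / K - 1 \<noteq> - 1" by (metis less_irrefl norm_minus_cancel norm_one)
  then show ?thesis by auto
qed

lemma xi_line_nonzero: "\<exists>z. xi_line q chi z \<noteq> 0"
proof -
  have "1 / 2 + \<i> * (- \<i> * (3 - 1 / 2)) = (3 :: complex)" by (simp add: complex_eq_iff)
  then have "xi_line q chi (- \<i> * (3 - 1 / 2)) = completed_L q chi 3"
    by (simp only: xi_line_def xi_eq_completed_L)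
  then show ?thesis using completed_L_3_nonzero by metis
qed

end

lemma xi_line_functional_equation:
  assumes q: "q > 1" and prim: "primitive_character q chi"
  shows "xi_line q chi z = root_number q chi * xi_line q (conj_character chi) (- z)"
proof -
  have "fourier_laplace (char_kernel q chi) z = (LINT y|lborel. char_kernel q chi (0 + (-1) * y) * exp (\<i> * z * of_real (0 + (-1) * y)))"
    unfolding fourier_laplace_def
    using lborel_integral_real_affine[of "-1" "\<lambda>y. char_kernel q chi y * exp (\<i> * z * of_real y)" 0] by simp
  also have "\<dots> = (LINT y|lborel. root_number q chi * (char_kernel q (conj_character chi) y * exp (\<i> * (- z) * of_real y)))"
    using char_kernel_functional_equation[OF prim q] by (simp add: mult.assoc)
  also have "\<dots> = root_number q chi * fourier_laplace (char_kernel q (conj_character chi)) (- z)"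
    unfolding fourier_laplace_def by (rule integral_mult_right_zero)
  finally show ?thesis
    by (simp only: xi_line_eq[OF q prim] xi_line_eq[OF q primitive_character_conj[OF prim]])
qed

text \<open>Apply the functional equation twice at a point where xi does not vanish. The root number
  is thereby nonzero, without an evaluation of the modulus of the Gauss sum.\<close>

lemma root_number_conj:
  assumes q: "q > 1" and prim: "primitive_character q chi"
  shows "root_number q chi * root_number q (conj_character chi) = 1"
proof -
  obtain z where z: "xi_line q chi z \<noteq> 0" using xi_line_nonzero[OF q prim] by blast
  have "xi_line q chi z = root_number q chi * (root_number q (conj_character chi) * xi_line q chi z)"
    using xi_line_functional_equation[OF q prim, of z]
      xi_line_functional_equation[OF q primitive_character_conj[OF prim], of "- z"] by simp
  then have "(root_number q chi * root_number q (conj_character chi)) * xi_line q chi z = 1 * xi_line q chi z"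
    by (simp add: mult.assoc)
  then show ?thesis using z by (simp only: mult_cancel_right) simp
qed

section \<open>Newton-type recurrence and Toeplitz determinants\<close>

text \<open>Compare coefficients of s^(2N+1) in F' = (F'/F) F. The coefficient of index 1 of F'/F is
  -2 b 1 / b 0 and is not a moment; it produces the product term with b 1 and b (n + 1).\<close>

lemma fps_logderiv_moment_recurrence:
  fixes F :: "'a::field_char_0 fps" and b m :: "nat \<Rightarrow> 'a"
  assumes even: "\<And>n. F $ (2 * n) = (-1) ^ n * b n" and odd: "\<And>n. F $ (2 * n + 1) = 0" and b0: "b 0 \<noteq> 0"
    and m: "\<And>k. m k = - (fps_logderiv F $ (2 * k + 3)) / 2"
  shows "(-1) ^ n * m n = b 1 * b (n + 1) / (b 0)\<^sup>2 - of_nat (n + 2) * b (n + 2) / b 0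
       - (\<Sum>k<n. (-1) ^ k * m k * b (n - k) / b 0)"
proof -
  define G where "G = fps_logderiv F"
  have "F $ 0 \<noteq> 0" using even[of 0] b0 by simp
  then have GF: "G * F = fps_deriv F"
    unfolding G_def fps_logderiv_def by (intro dvd_div_mult_self) (simp add: fps_is_unit_iff)
  have rec: "of_nat (2 * Suc N) * ((-1) ^ Suc N * b (Suc N)) = (\<Sum>j<Suc N. G $ (2 * j + 1) * ((-1) ^ (N - j) * b (N - j)))" for N
  proof -
    have "of_nat (2 * Suc N) * ((-1) ^ Suc N * b (Suc N)) = fps_deriv F $ (2 * N + 1)"
      using even[of "Suc N"] by (simp add: fps_deriv_nth)
    also have "\<dots> = (\<Sum>i=0..2 * N + 1. G $ i * F $ (2 * N + 1 - i))"
      unfolding GF[symmetric] by (rule fps_mult_nth)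
    \<comment> \<open>For even i the complementary index 2 N + 1 - i is odd, where F vanishes; only
      the odd coefficients of G remain.\<close>
    also have "\<dots> = (\<Sum>i\<in>(\<lambda>j. 2 * j + 1) ` {..<Suc N}. G $ i * F $ (2 * N + 1 - i))"
    proof (rule sum.mono_neutral_right)
      show "\<forall>i\<in>{0..2 * N + 1} - (\<lambda>j. 2 * j + 1) ` {..<Suc N}. G $ i * F $ (2 * N + 1 - i) = 0"
      proof
        fix i assume i: "i \<in> {0..2 * N + 1} - (\<lambda>j. 2 * j + 1) ` {..<Suc N}"
        have "even i"
        proof (rule ccontr)
          assume "odd i"
          then obtain j where "i = 2 * j + 1" by (elim oddE)
          with i show False by auto
        qed
        then obtain j where j: "i = 2 * j" by (elim evenE)
        then have "2 * N + 1 - i = 2 * (N - j) + 1" using i by auto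
        then show "G $ i * F $ (2 * N + 1 - i) = 0" using odd by simp
      qed
    qed auto
    also have "\<dots> = (\<Sum>j<Suc N. G $ (2 * j + 1) * F $ (2 * N + 1 - (2 * j + 1)))"
      by (subst sum.reindex) (auto simp: inj_on_def)
    also have "\<dots> = (\<Sum>j<Suc N. G $ (2 * j + 1) * ((-1) ^ (N - j) * b (N - j)))"
    proof (intro sum.cong refl)
      fix j assume "j \<in> {..<Suc N}"
      then have "2 * N + 1 - (2 * j + 1) = 2 * (N - j)" by auto
      then show "G $ (2 * j + 1) * F $ (2 * N + 1 - (2 * j + 1)) = G $ (2 * j + 1) * ((-1) ^ (N - j) * b (N - j))"
        by (simp only: even)
    qed
    finally show ?thesis .
  qed
  have G1: "G $ 1 = - 2 * b 1 / b 0" using rec[of 0] b0 by (simp add: field_simps)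
  then have G1': "- G $ 1 = 2 * b 1 / b 0" by simp
  have sgn: "(-1) ^ n * (-1) ^ n = (1 :: 'a)" by (simp flip: power_mult_distrib)
  have sgn': "(-1) ^ n * (-1) ^ (n - k) = ((-1) ^ k :: 'a)" if "k \<le> n" for k
  proof -
    have "(-1 :: 'a) ^ n = (-1) ^ k * (-1) ^ (n - k)" using that by (simp flip: power_add)
    moreover have "(-1) ^ (n - k) * (-1) ^ (n - k) = (1 :: 'a)" by (simp flip: power_mult_distrib)
    ultimately show ?thesis by (simp add: mult.assoc)
  qed
  \<comment> \<open>This is N = n + 1: the term j = 0 is split off, and the others have index 2 j +
    3 and are moments.\<close>
  have "of_nat (2 * (n + 2)) * ((-1) ^ n * b (n + 2)) = - G $ 1 * ((-1) ^ n * b (n + 1)) + (\<Sum>j<Suc n. G $ (2 * j + 3) * ((-1) ^ (n - j) * b (n - j)))"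
    using rec[of "Suc n"] by (subst (asm) sum.lessThan_Suc_shift) (simp add: numeral_3_eq_3 numeral_2_eq_2)
  also have "(\<Sum>j<Suc n. G $ (2 * j + 3) * ((-1) ^ (n - j) * b (n - j))) = - 2 * (\<Sum>j<Suc n. m j * ((-1) ^ (n - j) * b (n - j)))"
    unfolding sum_distrib_left by (intro sum.cong refl) (simp add: m G_def)
  finally have "(-1) ^ n * (of_nat (2 * (n + 2)) * ((-1) ^ n * b (n + 2))) = (-1) ^ n * (2 * b 1 / b 0 * ((-1) ^ n * b (n + 1)) - 2 * (\<Sum>j<Suc n. m j * ((-1) ^ (n - j) * b (n - j))))"
    by (simp only: G1' mult_minus_left add_uminus_conv_diff)
  moreover have "(-1) ^ n * (of_nat (2 * (n + 2)) * ((-1) ^ n * b (n + 2))) = 2 * (of_nat (n + 2) * b (n + 2))"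
  proof -
    have "(-1) ^ n * (of_nat (2 * (n + 2)) * ((-1) ^ n * b (n + 2))) = ((-1) ^ n * (-1) ^ n) * (of_nat (2 * (n + 2)) * b (n + 2))"
      by (simp only: mult_ac)
    then show ?thesis unfolding sgn by (simp add: algebra_simps)
  qed
  moreover have "(-1) ^ n * (2 * b 1 / b 0 * ((-1) ^ n * b (n + 1)) - 2 * (\<Sum>j<Suc n. m j * ((-1) ^ (n - j) * b (n - j))))
      = 2 * (b 1 * b (n + 1) / b 0 - (\<Sum>j<Suc n. (-1) ^ j * m j * b (n - j)))"
  proof -
    have "(-1) ^ n * (2 * b 1 / b 0 * ((-1) ^ n * b (n + 1))) = ((-1) ^ n * (-1) ^ n) * (2 * b 1 / b 0 * b (n + 1))"
      by (simp only: mult_ac)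
    moreover have "(-1) ^ n * (2 * (\<Sum>j<Suc n. m j * ((-1) ^ (n - j) * b (n - j)))) = 2 * (\<Sum>j<Suc n. (-1) ^ j * m j * b (n - j))"
      unfolding sum_distrib_left
    proof (intro sum.cong refl)
      fix j assume "j \<in> {..<Suc n}"
      then have "(-1) ^ n * (2 * (m j * ((-1) ^ (n - j) * b (n - j)))) = 2 * (((-1) ^ n * (-1) ^ (n - j)) * m j * b (n - j))"
        by (simp only: mult_ac)
      then show "(-1) ^ n * (2 * (m j * ((-1) ^ (n - j) * b (n - j)))) = 2 * ((-1) ^ j * m j * b (n - j))"
        using sgn'[of j] \<open>j \<in> {..<Suc n}\<close> by simp
    qed
    ultimately show ?thesis unfolding sgn right_diff_distrib by simp
  qed
  ultimately have "2 * (of_nat (n + 2) * b (n + 2)) = 2 * (b 1 * b (n + 1) / b 0 - (\<Sum>j<Suc n. (-1) ^ j * m j * b (n - j)))"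
    by (simp only:)
  then have "of_nat (n + 2) * b (n + 2) = b 1 * b (n + 1) / b 0 - (\<Sum>j<Suc n. (-1) ^ j * m j * b (n - j))"
    by (rule mult_left_cancel[THEN iffD1, OF zero_neq_numeral[symmetric]])
  then have "of_nat (n + 2) * b (n + 2) = b 1 * b (n + 1) / b 0 - ((\<Sum>j<n. (-1) ^ j * m j * b (n - j)) + (-1) ^ n * m n * b 0)"
    by (simp only: sum.lessThan_Suc diff_self_eq_0)
  then have "(-1) ^ n * m n * b 0 = b 1 * b (n + 1) / b 0 - of_nat (n + 2) * b (n + 2) - (\<Sum>j<n. (-1) ^ j * m j * b (n - j))"
    by (simp only: algebra_simps)
  then have "(-1) ^ n * m n = (b 1 * b (n + 1) / b 0 - of_nat (n + 2) * b (n + 2) - (\<Sum>j<n. (-1) ^ j * m j * b (n - j))) / b 0"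
    by (rule eq_divide_imp[OF b0])
  then show ?thesis by (simp add: diff_divide_distrib sum_divide_distrib power2_eq_square)
qed

text \<open>The recurrence says that a lower triangular Toeplitz matrix with unit diagonal maps the
  vector of the x i to that of the v i. Its determinant is 1, so Cramer's rule gives the last
  component as a determinant.\<close>

lemma toeplitz_recurrence_det:
  fixes c v x :: "nat \<Rightarrow> 'a::field"
  assumes c0: "c 0 = 1" and rec: "\<And>i. x i = v i - (\<Sum>k<i. x k * c (i - k))"
  shows "Determinant.det (replace_col (mat (n + 1) (n + 1) (\<lambda>(i, j). if j \<le> i then c (i - j) else 0))
            (vec (n + 1) v) n) = x n"
proof -
  define T where "T = mat (n + 1) (n + 1) (\<lambda>(i, j). if j \<le> i then c (i - j) else 0)"
  define X where "X = vec (n + 1) x"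
  have T: "T \<in> carrier_mat (n + 1) (n + 1)" by (simp add: T_def)
  have X: "X \<in> carrier_vec (n + 1)" by (simp add: X_def)
  have TX: "T *\<^sub>v X = vec (n + 1) v"
  proof (rule eq_vecI)
    fix i assume "i < dim_vec (vec (n + 1) v)"
    then have i: "i < n + 1" by simp
    have "vec_index (T *\<^sub>v X) i = (\<Sum>j\<in>{0..<n + 1}. (if j \<le> i then c (i - j) else 0) * x j)"
      using i by (simp add: T_def X_def scalar_prod_def)
    also have "\<dots> = (\<Sum>j\<in>{..<Suc i}. (if j \<le> i then c (i - j) else 0) * x j)"
      by (rule sum.mono_neutral_right) (use i in auto)
    also have "\<dots> = (\<Sum>j<i. x j * c (i - j)) + x i"
    proof -
      have "(\<Sum>j<i. (if j \<le> i then c (i - j) else 0) * x j) = (\<Sum>j<i. x j * c (i - j))"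
        by (intro sum.cong refl) auto
      then show ?thesis by (simp add: c0)
    qed
    also have "\<dots> = v i" using rec[of i] by simp
    finally show "vec_index (T *\<^sub>v X) i = vec_index (vec (n + 1) v) i" using i by simp
  qed (simp add: T_def)
  have "Determinant.det (replace_col T (T *\<^sub>v X) n) = vec_index X n * Determinant.det T"
    by (rule cramer_lemma_mat[OF T X]) simp
  moreover have "Determinant.det T = 1"
  proof -
    have "Determinant.det T = prod_list (diag_mat T)"
      by (rule det_lower_triangular[OF _ T]) (simp add: T_def)
    also have "diag_mat T = map (\<lambda>_. 1) [0..<n + 1]"
      unfolding diag_mat_def by (intro map_cong) (auto simp: T_def c0)
    also have "prod_list \<dots> = 1" by (induction n) auto
    finally show ?thesis .
  qed
  moreover have "vec_index X n = x n" by (simp add: X_def)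
  ultimately show ?thesis unfolding T_def[symmetric] TX[symmetric] by simp
qed

section \<open>Power series of entire functions\<close>

lemma entire_power_series:
  fixes g :: "complex \<Rightarrow> complex"
  assumes "g holomorphic_on UNIV"
  shows "(\<lambda>n. (deriv ^^ n) g 0 / fact n * s ^ n) sums g s"
  using holomorphic_power_series[of g 0 "norm s + 1" s] holomorphic_on_subset[OF assms] by simp

lemma entire_eq_if_fps_0:
  fixes g :: "complex \<Rightarrow> complex"
  assumes hol: "g holomorphic_on UNIV" and nz: "g z \<noteq> 0"
  shows "\<exists>n. (deriv ^^ n) g 0 \<noteq> 0"
proof (rule ccontr)
  assume "\<not> ?thesis"
  then have "(\<lambda>n. 0) sums g z" using entire_power_series[OF hol, of z] by simp
  then show False using nz sums_unique2[OF sums_zero] by metis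
qed

lemma entire_even_power_series:
  fixes g :: "complex \<Rightarrow> complex"
  assumes hol: "g holomorphic_on UNIV" and even: "\<And>s. g (- s) = g s"
  shows "fps_expansion g 0 $ (2 * n + 1) = 0"
    and "(\<lambda>n. fps_expansion g 0 $ (2 * n) * s ^ (2 * n)) sums g s"
proof -
  have G: "g has_fps_expansion fps_expansion g 0"
    by (rule has_fps_expansion_fps_expansion[OF open_UNIV _ hol]) simp
  have "(\<lambda>z. g (- z)) = g" by (simp add: even)
  then have "g has_fps_expansion Abs_fps (\<lambda>n. (-1) ^ n * fps_expansion g 0 $ n)"
    using has_fps_expansion_reflect[OF G] by simp
  then have "Abs_fps (\<lambda>n. (-1) ^ n * fps_expansion g 0 $ n) = fps_expansion g 0"
    using G fps_expansion_unique_complex by blast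
  then have "Abs_fps (\<lambda>n. (-1) ^ n * fps_expansion g 0 $ n) $ (2 * n + 1) = fps_expansion g 0 $ (2 * n + 1)" for n
    by simp
  then have odd: "fps_expansion g 0 $ (2 * n + 1) = 0" for n by (simp add: neg_equal_zero)
  then show "fps_expansion g 0 $ (2 * n + 1) = 0" .
  have "(\<lambda>n. fps_expansion g 0 $ n * s ^ n) sums g s"
    using entire_power_series[OF hol, of s] by (simp add: fps_expansion_def)
  moreover have "fps_expansion g 0 $ n * s ^ n = 0" if "n \<notin> range (\<lambda>n. 2 * n)" for n
  proof -
    have "odd n" using that by (auto elim!: evenE)
    then show ?thesis using odd by (auto elim!: oddE)
  qed
  ultimately show "(\<lambda>n. fps_expansion g 0 $ (2 * n) * s ^ (2 * n)) sums g s"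
    using sums_mono_reindex[of "\<lambda>n. 2 * n" "\<lambda>n. fps_expansion g 0 $ n * s ^ n"] by (simp add: strict_mono_def)
qed

text \<open>Dividing by z^k shifts the Taylor series; the shifted coefficients are part of the
  conclusion because the numbers a (n + \<mu>) are read off from them.\<close>

lemma entire_divide_power:
  fixes g :: "complex \<Rightarrow> complex"
  assumes hol: "g holomorphic_on UNIV" and low: "\<And>n. n < k \<Longrightarrow> (deriv ^^ n) g 0 = 0"
  obtains h where "h holomorphic_on UNIV" "\<And>z. g z = z ^ k * h z" "\<And>n. (deriv ^^ n) h 0 / fact n = (deriv ^^ (n + k)) g 0 / fact (n + k)"
proof -
  define A where "A = (\<lambda>n. (deriv ^^ (n + k)) g 0 / fact (n + k))"
  define h where "h = (\<lambda>z. \<Sum>n. A n * z ^ n)"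
  have g: "(\<lambda>n. A n * z ^ n * z ^ k) sums g z" for z
  proof -
    have "(\<lambda>n. (deriv ^^ n) g 0 / fact n * z ^ n) sums g z" by (rule entire_power_series[OF hol])
    then have "(\<lambda>n. (deriv ^^ (n + k)) g 0 / fact (n + k) * z ^ (n + k)) sums (g z - (\<Sum>n<k. (deriv ^^ n) g 0 / fact n * z ^ n))"
      by (rule sums_split_initial_segment)
    then show ?thesis using low by (simp add: A_def power_add mult.assoc)
  qed
  have summ: "summable (\<lambda>n. A n * z ^ n)" for z
  proof (cases "z = 0")
    case False
    then have "summable (\<lambda>n. A n * z ^ n * z ^ k * inverse (z ^ k))" by (intro summable_mult2[OF sums_summable[OF g]])
    then show ?thesis using False by (simp add: mult.assoc)
  qed (simp add: summable_0_powser)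
  have sums: "(\<lambda>n. A n * z ^ n) sums h z" for z unfolding h_def by (rule summable_sums[OF summ])
  have holh: "h holomorphic_on UNIV"
  proof -
    have "h holomorphic_on ball 0 (norm z + 1)" for z :: complex
      by (rule power_series_holomorphic[of _ _ A]) (use sums in simp)
    then have "h field_differentiable (at z)" for z
      by (rule holomorphic_on_imp_differentiable_at[where s = "ball 0 (norm z + 1)"]) auto
    then show ?thesis by (simp add: holomorphic_on_def field_differentiable_at_within)
  qed
  have "h has_fps_expansion Abs_fps A"
    by (rule has_fps_expansionI) (use sums in simp)
  then have nth: "(deriv ^^ n) h 0 / fact n = A n" for n
    using fps_nth_fps_expansion[of h "Abs_fps A" n] by simp
  have "g z = z ^ k * h z" for z
    using sums_unique2[OF g[of z] sums_mult2[OF sums[of z], of "z ^ k"]] by (simp add: mult.commute)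
  then show thesis using that[OF holh _ nth[unfolded A_def]] by blast
qed

section \<open>Moments of the completed L-function and the Riemann hypothesis\<close>

theorem corollary7:
  fixes q :: nat and chi :: "int \<Rightarrow> complex"
    and a b m :: "nat \<Rightarrow> complex" and \<mu> :: nat and f :: "complex \<Rightarrow> complex"
  assumes "q > 1" and "primitive_character q chi"
  defines "a \<equiv> xi_coeff q chi"
    and "\<mu> \<equiv> xi_order q chi"
    and "f \<equiv> xi_prod q chi"
    and "b \<equiv> xi_prod_coeff q chi"
    and "m \<equiv> logderiv_moment q chi"
  shows
    "((\<forall>s. (\<lambda>n. \<i> ^ n * a n * s ^ n) sums xi q chi (1 / 2 + \<i> * s)) \<and> a \<mu> \<noteq> 0) \<and>
     (f holomorphic_on UNIV \<and> (\<forall>s. f (- s) = f s) \<and>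
      (\<forall>s. s \<noteq> 0 \<longrightarrow> f s = xi q chi (1 / 2 + \<i> * s) * xi q (conj_character chi) (1 / 2 + \<i> * s)
                             / s ^ (2 * \<mu>)) \<and>
      (\<forall>s. (\<lambda>n. (-1) ^ n * b n * s ^ (2 * n)) sums f s) \<and> b 0 \<noteq> 0) \<and>
     (\<forall>n. m n = (-1) ^ n * Determinant.det
       (replace_col
         (mat (n + 1) (n + 1) (\<lambda>(i, j). if j \<le> i then b (i - j) / b 0 else 0))
         (vec (n + 1) (\<lambda>i. b 1 * b (i + 1) / (b 0)\<^sup>2 - of_nat (i + 2) * b (i + 2) / b 0))
         n)) \<and>
     (\<forall>n. (-1) ^ n * m n =
       b 1 * b (n + 1) / (b 0)\<^sup>2 - of_nat (n + 2) * b (n + 2) / b 0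
       - (\<Sum>k<n. (-1) ^ k * m k * b (n - k) / b 0)) \<and>
     (\<forall>n\<ge>1. b n / b 0 =
       (\<Sum>j\<le>2 * n. (-1) ^ j * (a (j + \<mu>) / a \<mu>) * (a (2 * n - j + \<mu>) / a \<mu>))) \<and>
     ((\<forall>n\<ge>1. b n / b 0 > 0) \<longrightarrow>
      (\<forall>s1. is_first_zero f s1 \<longrightarrow>
        (GRH q chi \<longleftrightarrow>
          (\<exists>L::real. L > 0 \<and> L > 1 / s1\<^sup>2 \<and>
            (\<forall>n k. (\<Sum>j\<le>k. (-1) ^ j * of_nat (k choose j) * (m (n + j) / of_real (L ^ (n + j))))
                   \<ge> 0)))))"

proof -
  define chi' where "chi' = conj_character chi"
  note q = assms(1) and prim = assms(2)
  have prim': "primitive_character q chi'" unfolding chi'_def by (rule primitive_character_conj[OF prim])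
  define X where "X = xi_line q chi"
  define X' where "X' = xi_line q chi'"
  \<comment> \<open>The root number of the conjugate character, because the functional equation is
    used to express X' through X.\<close>
  define \<epsilon> where "\<epsilon> = root_number q chi'"
  have holX: "X holomorphic_on UNIV" unfolding X_def by (rule holomorphic_xi_line[OF q prim])
  have X'X: "X' z = \<epsilon> * X (- z)" for z
    using xi_line_functional_equation[OF q prim'] by (simp add: X'_def X_def \<epsilon>_def chi'_def)
  have \<epsilon>: "\<epsilon> \<noteq> 0" using root_number_conj[OF q prim] by (auto simp: \<epsilon>_def chi'_def)
  have a: "(deriv ^^ n) X 0 / fact n = \<i> ^ n * a n" for n
    by (simp add: a_def xi_coeff_def X_def)
  obtain z0 where "X z0 \<noteq> 0" using xi_line_nonzero[OF q prim] by (auto simp: X_def)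
  then obtain n0 where n0: "a n0 \<noteq> 0"
    using entire_eq_if_fps_0[OF holX] by (auto simp: a_def xi_coeff_def X_def)
  have a\<mu>: "a \<mu> \<noteq> 0"
    unfolding \<mu>_def xi_order_def a_def by (rule LeastI) (use n0 a_def in simp)
  have low: "(deriv ^^ n) X 0 = 0" if "n < \<mu>" for n
  proof -
    have "a n = 0" using not_less_Least[of n "\<lambda>n. xi_coeff q chi n \<noteq> 0"] that by (simp add: \<mu>_def xi_order_def a_def)
    then show ?thesis using a[of n] by simp
  qed
  obtain Y where Y: "Y holomorphic_on UNIV" "\<And>z. X z = z ^ \<mu> * Y z"
    "\<And>n. (deriv ^^ n) Y 0 / fact n = (deriv ^^ (n + \<mu>)) X 0 / fact (n + \<mu>)"
    using entire_divide_power[OF holX low] by blast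
  have Ycoeff: "fps_expansion Y 0 $ n = \<i> ^ (n + \<mu>) * a (n + \<mu>)" for n
    using Y(3)[of n] a[of "n + \<mu>"] by (simp add: fps_expansion_def)
  \<comment> \<open>By X' z = \<epsilon> X (-z) and X z = z^\<mu> Y z the quotient in f is this
    function off 0. It is entire and visibly even, and removing the singularity at 0 gives f = g
    everywhere.\<close>
  define g where "g = (\<lambda>z. ((-1) ^ \<mu> * \<epsilon>) * (Y z * Y (- z)))"
  have holg: "g holomorphic_on UNIV"
  proof -
    have "(Y \<circ> uminus) holomorphic_on UNIV"
      by (rule holomorphic_on_compose_gen[OF _ Y(1)]) (auto intro!: holomorphic_intros)
    then show ?thesis unfolding g_def o_def by (intro holomorphic_intros Y(1))
  qed
  have Xg: "X z * X' z = z ^ (2 * \<mu>) * g z" for z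
  proof -
    have "X z * X' z = (z ^ \<mu> * (- z) ^ \<mu>) * (\<epsilon> * (Y z * Y (- z)))"
      by (simp only: X'X Y(2) mult_ac)
    also have "z ^ \<mu> * (- z) ^ \<mu> = z ^ (2 * \<mu>) * (-1) ^ \<mu>"
    proof -
      have "z ^ (2 * \<mu>) = z ^ \<mu> * z ^ \<mu>" by (simp only: mult_2 power_add)
      then show ?thesis by (simp only: power_minus[of z] mult_ac)
    qed
    finally show ?thesis by (simp only: g_def mult_ac)
  qed
  have fg: "f = g"
  proof
    fix z
    have "eventually (\<lambda>s. g s = X s * X' s / s ^ (2 * \<mu>)) (at z)"
    proof -
      have "eventually (\<lambda>s. s \<noteq> 0) (at z)"
        using eventually_neq_at_within[of 0 z UNIV] by simp
      then show ?thesis by eventually_elim (simp add: Xg)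
    qed
    moreover have "g \<midarrow>z\<rightarrow> g z"
      using holomorphic_on_imp_continuous_on[OF holg] by (simp add: continuous_on_eq_continuous_at isCont_def)
    ultimately have "(\<lambda>s. X s * X' s / s ^ (2 * \<mu>)) \<midarrow>z\<rightarrow> g z" by (rule Lim_transform_eventually[rotated])
    then show "f z = g z"
      unfolding f_def xi_prod_def X_def X'_def chi'_def \<mu>_def by (rule remove_sings_eqI)
  qed
  have holf: "f holomorphic_on UNIV" unfolding fg by (rule holg)
  have even: "f (- s) = f s" for s by (simp add: fg g_def mult.commute)
  define F where "F = fps_expansion f 0"
  have F: "f has_fps_expansion F"
    unfolding F_def by (rule has_fps_expansion_fps_expansion[OF open_UNIV _ holf]) simp
  have bF: "F $ (2 * n) = (-1) ^ n * b n" for n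
  proof -
    have "(-1) ^ n * ((-1) ^ n * x) = x" for x :: complex by (simp flip: mult.assoc power_mult_distrib)
    then show ?thesis by (simp add: b_def xi_prod_coeff_def f_def F_def fps_expansion_def)
  qed
  define c where "c = (\<lambda>n. a (n + \<mu>))"
  \<comment> \<open>K collects (-1)^\<mu> from (-z)^\<mu>, the root number, and i^(2 \<mu>) from the
    normalisation of the a n. It cancels in b n / b 0.\<close>
  define K where "K = (-1) ^ \<mu> * \<epsilon> * \<i> ^ (2 * \<mu>)"
  have K: "K \<noteq> 0" using \<epsilon> by (simp add: K_def)
  have b: "b n = K * (\<Sum>j\<le>2 * n. (-1) ^ j * c j * c (2 * n - j))" for n
  proof -
    define E where "E = fps_expansion Y 0"
    have E: "Y has_fps_expansion E"
      unfolding E_def by (rule has_fps_expansion_fps_expansion[OF open_UNIV _ Y(1)]) simp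
    have "g has_fps_expansion fps_const ((-1) ^ \<mu> * \<epsilon>) * (E * Abs_fps (\<lambda>n. (-1) ^ n * E $ n))"
      unfolding g_def by (intro fps_expansion_intros E has_fps_expansion_reflect)
    then have FE: "F = fps_const ((-1) ^ \<mu> * \<epsilon>) * (E * Abs_fps (\<lambda>n. (-1) ^ n * E $ n))"
      using F fps_expansion_unique_complex unfolding fg by blast
    have "F $ (2 * n) = ((-1) ^ \<mu> * \<epsilon>) * (\<Sum>i=0..2 * n. E $ (2 * n - i) * ((-1) ^ i * E $ i))"
    proof -
      have "F $ (2 * n) = ((-1) ^ \<mu> * \<epsilon>) * (Abs_fps (\<lambda>n. (-1) ^ n * E $ n) * E) $ (2 * n)"
        unfolding FE by (simp only: fps_mult_left_const_nth mult.commute[of E])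
      also have "(Abs_fps (\<lambda>n. (-1) ^ n * E $ n) * E) $ (2 * n) = (\<Sum>i=0..2 * n. E $ (2 * n - i) * ((-1) ^ i * E $ i))"
        unfolding fps_mult_nth by (intro sum.cong refl) (simp add: mult.commute)
      finally show ?thesis .
    qed
    also have "(\<Sum>i=0..2 * n. E $ (2 * n - i) * ((-1) ^ i * E $ i)) = (\<Sum>j\<le>2 * n. \<i> ^ (2 * \<mu>) * (-1) ^ n * ((-1) ^ j * c j * c (2 * n - j)))"
      unfolding atMost_atLeast0
    proof (intro sum.cong refl)
      fix j assume "j \<in> {0..2 * n}"
      \<comment> \<open>The powers of i combine to i^(2 n + 2 \<mu>) independently of j; the sign
        (-1)^j comes from Y (-z).\<close>
      then have "\<i> ^ (2 * n - j + \<mu>) * \<i> ^ (j + \<mu>) = \<i> ^ (2 * \<mu>) * \<i> ^ (2 * n)"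
        unfolding power_add[symmetric] by (intro arg_cong[of _ _ "(^) \<i>"]) auto
      also have "\<i> ^ (2 * n) = (-1) ^ n" by (simp add: power_mult)
      finally have i: "\<i> ^ (2 * n - j + \<mu>) * \<i> ^ (j + \<mu>) = \<i> ^ (2 * \<mu>) * (-1) ^ n" .
      have "E $ (2 * n - j) * ((-1) ^ j * E $ j) = (\<i> ^ (2 * n - j + \<mu>) * \<i> ^ (j + \<mu>)) * ((-1) ^ j * c j * c (2 * n - j))"
        by (simp only: E_def Ycoeff c_def mult_ac)
      then show "E $ (2 * n - j) * ((-1) ^ j * E $ j) = \<i> ^ (2 * \<mu>) * (-1) ^ n * ((-1) ^ j * c j * c (2 * n - j))"
        by (simp only: i)
    qed
    finally have "(-1) ^ n * b n = (-1) ^ n * (K * (\<Sum>j\<le>2 * n. (-1) ^ j * c j * c (2 * n - j)))"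
      unfolding bF sum_distrib_left[symmetric] K_def by (simp only: mult_ac)
    then show ?thesis by simp
  qed
  have b0: "b 0 = K * (a \<mu> * a \<mu>)" using b[of 0] by (simp add: c_def)
  have b0_nz: "b 0 \<noteq> 0" using K a\<mu> by (simp add: b0)
  have f0: "f 0 \<noteq> 0"
    using has_fps_expansion_imp_0_eq_fps_nth_0[OF F] bF[of 0] b0_nz by simp
  have F0: "F $ 0 \<noteq> 0" using bF[of 0] b0_nz by simp
  have m: "m k = - (fps_logderiv F $ (2 * k + 3)) / 2" for k
  proof -
    have "fps_logderiv F $ (2 * k + 3) = (deriv ^^ (2 * k + 3)) (\<lambda>s. deriv f s / f s) 0 / fact (2 * k + 3)"
      by (rule fps_nth_fps_expansion[OF has_fps_expansion_logderiv[OF F F0]])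
    then show ?thesis by (simp add: m_def logderiv_moment_def f_def)
  qed
  have odd: "F $ (2 * n + 1) = 0" for n
    unfolding F_def by (rule entire_even_power_series(1)[OF holf even])
  have rec: "(-1) ^ n * m n = b 1 * b (n + 1) / (b 0)\<^sup>2 - of_nat (n + 2) * b (n + 2) / b 0
       - (\<Sum>k<n. (-1) ^ k * m k * b (n - k) / b 0)" for n
    by (rule fps_logderiv_moment_recurrence[OF bF odd b0_nz m])
  have det: "m n = (-1) ^ n * Determinant.det
       (replace_col
         (mat (n + 1) (n + 1) (\<lambda>(i, j). if j \<le> i then b (i - j) / b 0 else 0))
         (vec (n + 1) (\<lambda>i. b 1 * b (i + 1) / (b 0)\<^sup>2 - of_nat (i + 2) * b (i + 2) / b 0))
         n)" for n
  proof -
    have "Determinant.det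
       (replace_col
         (mat (n + 1) (n + 1) (\<lambda>(i, j). if j \<le> i then b (i - j) / b 0 else 0))
         (vec (n + 1) (\<lambda>i. b 1 * b (i + 1) / (b 0)\<^sup>2 - of_nat (i + 2) * b (i + 2) / b 0))
         n) = (-1) ^ n * m n"
    proof (rule toeplitz_recurrence_det[where x = "\<lambda>n. (-1) ^ n * m n" and c = "\<lambda>n. b n / b 0"])
      show "b 0 / b 0 = 1" using b0_nz by simp
      show "(-1) ^ i * m i = b 1 * b (i + 1) / (b 0)\<^sup>2 - of_nat (i + 2) * b (i + 2) / b 0 - (\<Sum>k<i. (-1) ^ k * m k * (b (i - k) / b 0))" for i
        using rec[of i] by simp
    qed
    then show ?thesis by (simp flip: mult.assoc power_mult_distrib)
  qed
  have ratio: "b n / b 0 = (\<Sum>j\<le>2 * n. (-1) ^ j * (a (j + \<mu>) / a \<mu>) * (a (2 * n - j + \<mu>) / a \<mu>))" for n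
  proof -
    have "b n / b 0 = (\<Sum>j\<le>2 * n. (-1) ^ j * c j * c (2 * n - j)) / (a \<mu> * a \<mu>)"
      unfolding b[of n] b0 using K by simp
    also have "\<dots> = (\<Sum>j\<le>2 * n. (-1) ^ j * (a (j + \<mu>) / a \<mu>) * (a (2 * n - j + \<mu>) / a \<mu>))"
      unfolding sum_divide_distrib c_def by (intro sum.cong refl) simp
    finally show ?thesis .
  qed
  have f_eq: "f s = X s * X' s / s ^ (2 * \<mu>)" if "s \<noteq> 0" for s
    using that by (simp add: fg Xg)
  \<comment> \<open>For |z| >= 1 the division by z^(2 \<mu>) does not increase the modulus; the
    summand 1 in the constant keeps it positive.\<close>
  have growth: "\<exists>C>0. \<forall>z. norm z \<ge> 1 \<longrightarrow> norm (f z) \<le> C * exp (1 * norm z ^ 2)"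
  proof -
    obtain B where B: "\<And>z. norm (X z) \<le> B * exp (norm z ^ 2 / 2)"
      using xi_line_growth[OF q prim] unfolding X_def by blast
    have B0: "B \<ge> 0" using order_trans[OF norm_ge_zero B[of 0]] by simp
    have "norm (f z) \<le> (norm \<epsilon> * B\<^sup>2 + 1) * exp (1 * norm z ^ 2)" if z: "norm z \<ge> 1" for z
    proof -
      have "norm (f z) \<le> norm (X z * X' z)"
      proof -
        have "1 * norm (f z) \<le> norm z ^ (2 * \<mu>) * norm (f z)"
          using z by (intro mult_right_mono one_le_power) auto
        then show ?thesis unfolding Xg fg by (simp add: norm_mult norm_power)
      qed
      also have "\<dots> = norm \<epsilon> * (norm (X z) * norm (X (- z)))" by (simp add: X'X norm_mult)
      also have "\<dots> \<le> norm \<epsilon> * ((B * exp (norm z ^ 2 / 2)) * (B * exp (norm z ^ 2 / 2)))"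
        using B[of z] B[of "- z"] B0 by (intro mult_left_mono mult_mono) auto
      also have "\<dots> = norm \<epsilon> * B\<^sup>2 * exp (1 * norm z ^ 2)"
      proof -
        have "exp (norm z ^ 2 / 2) * exp (norm z ^ 2 / 2) = exp (1 * norm z ^ 2)"
          unfolding exp_add[symmetric] by simp
        moreover have "norm \<epsilon> * ((B * e) * (B * e)) = norm \<epsilon> * B\<^sup>2 * (e * e)" for e
          by (simp add: power2_eq_square)
        ultimately show ?thesis by (simp only:)
      qed
      also have "\<dots> \<le> (norm \<epsilon> * B\<^sup>2 + 1) * exp (1 * norm z ^ 2)" by (intro mult_right_mono) auto
      finally show ?thesis .
    qed
    moreover have "norm \<epsilon> * B\<^sup>2 + 1 > 0" by (intro add_nonneg_pos mult_nonneg_nonneg) auto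
    ultimately show ?thesis by blast
  qed
  \<comment> \<open>Zeros of f are nonzero and are zeros of X or negatives of such. Conversely a
    nonzero zero of X is a zero of f, and a zero of X at 0 is real anyway.\<close>
  have GRH_f: "GRH q chi \<longleftrightarrow> (\<forall>z. f z = 0 \<longrightarrow> z \<in> \<real>)"
  proof
    assume G: "GRH q chi"
    show "\<forall>z. f z = 0 \<longrightarrow> z \<in> \<real>"
    proof (intro allI impI)
      fix z assume z: "f z = 0"
      have "z \<noteq> 0" using z f0 by auto
      then have "X z = 0 \<or> X (- z) = 0" using f_eq[of z] z \<epsilon> by (auto simp: X'X)
      then have "z \<in> \<real> \<or> - z \<in> \<real>" using G by (auto simp: GRH_def X_def)
      then show "z \<in> \<real>" using Reals_minus_iff by blast
    qed
  next
    assume f: "\<forall>z. f z = 0 \<longrightarrow> z \<in> \<real>"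
    show "GRH q chi"
      unfolding GRH_def
    proof (intro allI impI)
      fix z assume "xi_line q chi z = 0"
      then show "z \<in> \<real>" using f f_eq[of z] by (cases "z = 0") (auto simp: X_def)
    qed
  qed
  have equiv: "GRH q chi \<longleftrightarrow>
          (\<exists>L::real. L > 0 \<and> L > 1 / s1\<^sup>2 \<and>
            (\<forall>n k. (\<Sum>j\<le>k. (-1) ^ j * of_nat (k choose j) * (m (n + j) / of_real (L ^ (n + j)))) \<ge> 0))"
    if s1: "is_first_zero f s1" for s1
  proof
    assume "GRH q chi"
    then have real: "\<And>z. f z = 0 \<Longrightarrow> z \<in> \<real>" using GRH_f by blast
    have s1_pos: "s1 > 0" using s1 by (simp add: is_first_zero_def)
    \<comment> \<open>Any number above 1 / s1^2 would do: once all zeros are real, evenness gives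
      |x| >= s1 for each zero x, hence x^2 L >= 1.\<close>
    define L where "L = 1 / s1\<^sup>2 + 1"
    have L: "L > 0" "L > 1 / s1\<^sup>2" using s1_pos by (auto simp: L_def add_pos_pos)
    obtain C where C: "C > 0" "\<And>z. norm z \<ge> 1 \<Longrightarrow> norm (f z) \<le> C * exp (1 * norm z ^ 2)" using growth by blast
    have zeros: "\<exists>x::real. z = of_real x \<and> x\<^sup>2 * L \<ge> 1" if z: "f z = 0" for z
    proof -
      obtain x where x: "z = of_real x" using real[OF z] by (auto elim: Reals_cases)
      have "x \<noteq> 0" using x z f0 by auto
      have "s1 \<le> \<bar>x\<bar>"
      proof (cases "x > 0")
        case True
        then show ?thesis using s1 z x by (auto simp: is_first_zero_def)
      next
        case False
        then have "Re (- z) > 0" using x \<open>x \<noteq> 0\<close> by simp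
        moreover have "f (- z) = 0" using even z by simp
        ultimately have "s1 \<le> Re (- z)" using s1 unfolding is_first_zero_def by blast
        then show ?thesis using x by simp
      qed
      then have "s1\<^sup>2 \<le> x\<^sup>2" using s1_pos by (metis abs_le_square_iff abs_of_pos)
      then have "s1\<^sup>2 * (1 / s1\<^sup>2) \<le> x\<^sup>2 * L" using L s1_pos by (intro mult_mono) auto
      then show ?thesis using x s1_pos by auto
    qed
    show "\<exists>L::real. L > 0 \<and> L > 1 / s1\<^sup>2 \<and>
            (\<forall>n k. (\<Sum>j\<le>k. (-1) ^ j * of_nat (k choose j) * (m (n + j) / of_real (L ^ (n + j)))) \<ge> 0)"
      using L real_zeros_imp_moment_differences_nonneg[OF holf f0 F C zeros L(1) m] by blast
  next
    assume "\<exists>L::real. L > 0 \<and> L > 1 / s1\<^sup>2 \<and>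
            (\<forall>n k. (\<Sum>j\<le>k. (-1) ^ j * of_nat (k choose j) * (m (n + j) / of_real (L ^ (n + j)))) \<ge> 0)"
    then obtain L :: real where L: "L > 0"
      "\<And>n k. (\<Sum>j\<le>k. (-1) ^ j * of_nat (k choose j) * (m (n + j) / of_real (L ^ (n + j)))) \<ge> 0" by blast
    show "GRH q chi"
      unfolding GRH_f using moment_differences_nonneg_imp_real_zeros[OF holf f0 F even m L] by blast
  qed
  have part1: "(\<lambda>n. \<i> ^ n * a n * s ^ n) sums xi q chi (1 / 2 + \<i> * s)" for s
    using entire_power_series[OF holX, of s] unfolding a by (simp add: X_def xi_line_def)
  have part2: "(\<lambda>n. (-1) ^ n * b n * s ^ (2 * n)) sums f s" for s
    using entire_even_power_series(2)[OF holf even, of s] by (simp add: F_def[symmetric] bF)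
  have part3: "f s = xi q chi (1 / 2 + \<i> * s) * xi q (conj_character chi) (1 / 2 + \<i> * s) / s ^ (2 * \<mu>)" if "s \<noteq> 0" for s
    using f_eq[OF that] by (simp add: X_def X'_def chi'_def xi_line_def)
  show ?thesis
    by (intro conjI allI impI) (fact part1 a\<mu> holf even part2 b0_nz det rec ratio | erule part3 | rule ratio | erule equiv)+
qed

end
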